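(* Let $k,l$ be integers with $1\le k<l$ such that both of the following conditions fail: (i) $(l+1)/(l-k)$ is not a positive integer; (ii) both $l-k$ and $(l+1)/(l-k)$ are odd integers. Then there are values of $\zeta\in\mathbb{C}$ such that the equation $$-f''(x)+\left(x^l-x^k\zeta\right)^2f(x)=0,\qquad x\in\mathbb{R},$$ has a solution $f\in L^\infty(\mathbb{R})$, $f\not\equiv0$. Moreover, an array $(\zeta_M)$ of such values of $\zeta$, indexed by all large enough $M\in\mathbb{Z}_+$, satisfies $$\zeta_M=e^{\frac{i\pi(l-k)}{2(l+1)}}\left[M\,\frac{\pi(l+1)(k+1)}{l-k}\right]^{\frac{l-k}{l+1}}\left[1+O\left(M^{-1}\right)\right]\qquad(M\to+\infty).$$ *)

theory Defs
  imports "HOL-Analysis.Analysis" "HOL-Library.Landau_Symbols"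
begin

definition Linfty :: "(real \<Rightarrow> complex) set" where
  "Linfty = {f \<in> borel_measurable lebesgue. \<exists>C. AE x in lebesgue. cmod (f x) \<le> C}"

text \<open>Solutions are classical: the coefficient is polynomial in \<open>x\<close>, so every
  distributional solution on the line is smooth after modification on a null set.\<close>

definition solves_ode :: "nat \<Rightarrow> nat \<Rightarrow> complex \<Rightarrow> (real \<Rightarrow> complex) \<Rightarrow> bool" where
  "solves_ode k l \<zeta> f \<longleftrightarrow>
    (\<exists>f' f''. \<forall>x::real.
       (f has_vector_derivative f' x) (at x) \<and>
       (f' has_vector_derivative f'' x) (at x) \<and>
       - f'' x + (complex_of_real x ^ l - complex_of_real x ^ k * \<zeta>)\<^sup>2 * f x = 0)"

definition admits_bounded_solution :: "nat \<Rightarrow> nat \<Rightarrow> complex \<Rightarrow> bool" where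
  "admits_bounded_solution k l \<zeta> \<longleftrightarrow>
    (\<exists>f. solves_ode k l \<zeta> f \<and> f \<in> Linfty \<and> (\<exists>x. f x \<noteq> 0))"

definition cond_i :: "nat \<Rightarrow> nat \<Rightarrow> bool" where
  "cond_i k l \<longleftrightarrow> \<not> (\<exists>m::int. m > 0 \<and> (real l + 1) / (real l - real k) = of_int m)"

definition cond_ii :: "nat \<Rightarrow> nat \<Rightarrow> bool" where
  "cond_ii k l \<longleftrightarrow>
    odd (int l - int k) \<and> (\<exists>m::int. odd m \<and> (real l + 1) / (real l - real k) = of_int m)"

definition leading_term :: "nat \<Rightarrow> nat \<Rightarrow> nat \<Rightarrow> complex" where
  "leading_term k l M =
    exp (\<i> * of_real (pi * (real l - real k) / (2 * (real l + 1)))) *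
    of_real ((real M * (pi * (real l + 1) * (real k + 1) / (real l - real k)))
               powr ((real l - real k) / (real l + 1)))"

end

(* Up to a constant there is one solution of the equation that decays at +infinity. Normalised by its WKB
   asymptotics, its value and derivative at 0 are entire functions fa, fb of zeta. By the reflection x -> -x
   there is a bounded solution on the whole line wherever fa vanishes (l, k odd), or where the Wronskian of the
   two one-sided decaying solutions vanishes (l odd, k even).

   Rotating the variable by e^(i pi/(l+1)) maps zeta to a rotated zeta and gives another subdominant solution;
   consecutive ones have a constant Wronskian (quantum_wronskian). The Wronskians E1, E2 of next-to-adjacent
   solutions satisfy a Plucker relation by which E1 E2 is nearly constant, so that E1 is zero-free for large
   zeta in the sector; in the variable W = zeta^((l+1)/(l-k)) the sector becomes a half plane.
   On the positive axis E1 is exponentially large, on the imaginary W-axis |E1| and |E2| agree, and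
   Phragmen-Lindelof makes E1 exponentially large to the right of that axis. A quotient built from E1 omits 0,
   is bounded at iN, grows exponentially to the right and equals 1 exactly at the eigenvalues; by Schottky's
   theorem it takes the value 1 within a bounded distance of iN. Taking N = pi M (l+1)(k+1)/(l-k) gives the array. *)

theory Submission
  imports Defs "HOL-Complex_Analysis.Complex_Analysis"
begin

section \<open>Power series solutions\<close>

text \<open>In the variable W a factor 1 + O(1/M) on zeta is a displacement by O(1). So no
  quantization condition is derived and no eigenvalues are counted: a zero within a fixed distance
  of every large iN suffices, and this is what Schottky's theorem can deliver. The hypotheses make m
  = (l+1)/(l-k) an integer with m >= 2. Hence zeta is rotated by \<open>\<theta>\<close> = pi/m <=
  pi/2, which keeps the outer rotations of zeta at angular distance at least \<open>\<theta>\<close>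
  from the positive axis, where \<open>fa\<close> and \<open>fb\<close> have simple asymptotics.
  Moreover l - k or m is even, so l is odd, and reflection preserves the equation up to the sign of
  zeta. The obstacle is the analysis off the real line. It is met by keeping x real and making the
  coefficients complex: in Q = A x^l + B x^k both A and B are free, a rotated half-line becomes a
  change of (A, B), and all limits are taken along one half-line. The estimates ask only for Re Q >=
  0, so they reach the ray where Q is imaginary; there the rotated solution is a complex conjugate
  and the Wronskian is a conserved flux.\<close>

fun ode_coeff :: "nat \<Rightarrow> nat \<Rightarrow> complex \<Rightarrow> complex \<Rightarrow> complex \<Rightarrow> complex \<Rightarrow> nat \<Rightarrow> complex" where
  "ode_coeff k l A B p q 0 = p"
| "ode_coeff k l A B p q (Suc 0) = q"
| "ode_coeff k l A B p q (Suc (Suc n)) =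
     (A\<^sup>2 * (if 2 * l \<le> n then ode_coeff k l A B p q (n - 2 * l) else 0) +
      2 * A * B * (if l + k \<le> n then ode_coeff k l A B p q (n - (l + k)) else 0) +
      B\<^sup>2 * (if 2 * k \<le> n then ode_coeff k l A B p q (n - 2 * k) else 0)) /
     of_nat (Suc (Suc n) * Suc n)"

locale exponents =
  fixes k l :: nat
  assumes k_pos: "1 \<le> k" and k_less_l: "k < l"
begin

definition Q :: "complex \<Rightarrow> complex \<Rightarrow> complex \<Rightarrow> complex" where
  "Q A B z = A * z ^ l + B * z ^ k"

abbreviation coeff :: "complex \<Rightarrow> complex \<Rightarrow> complex \<Rightarrow> complex \<Rightarrow> nat \<Rightarrow> complex" where
  "coeff \<equiv> ode_coeff k l"

definition sol_fps :: "complex \<Rightarrow> complex \<Rightarrow> complex \<Rightarrow> complex \<Rightarrow> complex fps" where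
  "sol_fps A B p q = Abs_fps (coeff A B p q)"

definition sol :: "complex \<Rightarrow> complex \<Rightarrow> complex \<Rightarrow> complex \<Rightarrow> complex \<Rightarrow> complex" where
  "sol A B p q z = eval_fps (sol_fps A B p q) z"

definition sol' :: "complex \<Rightarrow> complex \<Rightarrow> complex \<Rightarrow> complex \<Rightarrow> complex \<Rightarrow> complex" where
  "sol' A B p q z = eval_fps (fps_deriv (sol_fps A B p q)) z"

text \<open>One step of the recurrence multiplies the weighted size by at most \<open>V\<close> and
  divides it by n(n-1). Once the index passes \<open>N0\<close> >= \<open>V\<close> the divisor pays
  for the factor, so only about the first \<open>N0\<close> steps can grow; hence the exponent
  \<open>min n N0\<close>. Uniformity over a ball of coefficients is what later gives continuous and
  holomorphic dependence on A and B.\<close>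

lemma coeff_geometric_bound:
  fixes \<rho> N :: real
  assumes \<rho>: "\<rho> \<ge> 1"
  shows "\<exists>C\<ge>0. \<forall>A B n. cmod A \<le> N \<longrightarrow> cmod B \<le> N \<longrightarrow> cmod (coeff A B p q n) * \<rho> ^ n \<le> C"
proof -
  \<comment> \<open>4 = 1 + 2 + 1 adds the weights of the terms with \<open>A\<^sup>2\<close>,
    \<open>A * B\<close> and \<open>B\<^sup>2\<close>; 2l + 2 is the farthest that the recurrence
    reaches back.\<close>
  define V where "V = max 1 (4 * N\<^sup>2 * \<rho> ^ (2 * l + 2))"
  define T where "T = cmod p + cmod q * \<rho>"
  obtain N0 :: nat where N0: "real N0 \<ge> V" using real_arch_simple by blast
  have V1: "V \<ge> 1" unfolding V_def by simp
  have T0: "T \<ge> 0" unfolding T_def using \<rho> by simp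
  have main: "cmod (coeff A B p q n) * \<rho> ^ n \<le> T * V ^ (min n N0)"
    if A: "cmod A \<le> N" and B: "cmod B \<le> N" for A B n
  proof (induction n rule: less_induct)
    case (less n)
    have N: "N \<ge> 0" using A norm_ge_zero[of A] by linarith
    consider "n = 0" | "n = Suc 0" | j where "n = Suc (Suc j)" by (metis not0_implies_Suc)
    then show ?case
    proof cases
      case 1 then show ?thesis using \<rho> by (simp add: T_def)
    next
      case 2
      have "T \<le> T * V ^ i" for i using T0 V1 by (simp add: mult_le_cancel_left1)
      moreover have "cmod q * \<rho> \<le> T" by (simp add: T_def)
      ultimately show ?thesis using 2 by (simp add: order_trans)
    next
      case 3
      define D where "D = T * V ^ (min j N0)"
      have D0: "D \<ge> 0" unfolding D_def using T0 V1 by simp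
      have sub: "cmod (if e \<le> j then coeff A B p q (j - e) else 0) * \<rho> ^ n \<le> D * \<rho> ^ (2 * l + 2)"
        if e: "e \<le> 2 * l" for e
      proof (cases "e \<le> j")
        case True
        have "cmod (coeff A B p q (j - e)) * \<rho> ^ n =
              cmod (coeff A B p q (j - e)) * \<rho> ^ (j - e) * \<rho> ^ (e + 2)"
          using True 3 by (simp add: power_add[symmetric])
        also have "\<dots> \<le> D * \<rho> ^ (2 * l + 2)"
        proof (rule mult_mono)
          have "cmod (coeff A B p q (j - e)) * \<rho> ^ (j - e) \<le> T * V ^ (min (j - e) N0)"
            using less.IH[of "j - e"] 3 by simp
          also have "\<dots> \<le> D" unfolding D_def using T0 V1
            by (intro mult_left_mono power_increasing) auto
          finally show "cmod (coeff A B p q (j - e)) * \<rho> ^ (j - e) \<le> D" .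
          show "\<rho> ^ (e + 2) \<le> \<rho> ^ (2 * l + 2)" using e \<rho> by (intro power_increasing) auto
        qed (use D0 \<rho> in auto)
        finally show ?thesis using True by simp
      next
        case False then show ?thesis using D0 \<rho> by simp
      qed
      let ?c = "\<lambda>e. if e \<le> j then coeff A B p q (j - e) else 0"
      have AB: "cmod A ^ 2 \<le> N\<^sup>2" "cmod (A * B) \<le> N\<^sup>2" "cmod B ^ 2 \<le> N\<^sup>2"
        using A B N by (auto simp: norm_mult power2_eq_square intro!: mult_mono)
      have "cmod (A\<^sup>2 * ?c (2*l) + 2 * A * B * ?c (l+k) + B\<^sup>2 * ?c (2*k)) * \<rho> ^ n
        \<le> (cmod A ^ 2 * cmod (?c (2*l)) + 2 * cmod (A * B) * cmod (?c (l+k)) + cmod B ^ 2 * cmod (?c (2*k))) * \<rho> ^ n"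
        using \<rho> by (intro mult_right_mono norm_triangle_le add_mono)
          (auto simp: norm_mult norm_power)
      also have "\<dots> = cmod A ^ 2 * (cmod (?c (2*l)) * \<rho> ^ n) + 2 * (cmod (A * B) * (cmod (?c (l+k)) * \<rho> ^ n)) + cmod B ^ 2 * (cmod (?c (2*k)) * \<rho> ^ n)"
        by (simp add: algebra_simps)
      also have "\<dots> \<le> N\<^sup>2 * (D * \<rho> ^ (2*l+2)) + 2 * (N\<^sup>2 * (D * \<rho> ^ (2*l+2))) + N\<^sup>2 * (D * \<rho> ^ (2*l+2))"
        using k_less_l \<rho> by (intro add_mono mult_mono mult_left_mono AB sub) (auto intro!: mult_nonneg_nonneg D0)
      also have "\<dots> \<le> D * V"
      proof -
        have "D * (4 * N\<^sup>2 * \<rho> ^ (2 * l + 2)) \<le> D * V"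
          using D0 unfolding V_def by (intro mult_left_mono) auto
        then show ?thesis by (simp add: algebra_simps)
      qed
      finally have S: "cmod (A\<^sup>2 * ?c (2*l) + 2 * A * B * ?c (l+k) + B\<^sup>2 * ?c (2*k)) * \<rho> ^ n \<le> D * V" .
      have "cmod (coeff A B p q n) * \<rho> ^ n =
         cmod (A\<^sup>2 * ?c (2*l) + 2 * A * B * ?c (l+k) + B\<^sup>2 * ?c (2*k)) * \<rho> ^ n / real (Suc (Suc j) * Suc j)"
        unfolding 3 by (simp only: ode_coeff.simps norm_divide norm_of_nat) simp
      also have "\<dots> \<le> D * V / real (Suc (Suc j) * Suc j)"
        by (rule divide_right_mono[OF S]) simp
      also have "\<dots> \<le> T * V ^ (min n N0)"
      proof (cases "j < N0")
        case True
        have "D * V / real (Suc (Suc j) * Suc j) \<le> D * V"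
          using D0 V1 mult_left_mono[of 1 "real (Suc (Suc j) * Suc j)" "D * V"]
          by (simp add: divide_le_eq del: of_nat_mult of_nat_Suc)
        also have "\<dots> = T * V ^ (Suc (min j N0))" by (simp add: D_def)
        also have "\<dots> \<le> T * V ^ (min n N0)" using T0 V1 True 3
          by (intro mult_left_mono power_increasing) auto
        finally show ?thesis .
      next
        case False
        have "V \<le> real (Suc (Suc j) * Suc j)"
        proof -
          have "N0 \<le> Suc (Suc j) * Suc j" using False by (simp add: algebra_simps)
          then show ?thesis using N0 by linarith
        qed
        then have "D * V \<le> D * real (Suc (Suc j) * Suc j)"
          using D0 by (intro mult_left_mono)
        then have "D * V / real (Suc (Suc j) * Suc j) \<le> D"
          by (simp add: divide_le_eq del: of_nat_mult of_nat_Suc)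
        also have "D = T * V ^ (min n N0)" using False 3 by (simp add: D_def min_def)
        finally show ?thesis .
      qed
      finally show ?thesis .
    qed
  qed
  show ?thesis
  proof (intro exI[of _ "T * V ^ N0"] conjI allI impI)
    show "0 \<le> T * V ^ N0" using T0 V1 by simp
    fix A B n assume AB: "cmod A \<le> N" "cmod B \<le> N"
    have "T * V ^ (min n N0) \<le> T * V ^ N0"
      using T0 V1 by (intro mult_left_mono power_increasing) auto
    then show "cmod (coeff A B p q n) * \<rho> ^ n \<le> T * V ^ N0"
      using main[OF AB, of n] by linarith
  qed
qed

lemma sol_fps_conv_radius [simp]: "fps_conv_radius (sol_fps A B p q) = \<infinity>"
proof -
  have "conv_radius (coeff A B p q) = \<infinity>"
  proof (rule conv_radius_inftyI'')
    fix z :: complex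
    define \<rho> where "\<rho> = 2 * (cmod z + 1)"
    have \<rho>: "\<rho> \<ge> 1" unfolding \<rho>_def by (simp add: add_increasing)
    define N where "N = max (cmod A) (cmod B)"
    obtain C where C: "\<And>n. cmod (coeff A B p q n) * \<rho> ^ n \<le> C"
      using coeff_geometric_bound[OF \<rho>, of N p q] unfolding N_def by (metis max.cobounded1 max.cobounded2)
    show "summable (\<lambda>n. coeff A B p q n * z ^ n)"
    proof (rule summable_comparison_test'[of "\<lambda>n. C * (1/2) ^ n" 0])
      show "summable (\<lambda>n. C * (1/2) ^ n)" by (intro summable_mult summable_geometric) simp
      fix n
      have "norm (coeff A B p q n * z ^ n) \<le> cmod (coeff A B p q n) * (\<rho> * (1/2)) ^ n"
        unfolding norm_mult norm_power by (intro mult_left_mono power_mono) (auto simp: \<rho>_def)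
      also have "\<dots> = cmod (coeff A B p q n) * \<rho> ^ n * (1/2) ^ n"
        by (simp only: power_mult_distrib mult.assoc)
      also have "\<dots> \<le> C * (1/2)^n" using C[of n] by (intro mult_right_mono) auto
      finally show "norm (coeff A B p q n * z ^ n) \<le> C * (1/2)^n" .
    qed
  qed
  then show ?thesis by (simp add: fps_conv_radius_def sol_fps_def)
qed

lemma sol_fps_deriv_conv_radius [simp]: "fps_conv_radius (fps_deriv (sol_fps A B p q)) = \<infinity>"
  using fps_conv_radius_deriv[of "sol_fps A B p q"] by simp

lemma sol_0 [simp]: "sol A B p q 0 = p" "sol' A B p q 0 = q"
  by (simp_all add: sol_def sol'_def eval_fps_at_0 sol_fps_def)

lemma sol_has_field_derivative:
  "(sol A B p q has_field_derivative sol' A B p q z) (at z within S)"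
  unfolding sol_def[abs_def] sol'_def by (rule has_field_derivative_eval_fps) simp

lemma sol_fps_ode:
  "fps_deriv (fps_deriv (sol_fps A B p q)) =
     (fps_const A * fps_X ^ l + fps_const B * fps_X ^ k)\<^sup>2 * sol_fps A B p q"
proof (rule fps_ext)
  fix n
  let ?S = "sol_fps A B p q"
  have e: "(fps_const A * fps_X ^ l + fps_const B * fps_X ^ k)\<^sup>2 * ?S =
     fps_const (A\<^sup>2) * (fps_X ^ (2*l) * ?S) + fps_const (2*A*B) * (fps_X ^ (l+k) * ?S)
      + fps_const (B\<^sup>2) * (fps_X ^ (2*k) * ?S)"
  proof -
    have 1: "fps_const (A\<^sup>2) = fps_const A ^ 2" "fps_const (2*A*B) = 2 * fps_const A * fps_const B"
      "fps_const (B\<^sup>2) = fps_const B ^ 2"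
      by (simp_all add: numeral_fps_const power2_eq_square)
    have 2: "fps_X ^ (2*l) = (fps_X ^ l)^2" "fps_X ^ (2*k) = (fps_X ^ k)^2"
      for fps_X :: "complex fps" by (simp_all add: power_mult[symmetric] mult.commute)
    show ?thesis unfolding 1 2 power_add by algebra
  qed
  have "fps_nth ((fps_const A * fps_X ^ l + fps_const B * fps_X ^ k)\<^sup>2 * ?S) n =
    A\<^sup>2 * (if 2 * l \<le> n then coeff A B p q (n - 2 * l) else 0) +
      2 * A * B * (if l + k \<le> n then coeff A B p q (n - (l + k)) else 0) +
      B\<^sup>2 * (if 2 * k \<le> n then coeff A B p q (n - 2 * k) else 0)"
    unfolding e by (simp add: fps_X_power_mult_nth sol_fps_def not_less[symmetric])
  also have "\<dots> = of_nat (Suc (Suc n) * Suc n) * coeff A B p q (Suc (Suc n))"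
    unfolding ode_coeff.simps by (simp del: of_nat_mult of_nat_Suc)
  also have "\<dots> = fps_nth (fps_deriv (fps_deriv ?S)) n"
    by (simp add: sol_fps_def algebra_simps)
  finally show "fps_nth (fps_deriv (fps_deriv ?S)) n = fps_nth ((fps_const A * fps_X ^ l + fps_const B * fps_X ^ k)\<^sup>2 * ?S) n" ..
qed

lemma sol'_has_field_derivative:
  "(sol' A B p q has_field_derivative (Q A B z)\<^sup>2 * sol A B p q z) (at z within S)"
proof -
  let ?P = "fps_const A * fps_X ^ l + fps_const B * fps_X ^ k"
  have r1: "fps_conv_radius (fps_const A * fps_X ^ l) = \<infinity>" for A :: complex and l
    using fps_conv_radius_mult[of "fps_const A" "fps_X ^ l"] by simp
  have r2: "fps_conv_radius ?P = \<infinity>"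
    using fps_conv_radius_add[of "fps_const A * fps_X ^ l" "fps_const B * fps_X ^ k"] by (simp add: r1)
  have r3: "fps_conv_radius (?P\<^sup>2) = \<infinity>" using fps_conv_radius_power[of ?P 2] by (simp add: r2)
  have "eval_fps ?P z = Q A B z"
    by (simp add: eval_fps_add eval_fps_mult r1 Q_def)
  then have "eval_fps (fps_deriv (fps_deriv (sol_fps A B p q))) z = (Q A B z)\<^sup>2 * sol A B p q z"
    unfolding sol_fps_ode by (simp add: eval_fps_mult eval_fps_power r2 r3 sol_def)
  moreover have "(sol' A B p q has_field_derivative eval_fps (fps_deriv (fps_deriv (sol_fps A B p q))) z) (at z within S)"
    unfolding sol'_def[abs_def] by (rule has_field_derivative_eval_fps) simp
  ultimately show ?thesis by simp
qed

section \<open>Linearity, scaling, conjugation and Wronskian of the entire solutions\<close>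

lemma coeff_linear: "coeff A B p q n = p * coeff A B 1 0 n + q * coeff A B 0 1 n"
proof (induction n rule: less_induct)
  case (less n)
  consider "n = 0" | "n = Suc 0" | j where "n = Suc (Suc j)" by (metis not0_implies_Suc)
  then show ?case
  proof cases
    case 3
    have IH: "coeff A B p q (j - e) = p * coeff A B 1 0 (j - e) + q * coeff A B 0 1 (j - e)" for e
      using less.IH[of "j - e"] 3 by simp
    show ?thesis unfolding 3 ode_coeff.simps IH by (simp add: add_divide_distrib algebra_simps)
  qed auto
qed

lemma sol_fps_linear:
  "sol_fps A B p q = fps_const p * sol_fps A B 1 0 + fps_const q * sol_fps A B 0 1"
  by (rule fps_ext) (simp add: sol_fps_def coeff_linear[of A B p q])

lemma sol_linear: "sol A B p q z = p * sol A B 1 0 z + q * sol A B 0 1 z"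
  and sol'_linear: "sol' A B p q z = p * sol' A B 1 0 z + q * sol' A B 0 1 z"
proof -
  have r: "fps_conv_radius (fps_const c * f) = \<infinity>" if "fps_conv_radius f = \<infinity>" for c :: complex and f
    using fps_conv_radius_mult[of "fps_const c" f] that by simp
  show "sol A B p q z = p * sol A B 1 0 z + q * sol A B 0 1 z"
    unfolding sol_def by (subst sol_fps_linear) (simp add: eval_fps_add eval_fps_mult r)
  show "sol' A B p q z = p * sol' A B 1 0 z + q * sol' A B 0 1 z"
    unfolding sol'_def by (subst sol_fps_linear) (simp add: eval_fps_add eval_fps_mult r)
qed

lemma coeff_scale: "coeff (A * s ^ Suc l) (B * s ^ Suc k) p (s * q) n = s ^ n * coeff A B p q n"
proof (induction n rule: less_induct)
  case (less n)
  consider "n = 0" | "n = Suc 0" | j where "n = Suc (Suc j)" by (metis not0_implies_Suc)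
  then show ?case
  proof cases
    case 3
    have IH: "coeff (A * s ^ Suc l) (B * s ^ Suc k) p (s * q) (j - e) = s ^ (j - e) * coeff A B p q (j - e)" for e
      using less.IH[of "j - e"] 3 by simp
    have p: "s ^ Suc (Suc j) = s ^ e * s ^ (j - e) * s\<^sup>2" if "e \<le> j" for e
      using that by (simp add: power_add[symmetric] power2_eq_square)
    have g: "s ^ (2*l) = s ^ l * s ^ l" "s ^ (l+k) = s ^ l * s ^ k" "s ^ (2*k) = s ^ k * s ^ k"
      by (simp_all add: power_add mult_2)
    have "(A * s ^ Suc l)\<^sup>2 * (if 2*l \<le> j then s ^ (j - 2*l) * x else 0) = s ^ Suc (Suc j) * (A\<^sup>2 * (if 2*l \<le> j then x else 0))" for x
      using p[of "2*l", unfolded g] by (cases "2*l \<le> j") (simp_all only: if_True if_False, simp_all add: power2_eq_square)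
    moreover have "2 * (A * s ^ Suc l) * (B * s ^ Suc k) * (if l+k \<le> j then s ^ (j - (l+k)) * x else 0) = s ^ Suc (Suc j) * (2 * A * B * (if l+k \<le> j then x else 0))" for x
      using p[of "l+k", unfolded g] by (cases "l+k \<le> j") (simp_all only: if_True if_False, simp_all add: power2_eq_square)
    moreover have "(B * s ^ Suc k)\<^sup>2 * (if 2*k \<le> j then s ^ (j - 2*k) * x else 0) = s ^ Suc (Suc j) * (B\<^sup>2 * (if 2*k \<le> j then x else 0))" for x
      using p[of "2*k", unfolded g] by (cases "2*k \<le> j") (simp_all only: if_True if_False, simp_all add: power2_eq_square)
    ultimately have t: "(A * s ^ Suc l)\<^sup>2 * (if 2*l \<le> j then s ^ (j - 2*l) * x else 0) = s ^ Suc (Suc j) * (A\<^sup>2 * (if 2*l \<le> j then x else 0))"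
       "2 * (A * s ^ Suc l) * (B * s ^ Suc k) * (if l+k \<le> j then s ^ (j - (l+k)) * y else 0) = s ^ Suc (Suc j) * (2 * A * B * (if l+k \<le> j then y else 0))"
       "(B * s ^ Suc k)\<^sup>2 * (if 2*k \<le> j then s ^ (j - 2*k) * z else 0) = s ^ Suc (Suc j) * (B\<^sup>2 * (if 2*k \<le> j then z else 0))" for x y z
      by blast+
    show ?thesis unfolding 3 ode_coeff.simps IH t by (simp add: add_divide_distrib distrib_left)
  qed auto
qed

text \<open>Substituting s z for z turns Q into the expression with coefficients
  \<open>A * s ^ Suc l\<close> and \<open>B * s ^ Suc k\<close>, and the slope at 0 picks up a
  factor s. As s is any complex number, this covers both dilations and the reflection s =
  -1.\<close>

lemma sol_scale:
  "sol (A * s ^ Suc l) (B * s ^ Suc k) p (s * q) z = sol A B p q (s * z)"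
  by (simp only: sol_def eval_fps_def sol_fps_def fps_nth_Abs_fps coeff_scale power_mult_distrib)
     (simp add: mult_ac)

lemma sol'_scale:
  "sol' (A * s ^ Suc l) (B * s ^ Suc k) p (s * q) z = s * sol' A B p q (s * z)"
proof -
  have "((\<lambda>z. sol (A * s ^ Suc l) (B * s ^ Suc k) p (s * q) z) has_field_derivative sol' (A * s ^ Suc l) (B * s ^ Suc k) p (s * q) z) (at z)"
    by (rule sol_has_field_derivative)
  moreover have "((\<lambda>z. sol A B p q (s * z)) has_field_derivative sol' A B p q (s * z) * s) (at z)"
    by (rule DERIV_chain2[OF sol_has_field_derivative]) (auto intro!: derivative_eq_intros)
  ultimately show ?thesis
    unfolding sol_scale using DERIV_unique by (metis mult.commute)
qed

lemma coeff_cnj: "cnj (coeff A B p q n) = coeff (cnj A) (cnj B) (cnj p) (cnj q) n"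
proof (induction n rule: less_induct)
  case (less n)
  consider "n = 0" | "n = Suc 0" | j where "n = Suc (Suc j)" by (metis not0_implies_Suc)
  then show ?case
  proof cases
    case 3
    have IH: "cnj (coeff A B p q (j - e)) = coeff (cnj A) (cnj B) (cnj p) (cnj q) (j - e)" for e
      using less.IH[of "j - e"] 3 by simp
    show ?thesis unfolding 3 ode_coeff.simps by (simp add: IH del: of_nat_mult of_nat_Suc)
  qed auto
qed

lemma sol_cnj: "cnj (sol A B p q z) = sol (cnj A) (cnj B) (cnj p) (cnj q) (cnj z)"
proof -
  have s: "(\<lambda>n. fps_nth (sol_fps A B p q) n * z ^ n) sums sol A B p q z" for A B p q z
    unfolding sol_def by (rule sums_eval_fps) simp
  have "(\<lambda>n. cnj (fps_nth (sol_fps A B p q) n * z ^ n)) sums cnj (sol A B p q z)"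
    unfolding sums_cnj by (rule s)
  then show ?thesis using s[of "cnj A" "cnj B" "cnj p" "cnj q" "cnj z"]
    by (simp add: sol_fps_def coeff_cnj sums_unique2)
qed

lemma sol'_cnj: "cnj (sol' A B p q z) = sol' (cnj A) (cnj B) (cnj p) (cnj q) (cnj z)"
proof -
  have s: "(\<lambda>n. fps_nth (fps_deriv (sol_fps A B p q)) n * z ^ n) sums sol' A B p q z" for A B p q z
    unfolding sol'_def by (rule sums_eval_fps) simp
  have "(\<lambda>n. cnj (fps_nth (fps_deriv (sol_fps A B p q)) n * z ^ n)) sums cnj (sol' A B p q z)"
    unfolding sums_cnj by (rule s)
  then show ?thesis using s[of "cnj A" "cnj B" "cnj p" "cnj q" "cnj z"]
    by (simp add: sol_fps_def coeff_cnj sums_unique2)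
qed

text \<open>The equation has no first order term, so the Wronskian is constant. Its value 1 lets
  Cramer's rule recover the data at 0 of a solution from its Wronskians with the two basic
  solutions.\<close>

lemma sol_wronskian: "sol A B 1 0 z * sol' A B 0 1 z - sol' A B 1 0 z * sol A B 0 1 z = 1"
proof -
  let ?w = "\<lambda>z. sol A B 1 0 z * sol' A B 0 1 z - sol' A B 1 0 z * sol A B 0 1 z"
  have "(?w has_field_derivative 0) (at z within UNIV)" for z
    by (rule derivative_eq_intros sol_has_field_derivative sol'_has_field_derivative refl)+
       (simp add: algebra_simps)
  then obtain c where "\<And>z. ?w z = c"
    using has_field_derivative_zero_constant[of UNIV ?w] by auto
  then have "?w z = ?w 0" by metis
  then show ?thesis by simp
qed

section \<open>Dependence of the solutions on the coefficients\<close>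

lemma coeff_continuous: "continuous_on UNIV (\<lambda>x. coeff (fst x) (snd x) p q n)"
proof (induction n rule: less_induct)
  case (less n)
  consider "n = 0" | "n = Suc 0" | j where "n = Suc (Suc j)" by (metis not0_implies_Suc)
  then show ?case
  proof cases
    case 3
    have "continuous_on UNIV (\<lambda>x. if e \<le> j then coeff (fst x) (snd x) p q (j - e) else 0)" for e
      using less.IH[of "j - e"] 3 by (cases "e \<le> j") auto
    then show ?thesis unfolding 3 ode_coeff.simps
      by (intro continuous_intros) (auto simp del: of_nat_mult of_nat_Suc)
  qed auto
qed

lemma coeff_holomorphic:
  assumes "a holomorphic_on S" "b holomorphic_on S"
  shows "(\<lambda>s. coeff (a s) (b s) p q n) holomorphic_on S"
proof (induction n rule: less_induct)
  case (less n)
  consider "n = 0" | "n = Suc 0" | j where "n = Suc (Suc j)" by (metis not0_implies_Suc)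
  then show ?case
  proof cases
    case 3
    have "(\<lambda>s. if e \<le> j then coeff (a s) (b s) p q (j - e) else 0) holomorphic_on S" for e
      using less.IH[of "j - e"] 3 by (cases "e \<le> j") auto
    then show ?thesis unfolding 3 ode_coeff.simps using assms
      by (intro holomorphic_intros) (auto simp del: of_nat_mult of_nat_Suc)
  qed auto
qed

lemma sol_term_bound:
  "\<exists>M. summable M \<and> (\<forall>A B n. cmod A \<le> N \<longrightarrow> cmod B \<le> N \<longrightarrow> cmod (coeff A B p q n * z ^ n) \<le> M n)"
  and sol'_term_bound:
  "\<exists>M. summable M \<and> (\<forall>A B n. cmod A \<le> N \<longrightarrow> cmod B \<le> N \<longrightarrow> cmod (of_nat (Suc n) * coeff A B p q (Suc n) * z ^ n) \<le> M n)"
proof -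
  \<comment> \<open>4 = 2 * 2: one power of 2 dominates the factor n + 1 of the differentiated
    series, the other leaves the summable (1/2)^n.\<close>
  define \<rho> where "\<rho> = 4 * (cmod z + 1)"
  have \<rho>: "\<rho> \<ge> 1" unfolding \<rho>_def by (simp add: add_increasing)
  have z: "cmod z ^ n * 4 ^ n \<le> \<rho> ^ n" for n
    unfolding power_mult_distrib[symmetric] \<rho>_def by (rule power_mono) auto
  obtain C where C0: "C \<ge> 0" and C: "\<And>A B n. cmod A \<le> N \<Longrightarrow> cmod B \<le> N \<Longrightarrow> cmod (coeff A B p q n) * \<rho> ^ n \<le> C"
    using coeff_geometric_bound[OF \<rho>, of N p q] by blast
  have sm: "summable (\<lambda>n. C * (1/2) ^ n :: real)" by (intro summable_mult summable_geometric) simp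
  have two: "real (Suc n) \<le> 2 ^ n" for n
  proof -
    have "Suc n \<le> 2 ^ n" by (rule Suc_leI[OF less_exp])
    then have "real (Suc n) \<le> real (2 ^ n)" by (rule of_nat_mono)
    then show ?thesis by simp
  qed
  have b1: "cmod (coeff A B p q n * z ^ n) \<le> C * (1/2) ^ n" if "cmod A \<le> N" "cmod B \<le> N" for A B n
  proof -
    have "cmod (coeff A B p q n * z ^ n) * 2 ^ n \<le> cmod (coeff A B p q n) * (cmod z ^ n * 4 ^ n)"
      unfolding norm_mult norm_power mult.assoc by (intro mult_left_mono power_mono) auto
    also have "\<dots> \<le> cmod (coeff A B p q n) * \<rho> ^ n" by (intro mult_left_mono z) auto
    also have "\<dots> \<le> C" using C that by simp
    finally show ?thesis by (simp add: power_one_over field_simps)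
  qed
  have b2: "cmod (of_nat (Suc n) * coeff A B p q (Suc n) * z ^ n) \<le> C * (1/2) ^ n" if "cmod A \<le> N" "cmod B \<le> N" for A B n
  proof -
    have "cmod (of_nat (Suc n) * coeff A B p q (Suc n) * z ^ n) * 2 ^ n
      = real (Suc n) * 2 ^ n * cmod (coeff A B p q (Suc n)) * cmod z ^ n"
      by (simp add: norm_mult norm_power del: of_nat_Suc)
    also have "\<dots> \<le> 2 ^ n * 2 ^ n * cmod (coeff A B p q (Suc n)) * cmod z ^ n"
      by (intro mult_right_mono two) auto
    also have "\<dots> = cmod (coeff A B p q (Suc n)) * (cmod z ^ n * 4 ^ n)"
    proof -
      have "(4::real) ^ n = 2 ^ n * 2 ^ n" by (subst power_mult_distrib[symmetric]) simp
      then show ?thesis by simp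
    qed
    also have "\<dots> \<le> cmod (coeff A B p q (Suc n)) * \<rho> ^ n" by (intro mult_left_mono z) auto
    also have "\<dots> \<le> cmod (coeff A B p q (Suc n)) * \<rho> ^ Suc n" using \<rho> by (intro mult_left_mono power_increasing) auto
    also have "\<dots> \<le> C" using C that by blast
    finally show ?thesis by (simp add: power_one_over field_simps)
  qed
  show "\<exists>M. summable M \<and> (\<forall>A B n. cmod A \<le> N \<longrightarrow> cmod B \<le> N \<longrightarrow> cmod (coeff A B p q n * z ^ n) \<le> M n)"
    using sm b1 by (intro exI[of _ "\<lambda>n. C * (1/2) ^ n"] conjI allI impI)
  show "\<exists>M. summable M \<and> (\<forall>A B n. cmod A \<le> N \<longrightarrow> cmod B \<le> N \<longrightarrow> cmod (of_nat (Suc n) * coeff A B p q (Suc n) * z ^ n) \<le> M n)"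
    using sm b2 by (intro exI[of _ "\<lambda>n. C * (1/2) ^ n"] conjI allI impI)
qed

end

text \<open>Weierstrass M-test on bounded sets of coefficients. Continuity is joint in (A, B), for
  later compactness arguments; holomorphy is stated along curves s -> (a s, b' s), so that one
  complex variable is enough.\<close>

lemma series_param:
  fixes g :: "nat \<Rightarrow> complex \<Rightarrow> complex \<Rightarrow> complex"
  assumes s: "\<And>A B. (\<lambda>n. g n A B) sums G A B"
    and b: "\<And>N. \<exists>M. summable M \<and> (\<forall>A B n. cmod A \<le> N \<longrightarrow> cmod B \<le> N \<longrightarrow> cmod (g n A B) \<le> M n)"
  shows series_param_continuous: "(\<And>n. continuous_on UNIV (\<lambda>x. g n (fst x) (snd x))) \<Longrightarrow> continuous_on UNIV (\<lambda>x. G (fst x) (snd x))"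
    and series_param_holomorphic: "\<lbrakk>\<And>n. (\<lambda>s. g n (a s) (b' s)) holomorphic_on S; a holomorphic_on S; b' holomorphic_on S; open S\<rbrakk>
           \<Longrightarrow> (\<lambda>s. G (a s) (b' s)) holomorphic_on S"
proof -
  have G: "G A B = (\<Sum>n. g n A B)" for A B using s sums_unique by blast
  have ul: "uniform_limit X (\<lambda>n x. \<Sum>i<n. g i (\<alpha> x) (\<beta> x)) (\<lambda>x. G (\<alpha> x) (\<beta> x)) sequentially"
    if "\<And>x. x \<in> X \<Longrightarrow> cmod (\<alpha> x) \<le> N" "\<And>x. x \<in> X \<Longrightarrow> cmod (\<beta> x) \<le> N"
    for X :: "'x set" and \<alpha> \<beta> N
  proof -
    obtain M where M: "summable M" "\<And>A B n. cmod A \<le> N \<Longrightarrow> cmod B \<le> N \<Longrightarrow> cmod (g n A B) \<le> M n"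
      using b[of N] by blast
    show ?thesis unfolding G by (rule Weierstrass_m_test[OF M(2) M(1)]) (use that in auto)
  qed
  show "continuous_on UNIV (\<lambda>x. G (fst x) (snd x))" if c: "\<And>n. continuous_on UNIV (\<lambda>x. g n (fst x) (snd x))"
  proof -
    have "isCont (\<lambda>x. G (fst x) (snd x)) x" for x
    proof -
      let ?B = "ball 0 (norm x + 1) :: (complex \<times> complex) set"
      have n: "cmod (fst y) \<le> norm x + 1" "cmod (snd y) \<le> norm x + 1" if "y \<in> ?B" for y
        using that norm_fst_le[of "fst y" "snd y"] norm_snd_le[of "snd y" "fst y"] by auto
      have "continuous_on ?B (\<lambda>x. G (fst x) (snd x))"
        by (rule uniform_limit_theorem[OF _ ul[of ?B fst "norm x + 1" snd]])
           (use n in \<open>auto intro!: always_eventually continuous_on_sum continuous_on_subset[OF c]\<close>)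
      moreover have "x \<in> ?B" by simp
      ultimately show ?thesis by (simp add: continuous_on_eq_continuous_at)
    qed
    then show ?thesis by (simp add: continuous_on_eq_continuous_at)
  qed
  show "(\<lambda>s. G (a s) (b' s)) holomorphic_on S"
    if h: "\<And>n. (\<lambda>s. g n (a s) (b' s)) holomorphic_on S" and a: "a holomorphic_on S" "b' holomorphic_on S" "open S"
  proof (rule holomorphic_uniform_sequence[OF \<open>open S\<close>])
    show "(\<lambda>s. \<Sum>i<n. g i (a s) (b' s)) holomorphic_on S" for n
      by (intro holomorphic_intros h)
    fix x assume "x \<in> S"
    then obtain d where d: "d > 0" "cball x d \<subseteq> S" using \<open>open S\<close> open_contains_cball by blast
    have "bounded (a ` cball x d)" "bounded (b' ` cball x d)"
      using a d by (auto intro!: compact_imp_bounded compact_continuous_image holomorphic_on_imp_continuous_on intro: holomorphic_on_subset)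
    then obtain N1 N2 where N: "\<And>y. y \<in> cball x d \<Longrightarrow> cmod (a y) \<le> N1" "\<And>y. y \<in> cball x d \<Longrightarrow> cmod (b' y) \<le> N2"
      unfolding bounded_iff by blast
    have "uniform_limit (cball x d) (\<lambda>n s. \<Sum>i<n. g i (a s) (b' s)) (\<lambda>s. G (a s) (b' s)) sequentially"
      by (rule ul[of _ a "max N1 N2" b']) (use N in \<open>auto simp: le_max_iff_disj\<close>)
    then show "\<exists>d>0. cball x d \<subseteq> S \<and> uniform_limit (cball x d) (\<lambda>n s. \<Sum>i<n. g i (a s) (b' s)) (\<lambda>s. G (a s) (b' s)) sequentially"
      using d by blast
  qed
qed

context exponents
begin

lemma sums_sol: "(\<lambda>n. coeff A B p q n * z ^ n) sums sol A B p q z"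
  using sums_eval_fps[of z "sol_fps A B p q", simplified] by (simp add: sol_def sol_fps_def)

lemma sums_sol': "(\<lambda>n. of_nat (Suc n) * coeff A B p q (Suc n) * z ^ n) sums sol' A B p q z"
  using sums_eval_fps[of z "fps_deriv (sol_fps A B p q)", simplified] by (simp add: sol'_def sol_fps_def)

lemma sol_continuous:
  assumes "continuous_on T a" "continuous_on T b"
  shows "continuous_on T (\<lambda>t. sol (a t) (b t) p q z)" "continuous_on T (\<lambda>t. sol' (a t) (b t) p q z)"
proof -
  have 1: "continuous_on UNIV (\<lambda>x. sol (fst x) (snd x) p q z)"
    by (rule series_param_continuous[OF sums_sol sol_term_bound]) (intro continuous_intros coeff_continuous)
  have 2: "continuous_on UNIV (\<lambda>x. sol' (fst x) (snd x) p q z)"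
    by (rule series_param_continuous[OF sums_sol' sol'_term_bound]) (intro continuous_intros coeff_continuous)
  have "continuous_on T (\<lambda>t. (a t, b t))" using assms by (intro continuous_intros)
  from continuous_on_compose2[OF 1 this] continuous_on_compose2[OF 2 this]
  show "continuous_on T (\<lambda>t. sol (a t) (b t) p q z)" "continuous_on T (\<lambda>t. sol' (a t) (b t) p q z)" by auto
qed

lemma sol_holomorphic:
  assumes "a holomorphic_on S" "b holomorphic_on S" "open S"
  shows "(\<lambda>s. sol (a s) (b s) p q z) holomorphic_on S" "(\<lambda>s. sol' (a s) (b s) p q z) holomorphic_on S"
proof -
  show "(\<lambda>s. sol (a s) (b s) p q z) holomorphic_on S"
    by (rule series_param_holomorphic[OF sums_sol sol_term_bound _ assms])
       (intro holomorphic_on_mult holomorphic_on_const coeff_holomorphic assms)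
  show "(\<lambda>s. sol' (a s) (b s) p q z) holomorphic_on S"
    by (rule series_param_holomorphic[OF sums_sol' sol'_term_bound _ assms])
       (intro holomorphic_on_mult holomorphic_on_const coeff_holomorphic assms)
qed

end

section \<open>WKB estimates\<close>

lemma has_real_derivative_cmod_power2:
  assumes "(u has_vector_derivative u') (at r)"
  shows "((\<lambda>r. (cmod (u r))\<^sup>2) has_real_derivative 2 * Re (cnj (u r) * u')) (at r)"
proof -
  have "((\<lambda>r. Re (u r)) has_real_derivative Re u') (at r)" "((\<lambda>r. Im (u r)) has_real_derivative Im u') (at r)"
    unfolding has_real_derivative_iff_has_vector_derivative
    by (rule bounded_linear.has_vector_derivative[OF bounded_linear_Re assms]
             bounded_linear.has_vector_derivative[OF bounded_linear_Im assms])+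
  from DERIV_add[OF DERIV_power[OF this(1), of 2] DERIV_power[OF this(2), of 2]]
  have "((\<lambda>r. (Re (u r))\<^sup>2 + (Im (u r))\<^sup>2) has_real_derivative 2 * Re (cnj (u r) * u')) (at r)"
    by (simp add: algebra_simps)
  then show ?thesis by (simp add: cmod_power2)
qed

text \<open>Here u is the amplitude of the growing WKB component and v that of the decaying one,
  rescaled by exp(-2 Phi). In the derivative of |u|^2 + |v|^2 the function q appears only in -4 Re q
  |v|^2, which has the good sign, so purely imaginary q is allowed. What remains is a growth rate
  2K/r^2, integrable at infinity.\<close>

lemma forward_energy_bound:
  fixes u v :: "real \<Rightarrow> complex" and q g :: "real \<Rightarrow> complex"
  assumes R: "R > 0" and K: "K \<ge> 0"
    and u: "\<And>r. r \<ge> R \<Longrightarrow> (u has_vector_derivative - (g r / 2) * (u r - v r)) (at r)"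
    and v: "\<And>r. r \<ge> R \<Longrightarrow> (v has_vector_derivative - 2 * q r * v r - (g r / 2) * (u r - v r)) (at r)"
    and q: "\<And>r. r \<ge> R \<Longrightarrow> Re (q r) \<ge> 0"
    and g: "\<And>r. r \<ge> R \<Longrightarrow> cmod (g r) \<le> K / r\<^sup>2"
    and r: "r \<ge> R"
  shows "(cmod (u r))\<^sup>2 + (cmod (v r))\<^sup>2 \<le> ((cmod (u R))\<^sup>2 + (cmod (v R))\<^sup>2) * exp (2 * K / R)"
proof -
  define E where "E r = (cmod (u r))\<^sup>2 + (cmod (v r))\<^sup>2" for r
  define E' where "E' r = 2 * Re (cnj (u r) * (- (g r / 2) * (u r - v r))) + 2 * Re (cnj (v r) * (- 2 * q r * v r - (g r / 2) * (u r - v r)))" for r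
  have E: "(E has_real_derivative E' r) (at r)" if "r \<ge> R" for r
    unfolding E_def[abs_def] E'_def using u[OF that] v[OF that]
    by (intro DERIV_add has_real_derivative_cmod_power2) auto
  have E'_le: "E' r \<le> 2 * K / r\<^sup>2 * E r" if rR: "r \<ge> R" for r
  proof -
    define G where "G = g r / 2"
    have gr: "g r = 2 * G" by (simp add: G_def)
    have "E' r = - Re (g r * ((cnj (u r) + cnj (v r)) * (u r - v r))) - 4 * Re (q r) * (cmod (v r))\<^sup>2"
      unfolding E'_def cmod_power2 gr by (simp add: algebra_simps power2_eq_square)
    also have "\<dots> \<le> cmod (g r * ((cnj (u r) + cnj (v r)) * (u r - v r)))"
    proof -
      have "0 \<le> 4 * Re (q r) * (cmod (v r))\<^sup>2" using q[OF rR] by simp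
      moreover have "- Re X \<le> cmod X" for X using complex_Re_le_cmod[of "- X"] by simp
      ultimately show ?thesis by (smt (verit))
    qed
    also have "\<dots> = cmod (g r) * (cmod (cnj (u r) + cnj (v r)) * cmod (u r - v r))" by (simp add: norm_mult)
    also have "\<dots> \<le> K / r\<^sup>2 * ((cmod (u r) + cmod (v r)) * (cmod (u r) + cmod (v r)))"
      using norm_triangle_ineq[of "cnj (u r)" "cnj (v r)"] norm_triangle_ineq4[of "u r" "v r"] g[OF rR] K
      by (intro mult_mono) auto
    also have "\<dots> \<le> K / r\<^sup>2 * (2 * E r)"
    proof (rule mult_left_mono)
      have "0 \<le> (cmod (u r) - cmod (v r))\<^sup>2" by simp
      then show "(cmod (u r) + cmod (v r)) * (cmod (u r) + cmod (v r)) \<le> 2 * E r"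
        unfolding E_def by (simp add: power2_eq_square algebra_simps)
    qed (use K in simp)
    also have "\<dots> = 2 * K / r\<^sup>2 * E r" by simp
    finally show ?thesis .
  qed
  \<comment> \<open>Integrating factor: the logarithmic derivative of exp(2K/r) is -2K/r^2.\<close>
  have "E r * exp (2 * K / r) \<le> E R * exp (2 * K / R)"
  proof (rule DERIV_nonpos_imp_nonincreasing[OF r])
    fix x assume "R \<le> x" "x \<le> r"
    then have x: "x > 0" "x \<ge> R" using R by auto
    have "((\<lambda>r. E r * exp (2 * K / r)) has_real_derivative E' x * exp (2 * K / x) + E x * (exp (2 * K / x) * (- 2 * K / x\<^sup>2))) (at x)"
      using x by (auto intro!: derivative_eq_intros E simp: power2_eq_square)
    moreover have "E' x * exp (2 * K / x) + E x * (exp (2 * K / x) * (- 2 * K / x\<^sup>2)) = (E' x - 2 * K / x\<^sup>2 * E x) * exp (2 * K / x)"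
      by (simp add: algebra_simps)
    moreover have "\<dots> \<le> 0" using E'_le[OF x(2)] by (simp add: mult_nonpos_nonneg)
    ultimately show "\<exists>y. ((\<lambda>r. E r * exp (2 * K / r)) has_real_derivative y) (at x) \<and> y \<le> 0" by metis
  qed
  moreover have "E r \<le> E r * exp (2 * K / r)"
    using mult_left_mono[of 1 "exp (2 * K / r)" "E r"] R r K by (simp add: E_def)
  ultimately show ?thesis unfolding E_def by linarith
qed

text \<open>With u and v bounded by the energy estimate, |u'| is O(1/x^2), and integration from r to
  s leaves a Cauchy bound of order 1/r. Its constant involves the equation only through K and the
  data only through C, which makes the limits uniform over families of coefficients.\<close>

lemma forward_cauchy_bound:
  fixes u v :: "real \<Rightarrow> complex" and q g :: "real \<Rightarrow> complex"
  assumes R: "R > 0" and K: "K \<ge> 0"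
    and u: "\<And>r. r \<ge> R \<Longrightarrow> (u has_vector_derivative - (g r / 2) * (u r - v r)) (at r)"
    and v: "\<And>r. r \<ge> R \<Longrightarrow> (v has_vector_derivative - 2 * q r * v r - (g r / 2) * (u r - v r)) (at r)"
    and q: "\<And>r. r \<ge> R \<Longrightarrow> Re (q r) \<ge> 0"
    and g: "\<And>r. r \<ge> R \<Longrightarrow> cmod (g r) \<le> K / r\<^sup>2"
    and E0: "cmod (u R) \<le> C" "cmod (v R) \<le> C"
    and rs: "R \<le> r" "r \<le> s"
  shows "cmod (u s - u r) \<le> 2 * K * C * exp (K / R) / r"
proof -
  define D where "D = 2 * C * exp (K / R)"
  have C: "C \<ge> 0" using E0(1) norm_ge_zero[of "u R"] by linarith
  have uv: "cmod (u x) + cmod (v x) \<le> 2 * D" if x: "x \<ge> R" for x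
  proof -
    have "(cmod (u x))\<^sup>2 + (cmod (v x))\<^sup>2 \<le> ((cmod (u R))\<^sup>2 + (cmod (v R))\<^sup>2) * exp (2 * K / R)"
      by (rule forward_energy_bound[OF R K u v q g x])
    also have "\<dots> \<le> (C\<^sup>2 + C\<^sup>2) * exp (2 * K / R)"
      using E0 by (intro mult_right_mono add_mono power_mono) auto
    also have "\<dots> \<le> D\<^sup>2" unfolding D_def by (simp add: power_mult_distrib exp_double[symmetric])
    finally have "(cmod (u x))\<^sup>2 + (cmod (v x))\<^sup>2 \<le> D\<^sup>2" .
    then have "(cmod (u x))\<^sup>2 \<le> D\<^sup>2" "(cmod (v x))\<^sup>2 \<le> D\<^sup>2"
      using zero_le_power2[of "cmod (u x)"] zero_le_power2[of "cmod (v x)"] by linarith+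
    moreover have "D \<ge> 0" unfolding D_def using C by simp
    ultimately show ?thesis using power2_le_imp_le[of "cmod (u x)" D] power2_le_imp_le[of "cmod (v x)" D] by linarith
  qed
  show ?thesis
  proof (cases "r = s")
    case True then show ?thesis using C K R rs by simp
  next
    case False
    have "cmod (u s - u r) \<le> (- (K * D) / s) - (- (K * D) / r)"
    proof (rule differentiable_bound_general)
      show "r < s" using False rs by simp
      show "continuous_on {r..s} u"
        using rs by (intro continuous_at_imp_continuous_on ballI has_vector_derivative_continuous[OF u]) auto
      show "continuous_on {r..s} (\<lambda>x. - (K * D) / x)" using rs R by (intro continuous_intros) auto
      fix x assume x: "r < x" "x < s"
      show "(u has_vector_derivative - (g x / 2) * (u x - v x)) (at x)" using u x rs by simp
      show "((\<lambda>x. - (K * D) / x) has_vector_derivative K * D / x\<^sup>2) (at x)"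
        unfolding has_real_derivative_iff_has_vector_derivative[symmetric] using x rs R
        by (auto intro!: derivative_eq_intros simp: power2_eq_square)
      have "cmod (- (g x / 2) * (u x - v x)) \<le> (K / x\<^sup>2 / 2) * (2 * D)"
        unfolding norm_mult norm_minus_cancel norm_divide
        using g[of x] uv[of x] norm_triangle_ineq4[of "u x" "v x"] x rs K
        by (intro mult_mono) auto
      then show "cmod (- (g x / 2) * (u x - v x)) \<le> K * D / x\<^sup>2" by simp
    qed
    also have "\<dots> \<le> K * D / r" using rs R K C by (simp add: D_def)
    finally show ?thesis by (simp add: D_def mult_ac)
  qed
qed

text \<open>The exponential is now attached to the other amplitude, so that Re q >= 0 helps when
  moving towards smaller r. The data at n belong to the exact solution that agrees with the decaying
  WKB function there; (u - v - 2)/2 will be its relative error at r. The bound is free of n, which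
  permits n -> infinity.\<close>

lemma backward_energy_bound:
  fixes u v :: "real \<Rightarrow> complex" and q g :: "real \<Rightarrow> complex"
  assumes R: "R > 0" and K: "K \<ge> 0"
    and u: "\<And>r. r \<ge> R \<Longrightarrow> (u has_vector_derivative 2 * q r * u r - (g r / 2) * (u r - v r)) (at r)"
    and v: "\<And>r. r \<ge> R \<Longrightarrow> (v has_vector_derivative - (g r / 2) * (u r - v r)) (at r)"
    and q: "\<And>r. r \<ge> R \<Longrightarrow> Re (q r) \<ge> 0"
    and g: "\<And>r. r \<ge> R \<Longrightarrow> cmod (g r) \<le> K / r\<^sup>2"
    and n: "u n = 0" "v n = -2"
    and r: "r \<ge> R" "r \<le> n"
  shows "(cmod (u r - v r - 2))\<^sup>2 \<le> 2 * (exp (4 * K / r) - 1)"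
proof -
  define e where "e r = v r + 2" for r
  have e: "(e has_vector_derivative - (g r / 2) * (u r - v r)) (at r)" if "r \<ge> R" for r
    unfolding e_def[abs_def] using v[OF that] by (auto intro!: derivative_eq_intros)
  \<comment> \<open>The summand 1 absorbs the inhomogeneous term produced by v = e - 2, so that E
    satisfies a homogeneous differential inequality.\<close>
  define E where "E r = 1 + ((cmod (u r))\<^sup>2 + (cmod (e r))\<^sup>2)" for r
  define E' where "E' r = 2 * Re (cnj (u r) * (2 * q r * u r - (g r / 2) * (u r - v r))) + 2 * Re (cnj (e r) * (- (g r / 2) * (u r - v r)))" for r
  have E: "(E has_real_derivative E' r) (at r)" if "r \<ge> R" for r
  proof -
    have "((\<lambda>r. 1 + ((cmod (u r))\<^sup>2 + (cmod (e r))\<^sup>2)) has_real_derivative 0 + E' r) (at r)"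
      unfolding E'_def using u[OF that] e[OF that]
      by (intro DERIV_add DERIV_const has_real_derivative_cmod_power2) auto
    then show ?thesis by (simp add: E_def[abs_def])
  qed
  have E'_ge: "- (4 * K / r\<^sup>2 * E r) \<le> E' r" if rR: "r \<ge> R" for r
  proof -
    let ?s = "cmod (u r) + cmod (e r)"
    define G where "G = g r / 2"
    have gr: "g r = 2 * G" by (simp add: G_def)
    have "E' r = 4 * Re (q r) * (cmod (u r))\<^sup>2 - Re (g r * ((cnj (u r) + cnj (e r)) * (u r - e r + 2)))"
      unfolding E'_def cmod_power2 e_def gr by (simp add: algebra_simps power2_eq_square)
    moreover have "Re (g r * ((cnj (u r) + cnj (e r)) * (u r - e r + 2))) \<le> 4 * K / r\<^sup>2 * E r"
    proof -
      have "Re (g r * ((cnj (u r) + cnj (e r)) * (u r - e r + 2))) \<le> cmod (g r * ((cnj (u r) + cnj (e r)) * (u r - e r + 2)))"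
        by (rule complex_Re_le_cmod)
      also have "\<dots> = cmod (g r) * (cmod (cnj (u r) + cnj (e r)) * cmod (u r - e r + 2))" by (simp add: norm_mult)
      also have "\<dots> \<le> K / r\<^sup>2 * (?s * (?s + 2))"
        using norm_triangle_ineq[of "cnj (u r)" "cnj (e r)"] norm_triangle_ineq[of "u r - e r" "2"] norm_triangle_ineq4[of "u r" "e r"] g[OF rR] K
        by (intro mult_mono) auto
      also have "\<dots> \<le> K / r\<^sup>2 * (4 * E r)"
      proof (rule mult_left_mono)
        have "0 \<le> (cmod (u r) - cmod (e r))\<^sup>2" "0 \<le> (?s - 1)\<^sup>2" by simp_all
        then show "?s * (?s + 2) \<le> 4 * E r"
          unfolding E_def by (simp add: power2_eq_square algebra_simps)
      qed (use K in simp)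
      also have "\<dots> = 4 * K / r\<^sup>2 * E r" by simp
      finally show ?thesis .
    qed
    ultimately show ?thesis using q[OF rR] by (smt (verit) mult_nonneg_nonneg zero_le_power2)
  qed
  have "E r * exp (- 4 * K / r) \<le> E n * exp (- 4 * K / n)"
  proof (rule DERIV_nonneg_imp_nondecreasing[OF r(2)])
    fix x assume "r \<le> x" "x \<le> n"
    then have x: "x > 0" "x \<ge> R" using R r by auto
    have "((\<lambda>r. E r * exp (- 4 * K / r)) has_real_derivative E' x * exp (- 4 * K / x) + E x * (exp (- 4 * K / x) * (4 * K / x\<^sup>2))) (at x)"
      using x by (auto intro!: derivative_eq_intros E simp: power2_eq_square)
    moreover have "E' x * exp (- 4 * K / x) + E x * (exp (- 4 * K / x) * (4 * K / x\<^sup>2)) = (E' x + 4 * K / x\<^sup>2 * E x) * exp (- 4 * K / x)"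
      by (simp add: algebra_simps)
    moreover have "\<dots> \<ge> 0" using E'_ge[OF x(2)] by simp
    ultimately show "\<exists>y. ((\<lambda>r. E r * exp (- 4 * K / r)) has_real_derivative y) (at x) \<and> 0 \<le> y" by metis
  qed
  also have "E n * exp (- 4 * K / n) \<le> 1" using n K R r by (simp add: E_def e_def)
  finally have "E r * exp (- 4 * K / r) * exp (4 * K / r) \<le> 1 * exp (4 * K / r)"
    by (rule mult_right_mono) simp
  then have "E r \<le> exp (4 * K / r)" by (simp add: mult.assoc exp_add[symmetric])
  moreover have "(cmod (u r - v r - 2))\<^sup>2 \<le> 2 * (E r - 1)"
  proof -
    have "cmod (u r - v r - 2) \<le> cmod (u r) + cmod (e r)"
      using norm_triangle_ineq4[of "u r" "e r"] by (simp add: e_def diff_diff_eq)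
    then have "(cmod (u r - v r - 2))\<^sup>2 \<le> (cmod (u r) + cmod (e r))\<^sup>2" by (intro power_mono) auto
    also have "\<dots> \<le> 2 * (E r - 1)"
      using zero_le_power2[of "cmod (u r) - cmod (e r)"] unfolding E_def by (simp add: power2_eq_square algebra_simps)
    finally show ?thesis .
  qed
  ultimately show ?thesis by simp
qed

section \<open>WKB functions and their Wronskians with exact solutions\<close>

context exponents
begin

definition dQ :: "complex \<Rightarrow> complex \<Rightarrow> complex \<Rightarrow> complex" where
  "dQ A B z = of_nat l * A * z ^ (l - 1) + of_nat k * B * z ^ (k - 1)"

definition ddQ :: "complex \<Rightarrow> complex \<Rightarrow> complex \<Rightarrow> complex" where
  "ddQ A B z = of_nat l * of_nat (l - 1) * A * z ^ (l - 2) + of_nat k * of_nat (k - 1) * B * z ^ (k - 2)"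

definition \<Phi> :: "complex \<Rightarrow> complex \<Rightarrow> complex \<Rightarrow> complex" where
  "\<Phi> A B z = A * z ^ Suc l / of_nat (Suc l) + B * z ^ Suc k / of_nat (Suc k)"

definition wkb :: "complex \<Rightarrow> complex \<Rightarrow> complex \<Rightarrow> complex \<Rightarrow> complex" where
  "wkb \<sigma> A B z = exp (\<sigma> * \<Phi> A B z) / csqrt (Q A B z)"

definition wkb' :: "complex \<Rightarrow> complex \<Rightarrow> complex \<Rightarrow> complex \<Rightarrow> complex" where
  "wkb' \<sigma> A B z = wkb \<sigma> A B z * (\<sigma> * Q A B z - dQ A B z / (2 * Q A B z))"

text \<open>Minus one half of the Schwarzian derivative of \<open>\<Phi>\<close>: off the branch cut
  the WKB functions solve f'' = (Q^2 + \<open>wkb_err\<close>) f exactly.\<close>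

definition wkb_err :: "complex \<Rightarrow> complex \<Rightarrow> complex \<Rightarrow> complex" where
  "wkb_err A B z = 3/4 * (dQ A B z / Q A B z)\<^sup>2 - ddQ A B z / (2 * Q A B z)"

text \<open>Wronskian of a WKB function with an exact solution. Up to sign and a factor 2 it is the
  coefficient of the opposite WKB function in the sense of variation of constants.\<close>

definition wr :: "complex \<Rightarrow> complex \<Rightarrow> complex \<Rightarrow> complex \<Rightarrow> complex \<Rightarrow> complex \<Rightarrow> complex" where
  "wr \<sigma> A B p q z = wkb \<sigma> A B z * sol' A B p q z - wkb' \<sigma> A B z * sol A B p q z"

lemma Q_has_field_derivative: "(Q A B has_field_derivative dQ A B z) (at z within S)"
  unfolding Q_def[abs_def] dQ_def by (rule derivative_eq_intros refl)+ simp

lemma dQ_has_field_derivative: "(dQ A B has_field_derivative ddQ A B z) (at z within S)"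
  unfolding dQ_def[abs_def] ddQ_def by (rule derivative_eq_intros refl)+ (simp add: numeral_2_eq_2)

lemma Phi_has_field_derivative: "(\<Phi> A B has_field_derivative Q A B z) (at z within S)"
proof -
  have 1: "((\<lambda>z. A * z ^ Suc l / of_nat (Suc l)) has_field_derivative A * z ^ l) (at z within S)" for A :: complex and l
  proof -
    have "((\<lambda>z. A / of_nat (Suc l) * z ^ Suc l) has_field_derivative A / of_nat (Suc l) * (of_nat (Suc l) * z ^ l)) (at z within S)"
      by (intro DERIV_cmult) (use DERIV_power[OF DERIV_ident, where n = "Suc l" and x = z and s = S] in simp)
    then show ?thesis by (simp del: of_nat_Suc add: field_simps)
  qed
  show ?thesis unfolding \<Phi>_def[abs_def] Q_def by (intro derivative_intros 1)
qed

lemma wkb_has_field_derivative: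
  assumes "Q A B z \<notin> \<real>\<^sub>\<le>\<^sub>0"
  shows "(wkb \<sigma> A B has_field_derivative wkb' \<sigma> A B z) (at z)"
proof -
  have nz: "Q A B z \<noteq> 0" using assms by auto
  have sq: "csqrt (Q A B z) * csqrt (Q A B z) = Q A B z" by (simp add: power2_eq_square[symmetric])
  have "(wkb \<sigma> A B has_field_derivative
     ((exp (\<sigma> * \<Phi> A B z) * (\<sigma> * Q A B z)) * csqrt (Q A B z) - exp (\<sigma> * \<Phi> A B z) * (dQ A B z / (2 * csqrt (Q A B z)))) / (csqrt (Q A B z) * csqrt (Q A B z))) (at z)"
    unfolding wkb_def[abs_def] using nz assms
    by (auto intro!: derivative_eq_intros Q_has_field_derivative Phi_has_field_derivative)
  also have "((exp (\<sigma> * \<Phi> A B z) * (\<sigma> * Q A B z)) * csqrt (Q A B z) - exp (\<sigma> * \<Phi> A B z) * (dQ A B z / (2 * csqrt (Q A B z)))) / (csqrt (Q A B z) * csqrt (Q A B z))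
     = wkb' \<sigma> A B z"
    unfolding sq unfolding wkb'_def wkb_def using nz by (simp add: field_simps sq)
  finally show ?thesis .
qed

lemma wkb'_has_field_derivative:
  assumes "Q A B z \<notin> \<real>\<^sub>\<le>\<^sub>0" and \<sigma>: "\<sigma>\<^sup>2 = 1"
  shows "(wkb' \<sigma> A B has_field_derivative ((Q A B z)\<^sup>2 + wkb_err A B z) * wkb \<sigma> A B z) (at z)"
proof -
  have nz: "Q A B z \<noteq> 0" using assms by auto
  have "(wkb' \<sigma> A B has_field_derivative
      wkb' \<sigma> A B z * (\<sigma> * Q A B z - dQ A B z / (2 * Q A B z)) +
      wkb \<sigma> A B z * (\<sigma> * dQ A B z - (ddQ A B z * (2 * Q A B z) - dQ A B z * (2 * dQ A B z)) / (2 * Q A B z * (2 * Q A B z)))) (at z)"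
  proof -
    have e: "wkb' \<sigma> A B = (\<lambda>z. wkb \<sigma> A B z * (\<sigma> * Q A B z - dQ A B z / (2 * Q A B z)))"
      by (rule ext) (rule wkb'_def)
    show ?thesis
      by (subst e) (use nz assms(1) in \<open>auto intro!: derivative_eq_intros Q_has_field_derivative dQ_has_field_derivative wkb_has_field_derivative simp: mult_ac\<close>)
  qed
  also have "wkb' \<sigma> A B z * (\<sigma> * Q A B z - dQ A B z / (2 * Q A B z)) +
      wkb \<sigma> A B z * (\<sigma> * dQ A B z - (ddQ A B z * (2 * Q A B z) - dQ A B z * (2 * dQ A B z)) / (2 * Q A B z * (2 * Q A B z)))
    = ((Q A B z)\<^sup>2 + wkb_err A B z) * wkb \<sigma> A B z"
  proof -
    have "(\<sigma> * Q A B z - dQ A B z / (2 * Q A B z))\<^sup>2 = (Q A B z)\<^sup>2 - \<sigma> * dQ A B z + (dQ A B z)\<^sup>2 / (4 * (Q A B z)\<^sup>2)"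
      using nz \<sigma> by (simp add: power2_diff power_mult_distrib power_divide)
    then have e: "(\<sigma> * Q A B z - dQ A B z / (2 * Q A B z)) * (\<sigma> * Q A B z - dQ A B z / (2 * Q A B z)) = (Q A B z)\<^sup>2 - \<sigma> * dQ A B z + (dQ A B z)\<^sup>2 / (4 * (Q A B z)\<^sup>2)"
      by (simp add: power2_eq_square)
    have e2: "(ddQ A B z * (2 * Q A B z) - dQ A B z * (2 * dQ A B z)) / (2 * Q A B z * (2 * Q A B z)) =
        ddQ A B z / (2 * Q A B z) - (dQ A B z)\<^sup>2 / (2 * (Q A B z)\<^sup>2)"
      using nz by (simp add: field_simps power2_eq_square)
    have "(\<sigma> * Q A B z - dQ A B z / (2 * Q A B z)) * (\<sigma> * Q A B z - dQ A B z / (2 * Q A B z)) +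
      (\<sigma> * dQ A B z - (ddQ A B z * (2 * Q A B z) - dQ A B z * (2 * dQ A B z)) / (2 * Q A B z * (2 * Q A B z)))
      = (Q A B z)\<^sup>2 + wkb_err A B z"
      unfolding e e2 wkb_err_def power_divide using nz by (simp add: field_simps)
    then show ?thesis unfolding wkb'_def mult.assoc distrib_left[symmetric] by (simp add: mult.commute)
  qed
  finally show ?thesis .
qed

text \<open>The two functions solve second order equations whose potentials differ by
  \<open>wkb_err\<close>, and only this difference survives in the derivative of a
  Wronskian.\<close>

lemma wr_has_field_derivative:
  assumes "Q A B z \<notin> \<real>\<^sub>\<le>\<^sub>0" and \<sigma>: "\<sigma>\<^sup>2 = 1"
  shows "(wr \<sigma> A B p q has_field_derivative - wkb_err A B z * wkb \<sigma> A B z * sol A B p q z) (at z)"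
  unfolding wr_def[abs_def]
  by (rule derivative_eq_intros wkb_has_field_derivative wkb'_has_field_derivative sol_has_field_derivative
      sol'_has_field_derivative assms refl)+ (simp add: algebra_simps)

lemma wkb_mult: "Q A B z \<noteq> 0 \<Longrightarrow> wkb (-1) A B z * wkb 1 A B z = 1 / Q A B z"
  by (simp add: wkb_def exp_minus power2_eq_square[symmetric])

lemma wkb_plus_conv: "wkb 1 A B z = wkb (-1) A B z * exp (2 * \<Phi> A B z)"
  by (simp add: wkb_def exp_add[symmetric])

text \<open>Cramer's rule, as the two WKB functions have Wronskian 2. The factor
  \<open>wkb (-1)\<close> brings it to the form u - v in the amplitudes of the forward energy
  estimate.\<close>

lemma wkb_mult_sol:
  assumes "Q A B z \<noteq> 0"
  shows "2 * Q A B z * wkb (-1) A B z * sol A B p q z = wr (-1) A B p q z - wr 1 A B p q z * exp (- 2 * \<Phi> A B z)"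
proof -
  have e: "wkb 1 A B z * exp (- 2 * \<Phi> A B z) = wkb (-1) A B z"
    unfolding wkb_plus_conv by (simp add: mult.assoc exp_add[symmetric])
  have "wr 1 A B p q z * exp (- 2 * \<Phi> A B z) =
     (wkb 1 A B z * exp (- 2 * \<Phi> A B z)) * (sol' A B p q z - (Q A B z - dQ A B z / (2 * Q A B z)) * sol A B p q z)"
    unfolding wr_def wkb'_def by (simp add: algebra_simps)
  then show ?thesis unfolding e unfolding wr_def wkb'_def by (simp add: algebra_simps)
qed

lemma sol_eq_wr:
  assumes "Q A B z \<noteq> 0"
  shows "2 * sol A B p q z = wkb (-1) A B z * (wr (-1) A B p q z * exp (2 * \<Phi> A B z) - wr 1 A B p q z)"
proof -
  have "wkb (-1) A B z * (wr (-1) A B p q z * exp (2 * \<Phi> A B z) - wr 1 A B p q z)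
     = wkb 1 A B z * (wr (-1) A B p q z - wr 1 A B p q z * exp (- 2 * \<Phi> A B z))"
    unfolding wkb_plus_conv by (simp add: algebra_simps exp_minus)
  also have "\<dots> = (wkb (-1) A B z * wkb 1 A B z) * (2 * Q A B z * sol A B p q z)"
    using wkb_mult_sol[OF assms, of p q] by (simp add: mult_ac)
  also have "\<dots> = 2 * sol A B p q z" using assms by (simp add: wkb_mult)
  finally show ?thesis ..
qed

end

lemma has_vector_derivative_of_real_comp:
  fixes f :: "complex \<Rightarrow> complex"
  assumes "(f has_field_derivative f') (at (of_real r))"
  shows "((\<lambda>r. f (of_real r)) has_vector_derivative f') (at r)"
proof -
  have "(complex_of_real has_vector_derivative 1) (at r)"
    by (rule bounded_linear.has_vector_derivative[OF bounded_linear_of_real has_vector_derivative_id, simplified])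
  from field_vector_diff_chain_at[OF this assms] show ?thesis by (simp add: o_def)
qed

section \<open>Admissible coefficients and the size of the WKB error\<close>

context exponents
begin

definition coef_size :: "complex \<Rightarrow> complex \<Rightarrow> real \<Rightarrow> real" where
  "coef_size A B r = cmod A * r ^ l + cmod B * r ^ k"

text \<open>Three separate demands on the half-line r >= R. The sign of Re Q serves the energy
  estimates and, with Q nonzero, keeps Q off the cut of \<open>csqrt\<close>;
  \<open>\<kappa>\<close> excludes cancellation between the two monomials; \<open>\<mu>\<close>
  bounds their joint size from below. The constants are explicit so that estimates hold uniformly
  over families of coefficients.\<close>

definition admissible :: "real \<Rightarrow> real \<Rightarrow> real \<Rightarrow> complex \<Rightarrow> complex \<Rightarrow> bool" where
  "admissible \<kappa> \<mu> R A B \<longleftrightarrow> (\<forall>r\<ge>R. 0 \<le> Re (Q A B (of_real r)) \<and>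
      \<kappa> * coef_size A B r \<le> cmod (Q A B (of_real r)) \<and> \<mu> \<le> coef_size A B r)"

text \<open>Two of the factors \<open>\<kappa>\<close> come from (Q'/Q)^2 in \<open>wkb_err\<close>,
  the third one together with \<open>\<mu>\<close> from the division by Q.\<close>

definition err_const :: "real \<Rightarrow> real \<Rightarrow> real" where
  "err_const \<kappa> \<mu> = 2 * (real l)\<^sup>2 / (\<kappa> ^ 3 * \<mu>)"

lemma admissible_Q:
  assumes "admissible \<kappa> \<mu> R A B" "0 < \<kappa>" "0 < \<mu>" "R \<le> r"
  shows "Q A B (of_real r) \<noteq> 0" "Q A B (of_real r) \<notin> \<real>\<^sub>\<le>\<^sub>0" "0 \<le> Re (Q A B (of_real r))"
    "\<kappa> * \<mu> \<le> cmod (Q A B (of_real r))"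
proof -
  have a: "0 \<le> Re (Q A B (of_real r))" "\<kappa> * coef_size A B r \<le> cmod (Q A B (of_real r))" "\<mu> \<le> coef_size A B r"
    using assms unfolding admissible_def by auto
  have "\<kappa> * \<mu> \<le> \<kappa> * coef_size A B r" using a assms by (intro mult_left_mono) auto
  then show b: "\<kappa> * \<mu> \<le> cmod (Q A B (of_real r))" using a by linarith
  have "0 < \<kappa> * \<mu>" using assms by simp
  then show nz: "Q A B (of_real r) \<noteq> 0" using b by auto
  show "0 \<le> Re (Q A B (of_real r))" by fact
  show "Q A B (of_real r) \<notin> \<real>\<^sub>\<le>\<^sub>0"
    using nz a(1) by (auto simp: complex_nonpos_Reals_iff complex_eq_iff)
qed

lemma wkb_err_bound:
  assumes adm: "admissible \<kappa> \<mu> R A B" and \<kappa>: "0 < \<kappa>" "\<kappa> \<le> 1" and \<mu>: "0 < \<mu>" and R: "0 < R" "R \<le> r"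
  shows "cmod (wkb_err A B (of_real r) / Q A B (of_real r)) \<le> err_const \<kappa> \<mu> / r\<^sup>2"
proof -
  let ?S = "coef_size A B r" and ?Q = "Q A B (of_real r)"
  have r: "r > 0" using R by simp
  have S: "\<kappa> * ?S \<le> cmod ?Q" "\<mu> \<le> ?S" using adm R unfolding admissible_def by auto
  have S0: "?S > 0" using S \<mu> by linarith
  have nQ: "0 < \<kappa> * ?S" using \<kappa> S0 by simp
  have Q0: "cmod ?Q > 0" using S nQ by linarith
  have pk: "r ^ (k - 1) * r = r ^ k" "r ^ (l - 1) * r = r ^ l"
    using k_pos k_less_l by (simp_all add: power_Suc2[symmetric] del: power_Suc)
  have pw2: "r ^ (j - 2) * r\<^sup>2 = r ^ j" if "2 \<le> j" for j
    using that by (metis le_add_diff_inverse2 power_add)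
  have pl2: "r ^ (l - 2) * r\<^sup>2 = r ^ l" using k_pos k_less_l by (intro pw2) simp
  have pk2: "real (k - 1) * (r ^ (k - 2) * r\<^sup>2) = real (k - 1) * r ^ k"
  proof (cases "k = 1")
    case False
    then have "r ^ (k - 2) * r\<^sup>2 = r ^ k" using k_pos by (intro pw2) simp
    then show ?thesis by simp
  qed simp
  have d: "cmod (dQ A B (of_real r)) * r \<le> real l * ?S"
  proof -
    have "cmod (dQ A B (of_real r)) * r \<le> (real l * cmod A * r ^ (l - 1) + real k * cmod B * r ^ (k - 1)) * r"
      unfolding dQ_def using r by (intro mult_right_mono norm_triangle_le add_mono) (auto simp: norm_mult norm_power)
    also have "\<dots> = real l * (cmod A * (r ^ (l - 1) * r)) + real k * (cmod B * (r ^ (k - 1) * r))" by (simp add: algebra_simps)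
    also have "\<dots> \<le> real l * (cmod A * r ^ l) + real l * (cmod B * r ^ k)"
      unfolding pk using r k_less_l by (intro add_mono mult_right_mono) auto
    finally show ?thesis by (simp add: coef_size_def algebra_simps)
  qed
  have dd: "cmod (ddQ A B (of_real r)) * r\<^sup>2 \<le> (real l)\<^sup>2 * ?S"
  proof -
    have "cmod (ddQ A B (of_real r)) * r\<^sup>2 \<le> (real l * real (l - 1) * cmod A * r ^ (l - 2) + real k * real (k - 1) * cmod B * r ^ (k - 2)) * r\<^sup>2"
      unfolding ddQ_def using r by (intro mult_right_mono norm_triangle_le add_mono) (auto simp: norm_mult norm_power)
    also have "\<dots> = real l * real (l - 1) * (cmod A * (r ^ (l - 2) * r\<^sup>2)) + real k * (cmod B * (real (k - 1) * (r ^ (k - 2) * r\<^sup>2)))" by (simp add: algebra_simps)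
    also have "\<dots> = (real l * real (l - 1)) * (cmod A * r ^ l) + (real k * real (k - 1)) * (cmod B * r ^ k)"
      unfolding pk2 pl2 by simp
    also have "\<dots> \<le> (real l)\<^sup>2 * (cmod A * r ^ l) + (real l)\<^sup>2 * (cmod B * r ^ k)"
      unfolding power2_eq_square using r k_less_l by (intro add_mono mult_right_mono mult_mono) auto
    finally show ?thesis by (simp add: coef_size_def algebra_simps)
  qed
  have d': "cmod (dQ A B (of_real r) / ?Q) \<le> real l / (\<kappa> * r)"
  proof -
    have "cmod (dQ A B (of_real r)) \<le> real l * ?S / r" using d r by (simp add: pos_le_divide_eq)
    then have "cmod (dQ A B (of_real r) / ?Q) \<le> (real l * ?S / r) / (\<kappa> * ?S)"
      unfolding norm_divide using S nQ Q0 r S0 by (intro frac_le) auto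
    also have "\<dots> = real l / (\<kappa> * r)" using S0 by simp
    finally show ?thesis .
  qed
  have dd': "cmod (ddQ A B (of_real r) / (2 * ?Q)) \<le> (real l)\<^sup>2 / (2 * \<kappa> * r\<^sup>2)"
  proof -
    have "cmod (ddQ A B (of_real r)) \<le> (real l)\<^sup>2 * ?S / r\<^sup>2" using dd r by (simp add: pos_le_divide_eq)
    then have "cmod (ddQ A B (of_real r) / (2 * ?Q)) \<le> ((real l)\<^sup>2 * ?S / r\<^sup>2) / (2 * (\<kappa> * ?S))"
      unfolding norm_divide norm_mult using S nQ Q0 r S0 by (intro frac_le) auto
    also have "\<dots> = (real l)\<^sup>2 / (2 * \<kappa> * r\<^sup>2)" using S0 by simp
    finally show ?thesis .
  qed
  have "cmod (wkb_err A B (of_real r)) \<le> 3/4 * (real l / (\<kappa> * r))\<^sup>2 + (real l)\<^sup>2 / (2 * \<kappa> * r\<^sup>2)"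
    unfolding wkb_err_def
    by (rule norm_triangle_le_diff, rule add_mono[OF _ dd'])
       (use d' in \<open>auto simp: norm_mult norm_power intro!: power_mono\<close>)
  also have "\<dots> \<le> 3/4 * (real l / (\<kappa> * r))\<^sup>2 + (real l)\<^sup>2 / (2 * \<kappa>\<^sup>2 * r\<^sup>2)"
    using \<kappa> r by (intro add_left_mono divide_left_mono mult_right_mono mult_left_mono)
      (auto simp: power2_eq_square mult_le_one mult_left_le)
  also have "\<dots> = 5/4 * ((real l)\<^sup>2 / (\<kappa>\<^sup>2 * r\<^sup>2))" by (simp add: power_divide power_mult_distrib)
  also have "\<dots> \<le> 2 * ((real l)\<^sup>2 / (\<kappa>\<^sup>2 * r\<^sup>2))" by (intro mult_right_mono) auto
  finally have e: "cmod (wkb_err A B (of_real r)) \<le> 2 * ((real l)\<^sup>2 / (\<kappa>\<^sup>2 * r\<^sup>2))" .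
  have "\<kappa> * \<mu> \<le> \<kappa> * ?S" using S \<kappa> by (intro mult_left_mono) auto
  then have "\<kappa> * \<mu> \<le> cmod ?Q" using S by linarith
  then have "cmod (wkb_err A B (of_real r) / ?Q) \<le> 2 * ((real l)\<^sup>2 / (\<kappa>\<^sup>2 * r\<^sup>2)) / (\<kappa> * \<mu>)"
    unfolding norm_divide using e \<kappa> \<mu> by (intro frac_le) auto
  also have "\<dots> = err_const \<kappa> \<mu> / r\<^sup>2" unfolding err_const_def by (simp add: power3_eq_cube power2_eq_square mult_ac)
  finally show ?thesis .
qed

lemma err_const_nonneg: "0 < \<kappa> \<Longrightarrow> 0 < \<mu> \<Longrightarrow> 0 \<le> err_const \<kappa> \<mu>"
  by (simp add: err_const_def)

lemma half_quotient: "- e * ((x - y) / (2 * w)) = - (e / w / 2) * (x - y)" for e x y w :: complex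
  by (cases "w = 0") (simp_all add: field_simps)

text \<open>Instance of the forward estimate with u = \<open>wr (-1)\<close> and v =
  \<open>wr 1\<close> times exp(-2 \<open>\<Phi>\<close>): the growing amplitude of every exact
  solution settles down along the half-line.\<close>

lemma wr_forward:
  assumes adm: "admissible \<kappa> \<mu> R A B" and \<kappa>: "0 < \<kappa>" "\<kappa> \<le> 1" and \<mu>: "0 < \<mu>" and R: "0 < R"
    and C: "cmod (wr (-1) A B p q (of_real R)) \<le> C" "cmod (wr 1 A B p q (of_real R) * exp (- 2 * \<Phi> A B (of_real R))) \<le> C"
    and rs: "R \<le> r" "r \<le> s"
  shows "cmod (wr (-1) A B p q (of_real s) - wr (-1) A B p q (of_real r)) \<le> 2 * err_const \<kappa> \<mu> * C * exp (err_const \<kappa> \<mu> / R) / r"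
proof (rule forward_cauchy_bound[where u = "\<lambda>r. wr (-1) A B p q (of_real r)"
      and v = "\<lambda>r. wr 1 A B p q (of_real r) * exp (- 2 * \<Phi> A B (of_real r))"
      and q = "\<lambda>r. Q A B (of_real r)" and g = "\<lambda>r. wkb_err A B (of_real r) / Q A B (of_real r)"])
  show "0 < R" "0 \<le> err_const \<kappa> \<mu>" "R \<le> r" "r \<le> s"
    "cmod (wr (-1) A B p q (of_real R)) \<le> C" "cmod (wr 1 A B p q (of_real R) * exp (- 2 * \<Phi> A B (of_real R))) \<le> C"
    using R \<kappa> \<mu> rs C by (auto intro: err_const_nonneg)
  fix r assume r: "R \<le> r"
  note Q = admissible_Q[OF adm \<kappa>(1) \<mu> r]
  let ?z = "complex_of_real r"
  let ?u = "wr (-1) A B p q" and ?v = "\<lambda>z. wr 1 A B p q z * exp (- 2 * \<Phi> A B z)"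
  have m: "wkb (-1) A B ?z * sol A B p q ?z = (?u ?z - ?v ?z) / (2 * Q A B ?z)"
    using wkb_mult_sol[OF Q(1), of p q] Q(1) by (simp add: field_simps)
  have e: "wkb 1 A B ?z * exp (- 2 * \<Phi> A B ?z) = wkb (-1) A B ?z"
    unfolding wkb_plus_conv by (simp add: mult.assoc exp_add[symmetric])
  have "(?u has_field_derivative - wkb_err A B ?z * wkb (-1) A B ?z * sol A B p q ?z) (at ?z)"
    by (rule wr_has_field_derivative[OF Q(2)]) simp
  also have "- wkb_err A B ?z * wkb (-1) A B ?z * sol A B p q ?z = - (wkb_err A B ?z / Q A B ?z / 2) * (?u ?z - ?v ?z)"
    unfolding mult.assoc m half_quotient by simp
  finally show "((\<lambda>r. ?u (of_real r)) has_vector_derivative - (wkb_err A B ?z / Q A B ?z / 2) * (?u ?z - ?v ?z)) (at r)"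
    by (rule has_vector_derivative_of_real_comp)
  have "(?v has_field_derivative - wkb_err A B ?z * wkb 1 A B ?z * sol A B p q ?z * exp (- 2 * \<Phi> A B ?z)
      + exp (- 2 * \<Phi> A B ?z) * (- 2 * Q A B ?z) * wr 1 A B p q ?z) (at ?z)"
    using wr_has_field_derivative[OF Q(2), of 1 p q]
    by (auto intro!: derivative_eq_intros Phi_has_field_derivative)
  also have "- wkb_err A B ?z * wkb 1 A B ?z * sol A B p q ?z * exp (- 2 * \<Phi> A B ?z)
      + exp (- 2 * \<Phi> A B ?z) * (- 2 * Q A B ?z) * wr 1 A B p q ?z
      = - wkb_err A B ?z * (wkb 1 A B ?z * exp (- 2 * \<Phi> A B ?z) * sol A B p q ?z) - 2 * Q A B ?z * ?v ?z"
    by (simp add: algebra_simps)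
  also have "\<dots> = - 2 * Q A B ?z * ?v ?z - (wkb_err A B ?z / Q A B ?z / 2) * (?u ?z - ?v ?z)"
    unfolding e m half_quotient by (simp add: algebra_simps)
  finally show "((\<lambda>r. ?v (of_real r)) has_vector_derivative
       - 2 * Q A B ?z * ?v ?z - (wkb_err A B ?z / Q A B ?z / 2) * (?u ?z - ?v ?z)) (at r)"
    by (rule has_vector_derivative_of_real_comp)
  show "0 \<le> Re (Q A B ?z)" by (rule Q)
  show "cmod (wkb_err A B ?z / Q A B ?z) \<le> err_const \<kappa> \<mu> / r\<^sup>2"
    by (rule wkb_err_bound[OF adm \<kappa> \<mu> R r])
qed

text \<open>The coefficients \<open>p, q\<close> below are those of the exact solution whose Cauchy data at \<open>z\<close> are
  the Cauchy data of the decaying WKB function.\<close>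

lemma sol_matching:
  assumes "p = wr (-1) A B 0 1 z" "q = - wr (-1) A B 1 0 z"
  shows "sol A B p q z = wkb (-1) A B z" "sol' A B p q z = wkb' (-1) A B z"
proof -
  let ?f = "sol A B 1 0 z" and ?f' = "sol' A B 1 0 z" and ?g = "sol A B 0 1 z" and ?g' = "sol' A B 0 1 z"
  have w: "?f * ?g' - ?f' * ?g = 1" by (rule sol_wronskian)
  have "sol A B p q z = p * ?f + q * ?g" by (rule sol_linear)
  also have "\<dots> = wkb (-1) A B z * (?f * ?g' - ?f' * ?g)"
    unfolding assms wr_def by (simp add: algebra_simps)
  finally have "sol A B p q z = wkb (-1) A B z * (?f * ?g' - ?f' * ?g)" .
  then show "sol A B p q z = wkb (-1) A B z" by (simp add: w)
  have "sol' A B p q z = p * ?f' + q * ?g'" by (rule sol'_linear)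
  also have "\<dots> = wkb' (-1) A B z * (?f * ?g' - ?f' * ?g)"
    unfolding assms wr_def by (simp add: algebra_simps)
  finally have "sol' A B p q z = wkb' (-1) A B z * (?f * ?g' - ?f' * ?g)" .
  then show "sol' A B p q z = wkb' (-1) A B z" by (simp add: w)
qed

text \<open>The solution that starts with decaying WKB data at a far point n is close to the WKB
  function at r, by a relative bound independent of n. The subdominant solution is obtained from it
  as n -> infinity.\<close>

lemma wr_backward:
  assumes adm: "admissible \<kappa> \<mu> R A B" and \<kappa>: "0 < \<kappa>" "\<kappa> \<le> 1" and \<mu>: "0 < \<mu>" and R: "0 < R"
    and pq: "p = wr (-1) A B 0 1 (of_real n)" "q = - wr (-1) A B 1 0 (of_real n)"
    and r: "R \<le> r" "r \<le> n"
  shows "cmod (sol A B p q (of_real r) - wkb (-1) A B (of_real r)) \<le>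
      cmod (wkb (-1) A B (of_real r)) * sqrt ((exp (4 * err_const \<kappa> \<mu> / r) - 1) / 2)"
proof -
  let ?v = "wr 1 A B p q" and ?u = "\<lambda>z. wr (-1) A B p q z * exp (2 * \<Phi> A B z)"
  have "(cmod (?u (of_real r) - ?v (of_real r) - 2))\<^sup>2 \<le> 2 * (exp (4 * err_const \<kappa> \<mu> / r) - 1)"
  proof (rule backward_energy_bound[where u = "\<lambda>r. ?u (of_real r)" and v = "\<lambda>r. ?v (of_real r)"
      and q = "\<lambda>r. Q A B (of_real r)" and g = "\<lambda>r. wkb_err A B (of_real r) / Q A B (of_real r)"])
    show "0 < R" "0 \<le> err_const \<kappa> \<mu>" "R \<le> r" "r \<le> n"
      using R \<kappa> \<mu> r by (auto intro: err_const_nonneg)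
    fix r assume r: "R \<le> r"
    note Q = admissible_Q[OF adm \<kappa>(1) \<mu> r]
    let ?z = "complex_of_real r"
    have m: "wkb (-1) A B ?z * exp (2 * \<Phi> A B ?z) * sol A B p q ?z = (?u ?z - ?v ?z) / (2 * Q A B ?z)"
    proof -
      have "2 * Q A B ?z * (wkb (-1) A B ?z * exp (2 * \<Phi> A B ?z) * sol A B p q ?z) =
          (2 * Q A B ?z * wkb (-1) A B ?z * sol A B p q ?z) * exp (2 * \<Phi> A B ?z)" by (simp add: mult_ac)
      also have "\<dots> = ?u ?z - ?v ?z" unfolding wkb_mult_sol[OF Q(1)]
        by (simp add: algebra_simps exp_minus)
      finally show ?thesis using Q(1) by (simp add: field_simps)
    qed
    have "(?u has_field_derivative - wkb_err A B ?z * wkb (-1) A B ?z * sol A B p q ?z * exp (2 * \<Phi> A B ?z)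
        + exp (2 * \<Phi> A B ?z) * (2 * Q A B ?z) * wr (-1) A B p q ?z) (at ?z)"
      using wr_has_field_derivative[OF Q(2), of "-1" p q]
      by (auto intro!: derivative_eq_intros Phi_has_field_derivative)
    also have "- wkb_err A B ?z * wkb (-1) A B ?z * sol A B p q ?z * exp (2 * \<Phi> A B ?z)
        + exp (2 * \<Phi> A B ?z) * (2 * Q A B ?z) * wr (-1) A B p q ?z
        = - wkb_err A B ?z * (wkb (-1) A B ?z * exp (2 * \<Phi> A B ?z) * sol A B p q ?z) + 2 * Q A B ?z * ?u ?z"
      by (simp add: algebra_simps)
    also have "\<dots> = 2 * Q A B ?z * ?u ?z - (wkb_err A B ?z / Q A B ?z / 2) * (?u ?z - ?v ?z)"
      unfolding m half_quotient by (simp add: algebra_simps)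
    finally show "((\<lambda>r. ?u (of_real r)) has_vector_derivative
         2 * Q A B ?z * ?u ?z - (wkb_err A B ?z / Q A B ?z / 2) * (?u ?z - ?v ?z)) (at r)"
      by (rule has_vector_derivative_of_real_comp)
    have "(?v has_field_derivative - wkb_err A B ?z * wkb 1 A B ?z * sol A B p q ?z) (at ?z)"
      by (rule wr_has_field_derivative[OF Q(2)]) simp
    also have "- wkb_err A B ?z * wkb 1 A B ?z * sol A B p q ?z = - (wkb_err A B ?z / Q A B ?z / 2) * (?u ?z - ?v ?z)"
      unfolding wkb_plus_conv mult.assoc m[unfolded mult.assoc] half_quotient by simp
    finally show "((\<lambda>r. ?v (of_real r)) has_vector_derivative - (wkb_err A B ?z / Q A B ?z / 2) * (?u ?z - ?v ?z)) (at r)"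
      by (rule has_vector_derivative_of_real_comp)
    show "0 \<le> Re (Q A B ?z)" by (rule Q)
    show "cmod (wkb_err A B ?z / Q A B ?z) \<le> err_const \<kappa> \<mu> / r\<^sup>2"
      by (rule wkb_err_bound[OF adm \<kappa> \<mu> R r])
  next
    let ?n = "complex_of_real n"
    have Qn: "Q A B ?n \<noteq> 0" using admissible_Q(1)[OF adm \<kappa>(1) \<mu>] r by force
    show "?u ?n = 0" unfolding wr_def sol_matching[OF pq] by simp
    have "?v ?n = wkb (-1) A B ?n * wkb 1 A B ?n * (-2 * Q A B ?n)"
      unfolding wr_def sol_matching[OF pq] wkb'_def by (simp add: algebra_simps)
    then show "?v ?n = - 2" using Qn by (simp add: wkb_mult)
  qed
  then have b: "cmod (?u (of_real r) - ?v (of_real r) - 2) \<le> sqrt (2 * (exp (4 * err_const \<kappa> \<mu> / r) - 1))"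
    using real_le_rsqrt by blast
  have s: "sqrt (2 * (exp (4 * err_const \<kappa> \<mu> / r) - 1)) = 2 * sqrt ((exp (4 * err_const \<kappa> \<mu> / r) - 1) / 2)"
  proof -
    have "sqrt (2 * x) = 2 * sqrt (x / 2)" for x :: real
      using real_sqrt_mult[of 4 "x/2"] by simp
    then show ?thesis .
  qed
  have e: "sol A B p q (of_real r) - wkb (-1) A B (of_real r) =
     wkb (-1) A B (of_real r) * ((?u (of_real r) - ?v (of_real r) - 2) / 2)"
    using sol_eq_wr[OF admissible_Q(1)[OF adm \<kappa>(1) \<mu> r(1)], of p q] by (simp add: algebra_simps)
  show ?thesis unfolding e norm_mult norm_divide using b[unfolded s] by (intro mult_left_mono) simp_all
qed

lemma wr_continuous:
  assumes ab: "continuous_on T a" "continuous_on T b" and Q: "\<And>t. t \<in> T \<Longrightarrow> Q (a t) (b t) z \<notin> \<real>\<^sub>\<le>\<^sub>0"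
  shows "continuous_on T (\<lambda>t. wr \<sigma> (a t) (b t) p q z)"
proof -
  have nz: "t \<in> T \<Longrightarrow> Q (a t) (b t) z \<noteq> 0" for t using Q by force
  have q: "continuous_on T (\<lambda>t. Q (a t) (b t) z)" unfolding Q_def using ab by (intro continuous_intros)
  have "continuous_on T (\<lambda>t. csqrt (Q (a t) (b t) z))"
    by (rule continuous_on_compose2[OF continuous_on_csqrt q]) (use Q in auto)
  moreover have "continuous_on T (\<lambda>t. \<Phi> (a t) (b t) z)" "continuous_on T (\<lambda>t. dQ (a t) (b t) z)"
    unfolding \<Phi>_def dQ_def using ab by (auto intro!: continuous_intros simp del: of_nat_Suc)
  ultimately show ?thesis
    unfolding wr_def wkb'_def wkb_def using nz q ab
    by (intro continuous_intros sol_continuous) auto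
qed

lemma wr_holomorphic:
  assumes ab: "a holomorphic_on S" "b holomorphic_on S" "open S" and Q: "\<And>t. t \<in> S \<Longrightarrow> Q (a t) (b t) z \<notin> \<real>\<^sub>\<le>\<^sub>0"
  shows "(\<lambda>t. wr \<sigma> (a t) (b t) p q z) holomorphic_on S"
proof -
  have nz: "t \<in> S \<Longrightarrow> Q (a t) (b t) z \<noteq> 0" for t using Q by force
  have q: "(\<lambda>t. Q (a t) (b t) z) holomorphic_on S" unfolding Q_def using ab by (intro holomorphic_intros)
  have "(\<lambda>t. csqrt (Q (a t) (b t) z)) holomorphic_on S"
    by (rule holomorphic_on_csqrt'[OF q]) (use Q in auto)
  moreover have "(\<lambda>t. \<Phi> (a t) (b t) z) holomorphic_on S" "(\<lambda>t. dQ (a t) (b t) z) holomorphic_on S"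
    unfolding \<Phi>_def dQ_def using ab by (auto intro!: holomorphic_intros simp del: of_nat_Suc)
  ultimately show ?thesis
    unfolding wr_def wkb'_def wkb_def using nz q ab
    by (intro holomorphic_intros sol_holomorphic) (use Q in auto)
qed

end

section \<open>Connection coefficients\<close>

lemma limit_of_rate:
  fixes u :: "real \<Rightarrow> complex"
  assumes R: "0 < R" and est: "\<And>r s. R \<le> r \<Longrightarrow> r \<le> s \<Longrightarrow> cmod (u s - u r) \<le> C / r"
  shows "\<exists>L. (u \<longlongrightarrow> L) at_top \<and> (\<forall>r\<ge>R. cmod (u r - L) \<le> C / r)"
proof -
  have "0 \<le> C / R" using est[of R R] by simp
  then have C: "C \<ge> 0" using R by (simp add: zero_le_divide_iff)
  have "Cauchy (\<lambda>n. u (R + real n))"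
  proof (rule CauchyI')
    fix e :: real assume e: "e > 0"
    obtain M :: nat where M: "real M > C / e" using reals_Archimedean2 by blast
    show "\<exists>M. \<forall>m\<ge>M. \<forall>n>m. dist (u (R + real m)) (u (R + real n)) < e"
    proof (intro exI allI impI)
      fix m n assume mn: "M \<le> m" "m < n"
      have "cmod (u (R + real n) - u (R + real m)) \<le> C / (R + real m)" by (rule est) (use mn in auto)
      also have "\<dots> < e"
      proof -
        have "C / e < R + real m" using M mn R by linarith
        then have "C < (R + real m) * e" using e by (simp add: pos_divide_less_eq)
        then show ?thesis using R by (simp add: pos_divide_less_eq mult.commute add_pos_nonneg)
      qed
      finally show "dist (u (R + real m)) (u (R + real n)) < e" by (simp add: dist_norm norm_minus_commute)
    qed
  qed
  then obtain L where L: "(\<lambda>n. u (R + real n)) \<longlonglongrightarrow> L" using Cauchy_convergent convergent_def by blast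
  have rate: "cmod (u r - L) \<le> C / r" if r: "R \<le> r" for r
  proof -
    have "(\<lambda>n. cmod (u (R + real n) - u r)) \<longlonglongrightarrow> cmod (L - u r)" by (intro tendsto_intros L)
    moreover have "\<forall>\<^sub>F n in sequentially. cmod (u (R + real n) - u r) \<le> C / r"
    proof -
      have "\<forall>\<^sub>F n in sequentially. nat \<lceil>r\<rceil> \<le> n" by (rule eventually_ge_at_top)
      then show ?thesis
      proof eventually_elim
        case (elim n)
        then have "r \<le> R + real n" using R by linarith
        then show ?case using est r by blast
      qed
    qed
    ultimately have "cmod (L - u r) \<le> C / r" by (rule tendsto_upperbound) simp
    then show ?thesis by (simp add: norm_minus_commute)
  qed
  have "((\<lambda>r. u r - L) \<longlongrightarrow> 0) at_top"
  proof (rule Lim_null_comparison)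
    show "\<forall>\<^sub>F r in at_top. norm (u r - L) \<le> C / r"
      using eventually_ge_at_top[of R] by eventually_elim (rule rate)
    show "((\<lambda>r. C / r) \<longlongrightarrow> 0) at_top"       by (rule tendsto_divide_0[OF tendsto_const]) (simp add: filterlim_at_top_imp_at_infinity filterlim_ident)
  qed
  then have "(u \<longlongrightarrow> L) at_top" by (simp add: LIM_zero_iff)
  then show ?thesis using rate by blast
qed

context exponents
begin

text \<open>Limit of the growing amplitude. As a linear functional of (p, q) it is the Wronskian of
  the normalised decaying solution with \<open>sol A B p q\<close>; this allows the decaying
  solution to be defined through the functional.\<close>

definition lim_wr :: "complex \<Rightarrow> complex \<Rightarrow> complex \<Rightarrow> complex \<Rightarrow> complex" where
  "lim_wr A B p q = Lim at_top (\<lambda>r::real. wr (-1) A B p q (of_real r))"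

definition adm_set :: "real \<Rightarrow> real \<Rightarrow> real \<Rightarrow> real \<Rightarrow> (complex \<times> complex) set" where
  "adm_set \<kappa> \<mu> R N = {x. admissible \<kappa> \<mu> R (fst x) (snd x) \<and> cmod (fst x) \<le> N \<and> cmod (snd x) \<le> N}"

lemma compact_adm_set: "compact (adm_set \<kappa> \<mu> R N)"
proof -
  have "closed {x. \<forall>r\<ge>R. 0 \<le> Re (Q (fst x) (snd x) (of_real r)) \<and>
      \<kappa> * coef_size (fst x) (snd x) r \<le> cmod (Q (fst x) (snd x) (of_real r)) \<and> \<mu> \<le> coef_size (fst x) (snd x) r}"
    unfolding Q_def coef_size_def
    by (intro closed_Collect_all closed_Collect_imp closed_Collect_conj closed_Collect_le continuous_intros) auto
  moreover have "closed {x :: complex \<times> complex. cmod (fst x) \<le> N \<and> cmod (snd x) \<le> N}"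
    by (intro closed_Collect_conj closed_Collect_le continuous_intros)
  ultimately have "closed (adm_set \<kappa> \<mu> R N)"
    unfolding adm_set_def admissible_def by (subst Collect_conj_eq) (rule closed_Int)
  moreover have "bounded (adm_set \<kappa> \<mu> R N)"
  proof (rule bounded_subset)
    show "bounded (cball 0 N \<times> cball (0::complex) N :: (complex \<times> complex) set)" by (intro bounded_Times bounded_cball)
    show "adm_set \<kappa> \<mu> R N \<subseteq> cball 0 N \<times> cball 0 N" by (auto simp: adm_set_def)
  qed
  ultimately show ?thesis by (simp add: compact_eq_bounded_closed)
qed

text \<open>The forward estimate starts from a bound for the amplitudes at R, which has to be
  uniform in (A, B). Compactness of \<open>adm_set\<close> supplies it, and this is why
  admissibility is phrased with non-strict inequalities.\<close>

lemma wr_limit: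
  assumes \<kappa>: "0 < \<kappa>" "\<kappa> \<le> 1" and \<mu>: "0 < \<mu>" and R: "0 < R"
  shows "\<exists>C\<ge>0. \<forall>A B. admissible \<kappa> \<mu> R A B \<longrightarrow> cmod A \<le> N \<longrightarrow> cmod B \<le> N \<longrightarrow>
     ((\<lambda>r. wr (-1) A B p q (of_real r)) \<longlongrightarrow> lim_wr A B p q) at_top \<and>
     (\<forall>r\<ge>R. cmod (wr (-1) A B p q (of_real r) - lim_wr A B p q) \<le> C / r)"
proof -
  let ?X = "adm_set \<kappa> \<mu> R N" and ?R = "complex_of_real R"
  have Qx: "Q (fst x) (snd x) ?R \<notin> \<real>\<^sub>\<le>\<^sub>0" if "x \<in> ?X" for x
    using that admissible_Q(2)[OF _ \<kappa>(1) \<mu>, of R "fst x" "snd x" R] by (auto simp: adm_set_def)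
  have c: "continuous_on ?X (\<lambda>x. wr \<sigma> (fst x) (snd x) p q ?R)" for \<sigma>
    by (rule wr_continuous) (auto intro!: continuous_intros Qx)
  have ce: "continuous_on ?X (\<lambda>x. exp (- 2 * \<Phi> (fst x) (snd x) ?R))"
    unfolding \<Phi>_def by (auto intro!: continuous_intros simp del: of_nat_Suc)
  have "bounded ((\<lambda>x. wr (-1) (fst x) (snd x) p q ?R) ` ?X)"
    by (intro compact_imp_bounded compact_continuous_image c compact_adm_set)
  moreover have "bounded ((\<lambda>x. wr 1 (fst x) (snd x) p q ?R * exp (- 2 * \<Phi> (fst x) (snd x) ?R)) ` ?X)"
    by (intro compact_imp_bounded compact_continuous_image continuous_on_mult c ce compact_adm_set)
  ultimately obtain C1 C2 where C12: "\<And>x. x \<in> ?X \<Longrightarrow> cmod (wr (-1) (fst x) (snd x) p q ?R) \<le> C1"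
    "\<And>x. x \<in> ?X \<Longrightarrow> cmod (wr 1 (fst x) (snd x) p q ?R * exp (- 2 * \<Phi> (fst x) (snd x) ?R)) \<le> C2"
    unfolding bounded_iff by blast
  define D where "D = max 0 (max C1 C2)"
  define C where "C = 2 * err_const \<kappa> \<mu> * D * exp (err_const \<kappa> \<mu> / R)"
  have C0: "C \<ge> 0" unfolding C_def D_def using err_const_nonneg[OF \<kappa>(1) \<mu>] by simp
  show ?thesis
  proof (intro exI[of _ C] conjI C0 allI impI)
    fix A B assume adm: "admissible \<kappa> \<mu> R A B" and N: "cmod A \<le> N" "cmod B \<le> N"
    let ?u = "\<lambda>r::real. wr (-1) A B p q (of_real r)"
    have in_X: "(A, B) \<in> ?X" using adm N by (simp add: adm_set_def)
    have D: "cmod (?u R) \<le> D" "cmod (wr 1 A B p q ?R * exp (- 2 * \<Phi> A B ?R)) \<le> D"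
      using C12[OF in_X] unfolding D_def by auto
    have est: "cmod (?u s - ?u r) \<le> C / r" if "R \<le> r" "r \<le> s" for r s
      unfolding C_def by (rule wr_forward[OF adm \<kappa> \<mu> R D that])
    from limit_of_rate[OF R est] obtain L where L: "(?u \<longlongrightarrow> L) at_top" "\<And>r. R \<le> r \<Longrightarrow> cmod (?u r - L) \<le> C / r"
      by blast
    moreover have "lim_wr A B p q = L" unfolding lim_wr_def by (rule tendsto_Lim[OF _ L(1)]) simp
    ultimately show "(?u \<longlongrightarrow> lim_wr A B p q) at_top" "\<And>r. R \<le> r \<Longrightarrow> cmod (?u r - lim_wr A B p q) \<le> C / r"
      by auto
  qed
qed

lemma uniform_limit_wr:
  assumes \<kappa>: "0 < \<kappa>" "\<kappa> \<le> 1" and \<mu>: "0 < \<mu>" and R: "0 < R"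
    and T: "\<And>t. t \<in> T \<Longrightarrow> admissible \<kappa> \<mu> R (a t) (b t)" "\<And>t. t \<in> T \<Longrightarrow> cmod (a t) \<le> N" "\<And>t. t \<in> T \<Longrightarrow> cmod (b t) \<le> N"
  shows "uniform_limit T (\<lambda>r t. wr (-1) (a t) (b t) p q (of_real r)) (\<lambda>t. lim_wr (a t) (b t) p q) at_top"
proof (rule uniform_limitI)
  fix e :: real assume e: "e > 0"
  obtain C where C: "C \<ge> 0" "\<And>A B r. admissible \<kappa> \<mu> R A B \<Longrightarrow> cmod A \<le> N \<Longrightarrow> cmod B \<le> N \<Longrightarrow> r \<ge> R \<Longrightarrow>
     cmod (wr (-1) A B p q (of_real r) - lim_wr A B p q) \<le> C / r"
    using wr_limit[OF \<kappa> \<mu> R, of N p q] by blast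
  have "\<forall>\<^sub>F r in at_top. r \<ge> max R (C / e + 1)" by (rule eventually_ge_at_top)
  then show "\<forall>\<^sub>F r in at_top. \<forall>t\<in>T. dist (wr (-1) (a t) (b t) p q (of_real r)) (lim_wr (a t) (b t) p q) < e"
  proof eventually_elim
    case (elim r)
    show ?case
    proof
      fix t assume t: "t \<in> T"
      have "cmod (wr (-1) (a t) (b t) p q (of_real r) - lim_wr (a t) (b t) p q) \<le> C / r"
        using C(2)[OF T(1)[OF t] T(2)[OF t] T(3)[OF t]] elim by simp
      also have "C / r < e"
      proof -
        have r: "r > 0" using elim R by simp
        have "C / e < r" using elim by simp
        then have "C < r * e" using e by (simp add: pos_divide_less_eq)
        then show ?thesis using r by (simp add: pos_divide_less_eq mult.commute)
      qed
      finally show "dist (wr (-1) (a t) (b t) p q (of_real r)) (lim_wr (a t) (b t) p q) < e" by (simp add: dist_norm)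
    qed
  qed
qed

lemma lim_wr_continuous:
  assumes \<kappa>: "0 < \<kappa>" "\<kappa> \<le> 1" and \<mu>: "0 < \<mu>" and R: "0 < R"
    and T: "\<And>t. t \<in> T \<Longrightarrow> admissible \<kappa> \<mu> R (a t) (b t)" "\<And>t. t \<in> T \<Longrightarrow> cmod (a t) \<le> N" "\<And>t. t \<in> T \<Longrightarrow> cmod (b t) \<le> N"
    and ab: "continuous_on T a" "continuous_on T b"
  shows "continuous_on T (\<lambda>t. lim_wr (a t) (b t) p q)"
proof (rule uniform_limit_theorem[OF _ uniform_limit_wr[OF \<kappa> \<mu> R T]])
  have "\<forall>\<^sub>F r in at_top. r \<ge> R" by (rule eventually_ge_at_top)
  then show "\<forall>\<^sub>F r in at_top. continuous_on T (\<lambda>t. wr (-1) (a t) (b t) p q (of_real r))"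
  proof eventually_elim
    case (elim r)
    show ?case by (rule wr_continuous[OF ab]) (rule admissible_Q(2)[OF T(1) \<kappa>(1) \<mu> elim])
  qed
qed auto

text \<open>A locally uniform limit of holomorphic functions: constants of admissibility that are
  valid on a whole disc make the rate of convergence uniform there.\<close>

lemma lim_wr_holomorphic:
  assumes S: "open S" and ab: "a holomorphic_on S" "b holomorphic_on S"
    and adm: "\<And>s. s \<in> S \<Longrightarrow> \<exists>d \<kappa> \<mu> R. 0 < d \<and> 0 < \<kappa> \<and> \<kappa> \<le> 1 \<and> 0 < \<mu> \<and> 0 < R \<and> (\<forall>t\<in>cball s d \<inter> S. admissible \<kappa> \<mu> R (a t) (b t))"
  shows "(\<lambda>t. lim_wr (a t) (b t) p q) holomorphic_on S"
proof -
  let ?g = "\<lambda>t. lim_wr (a t) (b t) p q"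
  have "?g field_differentiable at s" if s: "s \<in> S" for s
  proof -
    obtain d1 \<kappa> \<mu> R where d1: "0 < d1" "0 < \<kappa>" "\<kappa> \<le> 1" "0 < \<mu>" "0 < R" "\<And>t. t \<in> cball s d1 \<Longrightarrow> t \<in> S \<Longrightarrow> admissible \<kappa> \<mu> R (a t) (b t)"
      using adm[OF s] by blast
    obtain d2 where d2: "0 < d2" "cball s d2 \<subseteq> S" using S s open_contains_cball by blast
    define d where "d = min d1 d2"
    have d: "0 < d" "cball s d \<subseteq> S" "\<And>t. t \<in> cball s d \<Longrightarrow> admissible \<kappa> \<mu> R (a t) (b t)"
      using d1 d2 by (auto simp: d_def)
    have bs: "ball s d \<subseteq> S" using d(2) ball_subset_cball by blast
    have "bounded (a ` cball s d)" "bounded (b ` cball s d)"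
      using ab d by (auto intro!: compact_imp_bounded compact_continuous_image holomorphic_on_imp_continuous_on intro: holomorphic_on_subset)
    then obtain N1 N2 where N: "\<And>y. y \<in> cball s d \<Longrightarrow> cmod (a y) \<le> N1" "\<And>y. y \<in> cball s d \<Longrightarrow> cmod (b y) \<le> N2"
      unfolding bounded_iff by blast
    have "?g holomorphic_on ball s d"
    proof (rule holomorphic_uniform_limit)
      show "uniform_limit (cball s d) (\<lambda>r t. wr (-1) (a t) (b t) p q (of_real r)) ?g at_top"
        by (rule uniform_limit_wr[where N = "max N1 N2", OF d1(2-5) d(3)]) (use N in \<open>auto simp: le_max_iff_disj\<close>)
      have "\<forall>\<^sub>F r in at_top. r \<ge> R" by (rule eventually_ge_at_top)
      then show "\<forall>\<^sub>F r in at_top. continuous_on (cball s d) (\<lambda>t. wr (-1) (a t) (b t) p q (of_real r)) \<and>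
          (\<lambda>t. wr (-1) (a t) (b t) p q (of_real r)) holomorphic_on ball s d"
      proof eventually_elim
        case (elim r)
        have Q: "Q (a t) (b t) (of_real r) \<notin> \<real>\<^sub>\<le>\<^sub>0" if "t \<in> cball s d" for t
          using admissible_Q(2)[OF d(3)[OF that] d1(2) d1(4) elim] .
        have "continuous_on (cball s d) a" "continuous_on (cball s d) b"
          using ab d by (auto intro!: holomorphic_on_imp_continuous_on intro: holomorphic_on_subset)
        then have "continuous_on (cball s d) (\<lambda>t. wr (-1) (a t) (b t) p q (of_real r))"
          by (rule wr_continuous) (rule Q)
        moreover have "(\<lambda>t. wr (-1) (a t) (b t) p q (of_real r)) holomorphic_on ball s d"
          by (rule wr_holomorphic[OF holomorphic_on_subset[OF ab(1) bs] holomorphic_on_subset[OF ab(2) bs] open_ball]) (use Q in auto)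
        ultimately show ?case ..
      qed
    qed auto
    then show ?thesis using d by (meson centre_in_ball holomorphic_on_imp_differentiable_at open_ball)
  qed
  then show ?thesis by (simp add: holomorphic_on_def field_differentiable_at_within)
qed

text \<open>Value at 0 of the decaying solution, with \<open>conn1\<close> as its derivative there:
  for f with these data the Wronskian with the solution of data (0, 1) is f(0), and with that of
  data (1, 0) it is -f'(0).\<close>

definition conn0 :: "complex \<Rightarrow> complex \<Rightarrow> complex" where
  "conn0 A B = lim_wr A B 0 1"

definition conn1 :: "complex \<Rightarrow> complex \<Rightarrow> complex" where
  "conn1 A B = - lim_wr A B 1 0"

definition rec_sol :: "complex \<Rightarrow> complex \<Rightarrow> complex \<Rightarrow> complex" where
  "rec_sol A B = sol A B (conn0 A B) (conn1 A B)"

lemma wr_tendsto_lim_wr: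
  assumes adm: "admissible \<kappa> \<mu> R A B" and \<kappa>: "0 < \<kappa>" "\<kappa> \<le> 1" and \<mu>: "0 < \<mu>" and R: "0 < R"
  shows "((\<lambda>r. wr (-1) A B p q (of_real r)) \<longlongrightarrow> lim_wr A B p q) at_top"
  using wr_limit[OF \<kappa> \<mu> R, of "max (cmod A) (cmod B)" p q] adm by auto

text \<open>The data at 0 of the solutions started at n converge to those of \<open>rec_sol\<close>,
  so the n-independent backward estimate passes to the limit.\<close>

lemma rec_sol_wkb:
  assumes adm: "admissible \<kappa> \<mu> R A B" and \<kappa>: "0 < \<kappa>" "\<kappa> \<le> 1" and \<mu>: "0 < \<mu>" and R: "0 < R" and r: "R \<le> r"
  shows "cmod (rec_sol A B (of_real r) - wkb (-1) A B (of_real r)) \<le>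
      cmod (wkb (-1) A B (of_real r)) * sqrt ((exp (4 * err_const \<kappa> \<mu> / r) - 1) / 2)"
proof (rule tendsto_upperbound)
  let ?f = "\<lambda>n::real. wr (-1) A B 0 1 (of_real n) * sol A B 1 0 (of_real r) + - wr (-1) A B 1 0 (of_real n) * sol A B 0 1 (of_real r)"
  have "(?f \<longlongrightarrow> conn0 A B * sol A B 1 0 (of_real r) + conn1 A B * sol A B 0 1 (of_real r)) at_top"
    unfolding conn0_def conn1_def by (intro tendsto_intros wr_tendsto_lim_wr[OF adm \<kappa> \<mu> R])
  then have "(?f \<longlongrightarrow> rec_sol A B (of_real r)) at_top"
    unfolding rec_sol_def sol_linear[of A B "conn0 A B" "conn1 A B"] .
  then show "((\<lambda>n. cmod (?f n - wkb (-1) A B (of_real r))) \<longlongrightarrow> cmod (rec_sol A B (of_real r) - wkb (-1) A B (of_real r))) at_top"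
    by (intro tendsto_intros)
  have "\<forall>\<^sub>F n in at_top. r \<le> n" by (rule eventually_ge_at_top)
  then show "\<forall>\<^sub>F n in at_top. cmod (?f n - wkb (-1) A B (of_real r)) \<le> cmod (wkb (-1) A B (of_real r)) * sqrt ((exp (4 * err_const \<kappa> \<mu> / r) - 1) / 2)"
  proof eventually_elim
    case (elim n)
    show ?case using wr_backward[OF adm \<kappa> \<mu> R refl refl r elim]
      unfolding sol_linear[of A B "wr (-1) A B 0 1 (of_real n)" "- wr (-1) A B 1 0 (of_real n)"] .
  qed
qed simp

end

section \<open>Complex scaling\<close>

lemma csqrt_of_real_times:
  assumes "0 < s"
  shows "csqrt (of_real s * z) = of_real (sqrt s) * csqrt z"
proof (rule csqrt_unique)
  show "(of_real (sqrt s) * csqrt z)\<^sup>2 = of_real s * z"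
    using assms by (simp add: power_mult_distrib of_real_power[symmetric] del: of_real_power)
  show "0 < Re (of_real (sqrt s) * csqrt z) \<or> Re (of_real (sqrt s) * csqrt z) = 0 \<and> 0 \<le> Im (of_real (sqrt s) * csqrt z)"
    using csqrt_principal[of z] assms by auto
qed

context exponents
begin

text \<open>\<open>\<Phi>\<close> is invariant under the scaling and Q gains a factor s, so the
  normalisation by 1/sqrt Q is the source of every sqrt s in the scaling laws. Positivity of s lets
  the principal root factor.\<close>

lemma wr_scale:
  assumes s: "0 < s" and AB: "A' = A * of_real s ^ Suc l" "B' = B * of_real s ^ Suc k"
  shows "wr \<sigma> A' B' p (of_real s * q) z = of_real (sqrt s) * wr \<sigma> A B p q (of_real s * z)"
proof -
  let ?s = "complex_of_real s" and ?t = "complex_of_real (sqrt s)"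
  have t: "?t * ?t = ?s" using s by (simp flip: of_real_mult)
  have t0: "?t \<noteq> 0" "?s \<noteq> 0" using s by auto
  have Q: "Q A' B' z = ?s * Q A B (?s * z)"
    unfolding Q_def AB by (simp add: power_mult_distrib algebra_simps)
  have Ph: "\<Phi> A' B' z = \<Phi> A B (?s * z)"
    unfolding \<Phi>_def AB by (simp add: power_mult_distrib algebra_simps del: of_nat_Suc)
  have j: "s ^ Suc j * z ^ (j - 1) * c = s * s * ((s * z) ^ (j - 1)) * c" if "1 \<le> j" for j and s z c :: complex
    using that by (cases j) (auto simp: power_mult_distrib)
  have dQ: "dQ A' B' z = ?s * ?s * dQ A B (?s * z)"
  proof -
    have "dQ A' B' z = ?s ^ Suc l * z ^ (l - 1) * (of_nat l * A) + ?s ^ Suc k * z ^ (k - 1) * (of_nat k * B)"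
      unfolding dQ_def AB by (simp add: mult_ac del: power_Suc)
    also have "\<dots> = ?s * ?s * dQ A B (?s * z)"
      unfolding dQ_def using k_pos k_less_l by (subst (1 2) j) (auto simp: algebra_simps)
    finally show ?thesis .
  qed
  have w: "wkb \<sigma> A' B' z = wkb \<sigma> A B (?s * z) / ?t"
    unfolding wkb_def Q Ph csqrt_of_real_times[OF s] by simp
  have dq: "dQ A' B' z / (2 * Q A' B' z) = ?s * (dQ A B (?s * z) / (2 * Q A B (?s * z)))"
    unfolding dQ Q using t0 by simp
  have w': "wkb' \<sigma> A' B' z = ?t * wkb' \<sigma> A B (?s * z)"
  proof -
    have "wkb' \<sigma> A' B' z = wkb \<sigma> A B (?s * z) / ?t * (?s * (\<sigma> * Q A B (?s * z) - dQ A B (?s * z) / (2 * Q A B (?s * z))))"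
      unfolding wkb'_def w dq unfolding Q by (simp add: algebra_simps)
    also have "\<dots> = ?t * wkb' \<sigma> A B (?s * z)"
      unfolding wkb'_def t[symmetric] using t0 by (simp add: field_simps)
    finally show ?thesis .
  qed
  show ?thesis
    unfolding wr_def w w' unfolding AB sol_scale sol'_scale
    using t0 by (simp add: t[symmetric] field_simps)
qed

lemma lim_wr_scale:
  assumes s: "0 < s" and AB: "A' = A * of_real s ^ Suc l" "B' = B * of_real s ^ Suc k"
    and adm: "admissible \<kappa> \<mu> R A B" "0 < \<kappa>" "\<kappa> \<le> 1" "0 < \<mu>" "0 < R"
  shows "lim_wr A' B' p (of_real s * q) = of_real (sqrt s) * lim_wr A B p q"
proof -
  have "filterlim (\<lambda>r. s * r) at_top at_top" using s
    by (intro filterlim_tendsto_pos_mult_at_top[OF tendsto_const _ filterlim_ident])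
  from filterlim_compose[OF wr_tendsto_lim_wr[OF adm] this]
  have "((\<lambda>r. of_real (sqrt s) * wr (-1) A B p q (of_real (s * r))) \<longlongrightarrow> of_real (sqrt s) * lim_wr A B p q) at_top"
    by (intro tendsto_intros)
  then have "((\<lambda>r. wr (-1) A' B' p (of_real s * q) (of_real r)) \<longlongrightarrow> of_real (sqrt s) * lim_wr A B p q) at_top"
    unfolding wr_scale[OF s AB] by simp
  then show ?thesis unfolding lim_wr_def[of A' B'] by (intro tendsto_Lim) auto
qed

lemma wr_cmult: "wr \<sigma> A B 0 (c * q) z = c * wr \<sigma> A B 0 q z"
  unfolding wr_def sol_linear[of A B 0 "c * q"] sol_linear[of A B 0 q] sol'_linear[of A B 0 "c * q"] sol'_linear[of A B 0 q]
  by (simp add: algebra_simps)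

lemma conn_scale:
  assumes s: "0 < s" and AB: "A' = A * of_real s ^ Suc l" "B' = B * of_real s ^ Suc k"
    and adm: "admissible \<kappa> \<mu> R A B" "0 < \<kappa>" "\<kappa> \<le> 1" "0 < \<mu>" "0 < R"
  shows "conn0 A B = of_real (sqrt s) * conn0 A' B'" "conn1 A' B' = of_real (sqrt s) * conn1 A B"
proof -
  have AB2: "A = A' * of_real (1/s) ^ Suc l" "B = B' * of_real (1/s) ^ Suc k"
    using s by (simp_all add: AB power_divide)
  have "filterlim (\<lambda>r. s * r) at_top at_top" using s
    by (intro filterlim_tendsto_pos_mult_at_top[OF tendsto_const _ filterlim_ident])
  from filterlim_compose[OF wr_tendsto_lim_wr[OF adm] this]
  have "((\<lambda>r. of_real (1 / sqrt s) * wr (-1) A B 0 1 (of_real (s * r))) \<longlongrightarrow> of_real (1 / sqrt s) * lim_wr A B 0 1) at_top"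
    by (intro tendsto_intros)
  moreover have "of_real (1 / sqrt s) * wr (-1) A B 0 1 (of_real (s * r)) = wr (-1) A' B' 0 1 (of_real r)" for r
  proof -
    have "of_real s * wr (-1) A' B' 0 1 (of_real r) = of_real (sqrt s) * wr (-1) A B 0 1 (of_real s * of_real r)"
      using wr_scale[OF s AB, of "-1" 0 1 "of_real r"] wr_cmult[of "-1" A' B' "of_real s" 1] by simp
    moreover have "complex_of_real s = of_real (sqrt s) * of_real (sqrt s)" using s by (simp flip: of_real_mult)
    ultimately show ?thesis using s by (simp add: field_simps)
  qed
  ultimately have "((\<lambda>r. wr (-1) A' B' 0 1 (of_real r)) \<longlongrightarrow> of_real (1 / sqrt s) * lim_wr A B 0 1) at_top"
    by simp
  then have "conn0 A' B' = of_real (1 / sqrt s) * conn0 A B"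
    unfolding conn0_def lim_wr_def[of A' B'] by (intro tendsto_Lim) auto
  then show "conn0 A B = of_real (sqrt s) * conn0 A' B'" using s by simp
  show "conn1 A' B' = of_real (sqrt s) * conn1 A B"
    unfolding conn1_def using lim_wr_scale[OF s AB adm, of 1 0] by simp
qed

section \<open>Criteria for admissibility\<close>

lemma admissible_Re_pos:
  assumes a: "0 < a" "a \<le> Re A" "cmod A \<le> N" "cmod B \<le> N"
  shows "admissible (a / (2 * (N + a))) a (max 1 (2 * N / a)) A B"
  unfolding admissible_def
proof (intro allI impI)
  fix r assume r: "max 1 (2 * N / a) \<le> r"
  then have r1: "1 \<le> r" and r2: "2 * N \<le> a * r" using a by (auto simp: pos_divide_le_eq mult.commute)
  have N0: "0 \<le> N" using a norm_ge_zero[of A] by linarith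
  have rl: "r * r ^ k \<le> r ^ l" using r1 k_less_l power_increasing[of "Suc k" l r] by simp
  have rk: "N * r ^ k \<le> a / 2 * r ^ l"
  proof -
    have "N * r ^ k \<le> (a / 2 * r) * r ^ k" using r2 r1 by (intro mult_right_mono) auto
    also have "\<dots> \<le> a / 2 * r ^ l" using rl a by (simp add: mult.assoc)
    finally show ?thesis .
  qed
  have Re: "a / 2 * r ^ l \<le> Re (Q A B (of_real r))"
  proof -
    have "Re (Q A B (of_real r)) = Re A * r ^ l + Re B * r ^ k"
      unfolding Q_def by (simp flip: of_real_power)
    moreover have "a * r ^ l \<le> Re A * r ^ l" using a r1 by (intro mult_right_mono) auto
    moreover have "- (N * r ^ k) \<le> Re B * r ^ k"
    proof -
      have "- N \<le> Re B" using a(4) abs_Re_le_cmod[of B] by linarith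
      then have "- N * r ^ k \<le> Re B * r ^ k" using r1 by (intro mult_right_mono) auto
      then show ?thesis by simp
    qed
    ultimately show ?thesis using rk by (simp add: field_simps)
  qed
  have rl0: "1 \<le> r ^ l" using r1 by simp
  have S: "coef_size A B r \<le> (N + a) * r ^ l"
  proof -
    have "cmod A * r ^ l \<le> N * r ^ l" "cmod B * r ^ k \<le> N * r ^ k" using a r1 by (auto intro!: mult_right_mono)
    moreover have "a / 2 * r ^ l \<le> a * r ^ l" using a r1 by (intro mult_right_mono) auto
    ultimately show ?thesis using rk unfolding coef_size_def by (simp add: algebra_simps)
  qed
  show "0 \<le> Re (Q A B (of_real r)) \<and> a / (2 * (N + a)) * coef_size A B r \<le> cmod (Q A B (of_real r)) \<and> a \<le> coef_size A B r"
  proof (intro conjI)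
    have p: "0 \<le> a / 2 * r ^ l" using a r1 by simp
    then show "0 \<le> Re (Q A B (of_real r))" using Re by linarith
    have "a / (2 * (N + a)) * coef_size A B r \<le> a / (2 * (N + a)) * ((N + a) * r ^ l)"
      using a N0 S by (intro mult_left_mono) auto
    also have "\<dots> = a / 2 * r ^ l" using a N0 by (simp add: field_simps)
    also have "\<dots> \<le> cmod (Q A B (of_real r))" using Re complex_Re_le_cmod[of "Q A B (of_real r)"] by linarith
    finally show "a / (2 * (N + a)) * coef_size A B r \<le> cmod (Q A B (of_real r))" .
    have "a * 1 \<le> cmod A * r ^ l" using a rl0 complex_Re_le_cmod[of A] by (intro mult_mono) auto
    then show "a \<le> coef_size A B r" unfolding coef_size_def using r1 by (simp add: add_increasing2)
  qed
qed

text \<open>If A and B lie in one sector about the positive axis, the real parts of both terms add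
  up without cancellation from r = 1 on. A may be 0, so the constants stay uniform while the degree
  of Q drops from l to k; the limit of large zeta rests on this.\<close>

lemma admissible_Re_sector:
  assumes \<kappa>: "0 \<le> \<kappa>" and A: "\<kappa> * cmod A \<le> Re A" and B: "\<kappa> * cmod B \<le> Re B" and \<mu>: "\<mu> \<le> cmod B" "0 \<le> \<mu>"
  shows "admissible \<kappa> \<mu> 1 A B"
  unfolding admissible_def
proof (intro allI impI)
  fix r :: real assume r: "1 \<le> r"
  have Re: "Re (Q A B (of_real r)) = Re A * r ^ l + Re B * r ^ k"
    unfolding Q_def by (simp flip: of_real_power)
  have "\<kappa> * cmod A * r ^ l \<le> Re A * r ^ l" "\<kappa> * cmod B * r ^ k \<le> Re B * r ^ k"
    using A B r by (auto intro!: mult_right_mono)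
  then have S: "\<kappa> * coef_size A B r \<le> Re (Q A B (of_real r))" unfolding Re coef_size_def by (simp add: algebra_simps)
  have "\<mu> * 1 \<le> cmod B * r ^ k" using \<mu> r by (intro mult_mono) auto
  then have "\<mu> \<le> coef_size A B r" unfolding coef_size_def using r by (simp add: add_increasing)
  moreover have "0 \<le> \<kappa> * coef_size A B r" using \<kappa> r by (simp add: coef_size_def)
  ultimately show "0 \<le> Re (Q A B (of_real r)) \<and> \<kappa> * coef_size A B r \<le> cmod (Q A B (of_real r)) \<and> \<mu> \<le> coef_size A B r"
    using S complex_Re_le_cmod[of "Q A B (of_real r)"] by auto
qed

definition loc_admissible :: "complex set \<Rightarrow> (complex \<Rightarrow> complex) \<Rightarrow> (complex \<Rightarrow> complex) \<Rightarrow> bool" where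
  "loc_admissible S a b \<longleftrightarrow> (\<forall>s\<in>S. \<exists>d \<kappa> \<mu> R. 0 < d \<and> 0 < \<kappa> \<and> \<kappa> \<le> 1 \<and> 0 < \<mu> \<and> 0 < R \<and> (\<forall>t\<in>cball s d \<inter> S. admissible \<kappa> \<mu> R (a t) (b t)))"

lemma conn_holomorphic:
  assumes "open S" "a holomorphic_on S" "b holomorphic_on S" "loc_admissible S a b"
  shows "(\<lambda>t. conn0 (a t) (b t)) holomorphic_on S" "(\<lambda>t. conn1 (a t) (b t)) holomorphic_on S"
  unfolding conn0_def conn1_def using assms unfolding loc_admissible_def
  by (auto intro!: holomorphic_intros lim_wr_holomorphic)

lemma loc_admissible_Re_pos:
  assumes "continuous_on S a" "continuous_on S b" "\<And>s. s \<in> S \<Longrightarrow> 0 < Re (a s)"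
  shows "loc_admissible S a b"
  unfolding loc_admissible_def
proof
  fix s assume s: "s \<in> S"
  define a0 where "a0 = Re (a s) / 2"
  define N where "N = max (cmod (a s)) (cmod (b s)) + 1"
  have a0: "0 < a0" "a0 < Re (a s)" using assms(3)[OF s] by (auto simp: a0_def)
  have N: "cmod (a s) < N" "cmod (b s) < N" "0 < N" using norm_ge_zero[of "a s"] unfolding N_def by linarith+
  have ta: "(a \<longlongrightarrow> a s) (at s within S)" "(b \<longlongrightarrow> b s) (at s within S)" using assms s by (auto simp: continuous_on)
  have "\<forall>\<^sub>F t in at s within S. a0 < Re (a t) \<and> cmod (a t) < N \<and> cmod (b t) < N"
    using order_tendstoD(1)[OF tendsto_Re[OF ta(1)] a0(2)] order_tendstoD(2)[OF tendsto_norm[OF ta(1)] N(1)]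
      order_tendstoD(2)[OF tendsto_norm[OF ta(2)] N(2)]
    by (intro eventually_conj)
  then obtain d where d: "0 < d" "\<And>t. t \<in> S \<Longrightarrow> t \<noteq> s \<Longrightarrow> dist t s \<le> d \<Longrightarrow> a0 < Re (a t) \<and> cmod (a t) < N \<and> cmod (b t) < N"
    unfolding eventually_at_le by blast
  have "admissible (a0 / (2 * (N + a0))) a0 (max 1 (2 * N / a0)) (a t) (b t)" if "t \<in> cball s d \<inter> S" for t
    using that d(2)[of t] a0 N by (intro admissible_Re_pos) (cases "t = s"; auto simp: dist_commute)+
  moreover have "a0 / (2 * (N + a0)) \<le> 1" "0 < a0 / (2 * (N + a0))" using a0 N by (auto simp: field_simps)
  ultimately show "\<exists>d \<kappa> \<mu> R. 0 < d \<and> 0 < \<kappa> \<and> \<kappa> \<le> 1 \<and> 0 < \<mu> \<and> 0 < R \<and> (\<forall>t\<in>cball s d \<inter> S. admissible \<kappa> \<mu> R (a t) (b t))"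
    using d(1) a0(1) by (intro exI[of _ d] exI[of _ "a0 / (2 * (N + a0))"] exI[of _ a0] exI[of _ "max 1 (2 * N / a0)"]) auto
qed

lemma loc_admissible_monomial:
  assumes "continuous_on S b" "\<And>s. s \<in> S \<Longrightarrow> 0 < Re (b s)"
  shows "loc_admissible S (\<lambda>_. 0) b"
  unfolding loc_admissible_def
proof
  fix s assume s: "s \<in> S"
  define b0 where "b0 = Re (b s) / 2"
  define N where "N = cmod (b s) + 1"
  have b0: "0 < b0" "b0 < Re (b s)" using assms(2)[OF s] by (auto simp: b0_def)
  have N: "cmod (b s) < N" "0 < N" by (auto simp: N_def intro: add_nonneg_pos)
  have b0N: "b0 < N" using b0 N complex_Re_le_cmod[of "b s"] by linarith
  have ta: "(b \<longlongrightarrow> b s) (at s within S)" using assms s by (auto simp: continuous_on)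
  have "\<forall>\<^sub>F t in at s within S. b0 < Re (b t) \<and> cmod (b t) < N"
    using order_tendstoD(1)[OF tendsto_Re[OF ta] b0(2)] order_tendstoD(2)[OF tendsto_norm[OF ta] N(1)]
    by (intro eventually_conj)
  then obtain d where d: "0 < d" "\<And>t. t \<in> S \<Longrightarrow> t \<noteq> s \<Longrightarrow> dist t s \<le> d \<Longrightarrow> b0 < Re (b t) \<and> cmod (b t) < N"
    unfolding eventually_at_le by blast
  have "admissible (b0 / N) b0 1 0 (b t)" if "t \<in> cball s d \<inter> S" for t
  proof (rule admissible_Re_sector)
    have t: "b0 < Re (b t)" "cmod (b t) < N"
      using that d(2)[of t] b0 N by (cases "t = s"; auto simp: dist_commute)+
    have "b0 / N * cmod (b t) \<le> b0 / N * N" using t b0 N by (intro mult_left_mono) auto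
    then show "b0 / N * cmod (b t) \<le> Re (b t)" using N t by simp
    show "b0 \<le> cmod (b t)" using t complex_Re_le_cmod[of "b t"] by linarith
  qed (use b0 N in auto)
  then show "\<exists>d \<kappa> \<mu> R. 0 < d \<and> 0 < \<kappa> \<and> \<kappa> \<le> 1 \<and> 0 < \<mu> \<and> 0 < R \<and> (\<forall>t\<in>cball s d \<inter> S. admissible \<kappa> \<mu> R 0 (b t))"
    using d(1) b0(1) N b0N by (intro exI[of _ d] exI[of _ "b0 / N"] exI[of _ b0] exI[of _ 1]) auto
qed

text \<open>Rotating the half-line amounts to a complex scaling \<open>s = exp x\<close> of the coefficients;
  the scaling law extends from real \<open>x\<close> by the identity theorem, so no path in the complex
  \<open>r\<close>-plane is ever needed.\<close>

lemma conn_scale_exp: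
  assumes S: "open S" "connected S" and re: "\<And>t::real. of_real t \<in> S"
    and loc: "loc_admissible S (\<lambda>x. A * exp (of_nat (Suc l) * x)) (\<lambda>x. B * exp (of_nat (Suc k) * x))"
    and x: "x \<in> S"
  shows "conn0 A B = exp (x / 2) * conn0 (A * exp (of_nat (Suc l) * x)) (B * exp (of_nat (Suc k) * x))"
    "conn1 A B = exp (- x / 2) * conn1 (A * exp (of_nat (Suc l) * x)) (B * exp (of_nat (Suc k) * x))"
proof -
  let ?A = "\<lambda>x. A * exp (of_nat (Suc l) * x)" and ?B = "\<lambda>x. B * exp (of_nat (Suc k) * x)"
  have hol: "?A holomorphic_on S" "?B holomorphic_on S" by (intro holomorphic_intros)+
  note h = conn_holomorphic[OF S(1) hol loc]
  have h0: "(\<lambda>x. exp (x / 2) * conn0 (?A x) (?B x) - conn0 A B) holomorphic_on S"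
    and h1: "(\<lambda>x. exp (- x / 2) * conn1 (?A x) (?B x) - conn1 A B) holomorphic_on S"
    using h by (auto intro!: holomorphic_intros)
  have 0: "0 \<in> S" using re[of 0] by simp
  obtain \<kappa> \<mu> R where adm: "admissible \<kappa> \<mu> R A B" "0 < \<kappa>" "\<kappa> \<le> 1" "0 < \<mu>" "0 < R"
    using loc[unfolded loc_admissible_def, rule_format, OF 0] 0 by force
  have lim: "0 islimpt range complex_of_real"
  proof (rule islimptI)
    fix T assume "(0::complex) \<in> T" "open T"
    then obtain e where e: "e > 0" "ball 0 e \<subseteq> T" using open_contains_ball by blast
    then have "complex_of_real (e / 2) \<in> T" by (auto simp: subset_iff)
    then show "\<exists>y\<in>range complex_of_real. y \<in> T \<and> y \<noteq> 0"       using e(1) by (intro bexI[OF _ rangeI[of complex_of_real "e/2"]]) auto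
  qed
  have real: "exp (z / 2) * conn0 (?A z) (?B z) - conn0 A B = 0" "exp (- z / 2) * conn1 (?A z) (?B z) - conn1 A B = 0"
    if z: "z \<in> range complex_of_real" for z
  proof -
    obtain t where t: "z = of_real t" using z by blast
    have e: "exp (of_nat n * complex_of_real t) = of_real (exp t) ^ n" for n
      by (simp add: exp_of_nat_mult exp_of_real)
    have s: "sqrt (exp t) = exp (t / 2)" by (rule real_sqrt_unique) (simp_all add: exp_double[symmetric])
    have e2: "complex_of_real (sqrt (exp t)) = exp (z / 2)"
      unfolding s t by (simp add: exp_of_real[symmetric])
    note c = conn_scale[OF exp_gt_zero[of t] _ _ adm, of "?A z" "?B z", unfolded e2]
    have AB: "?A z = A * of_real (exp t) ^ Suc l" "?B z = B * of_real (exp t) ^ Suc k"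
      unfolding t e by simp_all
    show "exp (z / 2) * conn0 (?A z) (?B z) - conn0 A B = 0" using c(1)[OF AB] by simp
    show "exp (- z / 2) * conn1 (?A z) (?B z) - conn1 A B = 0" unfolding c(2)[OF AB]
      by (simp add: exp_minus)
  qed
  have sub: "range complex_of_real \<subseteq> S" using re by auto
  have "exp (x / 2) * conn0 (?A x) (?B x) - conn0 A B = 0"
    by (rule analytic_continuation[OF h0 S sub 0 lim real(1) x])
  then show "conn0 A B = exp (x / 2) * conn0 (?A x) (?B x)" by simp
  have "exp (- x / 2) * conn1 (?A x) (?B x) - conn1 A B = 0"
    by (rule analytic_continuation[OF h1 S sub 0 lim real(2) x])
  then show "conn1 A B = exp (- x / 2) * conn1 (?A x) (?B x)" by simp
qed

section \<open>Conjugation symmetry and the ray where Q is imaginary\<close>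

lemma Q_cnj: "cnj (Q A B z) = Q (cnj A) (cnj B) (cnj z)"
  by (simp add: Q_def)

lemma wr_cnj:
  assumes "Q A B z \<notin> \<real>\<^sub>\<le>\<^sub>0"
  shows "cnj (wr \<sigma> A B p q z) = wr (cnj \<sigma>) (cnj A) (cnj B) (cnj p) (cnj q) (cnj z)"
proof -

  have 2: "cnj (\<Phi> A B z) = \<Phi> (cnj A) (cnj B) (cnj z)" by (simp add: \<Phi>_def del: of_nat_Suc)
  have 3: "cnj (dQ A B z) = dQ (cnj A) (cnj B) (cnj z)" by (simp add: dQ_def)
  show ?thesis unfolding wr_def wkb'_def wkb_def
    by (simp add: sol_cnj sol'_cnj cnj_csqrt[OF assms] 2 3 Q_cnj exp_cnj)
qed

lemma conn_cnj:
  assumes adm: "admissible \<kappa> \<mu> R A B" "0 < \<kappa>" "\<kappa> \<le> 1" "0 < \<mu>" "0 < R"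
  shows "conn0 (cnj A) (cnj B) = cnj (conn0 A B)" "conn1 (cnj A) (cnj B) = cnj (conn1 A B)"
proof -
  have "lim_wr (cnj A) (cnj B) p q = cnj (lim_wr A B (cnj p) (cnj q))" for p q
  proof -
    have "((\<lambda>r. cnj (wr (-1) A B (cnj p) (cnj q) (of_real r))) \<longlongrightarrow> cnj (lim_wr A B (cnj p) (cnj q))) at_top"
      by (intro tendsto_intros wr_tendsto_lim_wr[OF adm])
    moreover have "\<forall>\<^sub>F r in at_top. cnj (wr (-1) A B (cnj p) (cnj q) (of_real r)) = wr (-1) (cnj A) (cnj B) p q (of_real r)"
      using eventually_ge_at_top[of R]
    proof eventually_elim
      case (elim r)
      show ?case using wr_cnj[OF admissible_Q(2)[OF adm(1,2,4) elim], of "-1" "cnj p" "cnj q"] by simp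
    qed
    ultimately have "((\<lambda>r. wr (-1) (cnj A) (cnj B) p q (of_real r)) \<longlongrightarrow> cnj (lim_wr A B (cnj p) (cnj q))) at_top"
      by (rule Lim_transform_eventually)
    then show ?thesis unfolding lim_wr_def[of "cnj A"] by (intro tendsto_Lim) auto
  qed
  from this[of 0 1] this[of 1 0] show "conn0 (cnj A) (cnj B) = cnj (conn0 A B)" "conn1 (cnj A) (cnj B) = cnj (conn1 A B)"
    by (simp_all add: conn0_def conn1_def)
qed

lemma coeff_neg: "coeff (- A) (- B) p q n = coeff A B p q n"
proof (induction n rule: less_induct)
  case (less n)
  consider "n = 0" | "n = Suc 0" | j where "n = Suc (Suc j)" by (metis not0_implies_Suc)
  then show ?case
  proof cases
    case 3
    have IH: "coeff (- A) (- B) p q (j - e) = coeff A B p q (j - e)" for e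
      using less.IH[of "j - e"] 3 by simp
    show ?thesis unfolding 3 ode_coeff.simps IH by simp
  qed auto
qed

lemma sol_neg: "sol (- A) (- B) p q z = sol A B p q z" "sol' (- A) (- B) p q z = sol' A B p q z"
proof -
  have "coeff (- A) (- B) p q = coeff A B p q" by (rule ext) (rule coeff_neg)
  then show "sol (- A) (- B) p q z = sol A B p q z" "sol' (- A) (- B) p q z = sol' A B p q z"
    by (simp_all add: sol_def sol'_def sol_fps_def)
qed

text \<open>On a ray where \<open>Q\<close> is purely imaginary the equation is real, and the flux of the WKB function
  through every point is the same.\<close>

lemma neutral_flux:
  fixes q1 q2 r :: real
  defines "A \<equiv> \<i> * of_real q1" and "B \<equiv> \<i> * of_real q2"
  assumes pos: "0 < q1 * r ^ l + q2 * r ^ k"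
  shows "wr (-1) A B 0 1 (of_real r) * cnj (- wr (-1) A B 1 0 (of_real r))
       - (- wr (-1) A B 1 0 (of_real r)) * cnj (wr (-1) A B 0 1 (of_real r)) = 2 * \<i>"
proof -
  let ?r = "complex_of_real r"
  define a where "a = wr (-1) A B 0 1 ?r"
  define b where "b = - wr (-1) A B 1 0 ?r"
  define h where "h = q1 * r ^ l + q2 * r ^ k"
  have AB: "cnj A = - A" "cnj B = - B" by (simp_all add: A_def B_def)
  have real: "cnj (sol A B (of_real p) (of_real q) ?r) = sol A B (of_real p) (of_real q) ?r"
    "cnj (sol' A B (of_real p) (of_real q) ?r) = sol' A B (of_real p) (of_real q) ?r" for p q :: real
    by (simp_all add: sol_cnj sol'_cnj AB sol_neg)
  let ?\<psi> = "wkb (-1) A B ?r" and ?\<psi>' = "wkb' (-1) A B ?r"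
  note m = sol_matching[OF a_def b_def]
  have l: "?\<psi> = a * sol A B 1 0 ?r + b * sol A B 0 1 ?r" "?\<psi>' = a * sol' A B 1 0 ?r + b * sol' A B 0 1 ?r"
    using m sol_linear[of A B a b ?r] sol'_linear[of A B a b ?r] by simp_all
  have cl: "cnj ?\<psi> = cnj a * sol A B 1 0 ?r + cnj b * sol A B 0 1 ?r" "cnj ?\<psi>' = cnj a * sol' A B 1 0 ?r + cnj b * sol' A B 0 1 ?r"
    unfolding l using real[of 1 0] real[of 0 1] by simp_all
  have "?\<psi> * cnj ?\<psi>' - ?\<psi>' * cnj ?\<psi> = (a * cnj b - b * cnj a) * (sol A B 1 0 ?r * sol' A B 0 1 ?r - sol' A B 1 0 ?r * sol A B 0 1 ?r)"
    unfolding cl unfolding l by (simp add: algebra_simps)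
  then have 1: "?\<psi> * cnj ?\<psi>' - ?\<psi>' * cnj ?\<psi> = a * cnj b - b * cnj a" by (simp add: sol_wronskian)
  have Q: "Q A B ?r = \<i> * of_real h" by (simp add: Q_def A_def B_def h_def algebra_simps)
  have hp: "h > 0" using pos by (simp add: h_def)
  obtain d where d: "dQ A B ?r = \<i> * of_real d"
  proof
    show "dQ A B ?r = \<i> * of_real (real l * q1 * r ^ (l - 1) + real k * q2 * r ^ (k - 1))"
      by (simp add: dQ_def A_def B_def algebra_simps)
  qed
  have "\<Phi> A B ?r = \<i> * of_real (q1 * r ^ Suc l / real (Suc l) + q2 * r ^ Suc k / real (Suc k))"
    unfolding \<Phi>_def A_def B_def by (simp add: algebra_simps del: of_nat_Suc)
  then have "Re (\<Phi> A B ?r) = 0" by simp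
  then have "cmod (exp (- 1 * \<Phi> A B ?r)) = 1" by simp
  moreover have "(cmod (csqrt (Q A B ?r)))\<^sup>2 = h"
    using hp by (simp add: norm_power[symmetric] Q norm_mult)
  ultimately have "(cmod ?\<psi>)\<^sup>2 = 1 / h"
    unfolding wkb_def norm_divide power_divide using hp by simp
  then have n: "?\<psi> * cnj ?\<psi> = of_real (1 / h)" by (simp add: complex_norm_square[symmetric])
  have "dQ A B ?r / (2 * Q A B ?r) = of_real (d / (2 * h))" unfolding d Q using hp by simp
  then have w: "?\<psi>' = ?\<psi> * (- \<i> * of_real h - of_real (d / (2 * h)))" "cnj ?\<psi>' = cnj ?\<psi> * (\<i> * of_real h - of_real (d / (2 * h)))"
    unfolding wkb'_def Q by simp_all
  have "?\<psi> * cnj ?\<psi>' - ?\<psi>' * cnj ?\<psi> = (?\<psi> * cnj ?\<psi>) * (2 * \<i> * of_real h)"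
    unfolding w by (simp add: algebra_simps)
  also have "\<dots> = 2 * \<i>" unfolding n using hp by simp
  finally show ?thesis using 1 unfolding a_def b_def by simp
qed

section \<open>Rotation of the half-line\<close>

definition strip :: "real \<Rightarrow> complex set" where "strip \<omega> = {x. \<bar>Im x\<bar> < \<omega>}"

lemma strip: "open (strip \<omega>)" "connected (strip \<omega>)"
proof -
  have "strip \<omega> = {x. Im x < \<omega>} \<inter> {x. Im x > - \<omega>}" by (auto simp: strip_def)
  then show "open (strip \<omega>)" "connected (strip \<omega>)"
    by (auto intro!: open_Int open_halfspace_Im_lt open_halfspace_Im_gt convex_connected convex_Int convex_halfspace_Im_lt convex_halfspace_Im_gt)
qed

lemma Re_exp_strip:
  assumes "x \<in> strip (pi / (2 * real n))" "0 < n"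
  shows "0 < Re (exp (of_nat n * x))"
proof -
  have "\<bar>real n * Im x\<bar> < pi / 2"
    using assms by (simp add: strip_def abs_mult field_simps)
  then have "0 < cos (real n * Im x)" by (intro cos_gt_zero_pi) auto
  then show ?thesis by (simp add: Re_exp)
qed

text \<open>An imaginary x in the strip is a rotation by less than pi/(2(l+1)), for which the
  leading coefficient keeps a positive real part. At the boundary angle that coefficient is
  imaginary; this case is reached by continuity in \<open>conn_neutral\<close>.\<close>

lemma conn_rotate:
  assumes "x \<in> strip (pi / (2 * real (Suc l)))"
  shows "conn0 1 B = exp (x / 2) * conn0 (exp (of_nat (Suc l) * x)) (B * exp (of_nat (Suc k) * x))"
    "conn1 1 B = exp (- x / 2) * conn1 (exp (of_nat (Suc l) * x)) (B * exp (of_nat (Suc k) * x))"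
proof -
  let ?S = "strip (pi / (2 * real (Suc l)))"
  have loc: "loc_admissible ?S (\<lambda>x. 1 * exp (of_nat (Suc l) * x)) (\<lambda>x. B * exp (of_nat (Suc k) * x))"
    by (rule loc_admissible_Re_pos)
       (use Re_exp_strip[of _ "Suc l"] in \<open>auto intro!: continuous_intros simp del: of_nat_Suc\<close>)
  have re: "of_real t \<in> ?S" for t by (simp add: strip_def)
  show "conn0 1 B = exp (x / 2) * conn0 (exp (of_nat (Suc l) * x)) (B * exp (of_nat (Suc k) * x))"
    "conn1 1 B = exp (- x / 2) * conn1 (exp (of_nat (Suc l) * x)) (B * exp (of_nat (Suc k) * x))"
    using conn_scale_exp[OF strip re loc assms] by simp_all
qed

text \<open>With A = 0 only the phase of B counts, so the larger strip belonging to k + 1 is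
  allowed. It is used to identify the limit values for all directions of a sector at once.\<close>

lemma conn_rotate_monomial:
  assumes "x \<in> strip (pi / (2 * real (Suc k)))"
  shows "conn0 0 1 = exp (x / 2) * conn0 0 (exp (of_nat (Suc k) * x))"
    "conn1 0 1 = exp (- x / 2) * conn1 0 (exp (of_nat (Suc k) * x))"
proof -
  let ?S = "strip (pi / (2 * real (Suc k)))"
  have "loc_admissible ?S (\<lambda>_. 0) (\<lambda>x. exp (of_nat (Suc k) * x))"
    by (intro loc_admissible_monomial continuous_intros Re_exp_strip) auto
  then have loc: "loc_admissible ?S (\<lambda>x. 0 * exp (of_nat (Suc l) * x)) (\<lambda>x. 1 * exp (of_nat (Suc k) * x))"
    by simp
  have re: "of_real t \<in> ?S" for t by (simp add: strip_def)
  show "conn0 0 1 = exp (x / 2) * conn0 0 (exp (of_nat (Suc k) * x))"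
    "conn1 0 1 = exp (- x / 2) * conn1 0 (exp (of_nat (Suc k) * x))"
    using conn_scale_exp[OF strip re loc assms] by simp_all
qed

section \<open>The quantum Wronskian\<close>

text \<open>With s = exp(i \<open>\<alpha>\<close>) one has s^(l+1) = -1 and s^(k+1) = -exp(-i
  \<open>\<theta>\<close>). Since the equation contains Q squared and ignores its sign, replacing x
  by s x amounts to replacing zeta by exp(-i \<open>\<theta>\<close>) zeta.\<close>

definition \<alpha> :: real where "\<alpha> = pi / real (Suc l)"

definition \<theta> :: real where "\<theta> = pi * real (l - k) / real (Suc l)"

definition fa :: "complex \<Rightarrow> complex" where "fa \<zeta> = conn0 1 (- \<zeta>)"

definition fb :: "complex \<Rightarrow> complex" where "fb \<zeta> = conn1 1 (- \<zeta>)"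

lemma fa_fb_holomorphic: "fa holomorphic_on S" "fb holomorphic_on S"
proof -
  have "loc_admissible UNIV (\<lambda>_. 1) (\<lambda>\<zeta>. - \<zeta>)"
    by (rule loc_admissible_Re_pos) (auto intro!: continuous_intros)
  moreover have "(\<lambda>\<zeta>::complex. - \<zeta>) holomorphic_on UNIV" by (intro holomorphic_intros)
  ultimately have "fa holomorphic_on UNIV" "fb holomorphic_on UNIV"
    unfolding fa_def[abs_def] fb_def[abs_def] by (auto intro: conn_holomorphic)
  then show "fa holomorphic_on S" "fb holomorphic_on S" by (auto intro: holomorphic_on_subset)
qed

lemma admissible_one: "\<exists>\<kappa> \<mu> R. admissible \<kappa> \<mu> R 1 B \<and> 0 < \<kappa> \<and> \<kappa> \<le> 1 \<and> 0 < \<mu> \<and> 0 < R"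
proof -
  define N where "N = max 1 (cmod B)"
  have "admissible (1 / (2 * (N + 1))) 1 (max 1 (2 * N / 1)) 1 B"
    by (rule admissible_Re_pos) (auto simp: N_def)
  moreover have "0 < 1 / (2 * (N + 1))" "1 / (2 * (N + 1)) \<le> 1" by (auto simp: N_def field_simps)
  ultimately show ?thesis by (intro exI[of _ "1 / (2 * (N + 1))"] exI[of _ 1] exI[of _ "max 1 (2 * N / 1)"]) auto
qed

lemma fa_fb_cnj: "fa (cnj \<zeta>) = cnj (fa \<zeta>)" "fb (cnj \<zeta>) = cnj (fb \<zeta>)"
proof -
  obtain \<kappa> \<mu> R where "admissible \<kappa> \<mu> R 1 (- \<zeta>)" "0 < \<kappa>" "\<kappa> \<le> 1" "0 < \<mu>" "0 < R" using admissible_one by blast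
  from conn_cnj[OF this] show "fa (cnj \<zeta>) = cnj (fa \<zeta>)" "fb (cnj \<zeta>) = cnj (fb \<zeta>)" by (simp_all add: fa_def fb_def)
qed

lemma theta_half: "\<theta> / 2 + pi / 2 * (real (Suc k) / real (Suc l)) = pi / 2"
proof -
  have "\<theta> / 2 + pi / 2 * (real (Suc k) / real (Suc l)) = pi / 2 * ((real (l - k) + real (Suc k)) / real (Suc l))"
    unfolding \<theta>_def by (simp add: add_divide_distrib distrib_left)
  also have "real (l - k) + real (Suc k) = real (Suc l)" using k_less_l by simp
  finally show ?thesis by simp
qed

text \<open>Put v = pi/2 - u and c = (k+1)/(l+1). The two terms of Re Q carry the factors sin v and
  sin(c v), and sin(c v) <= sin v, so the leading term dominates up to and including u = pi/2, where
  Q is imaginary. The constants do not depend on u, as the passage to that endpoint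
  requires.\<close>

lemma neutral_admissible:
  assumes \<rho>: "0 < \<rho>" and u: "0 \<le> u" "u \<le> pi / 2"
  shows "admissible (1/3) 1 (max 1 (2 * \<rho>)) (cis u) (- of_real \<rho> * cis (\<theta> / 2 + u * (real (Suc k) / real (Suc l))))"
  unfolding admissible_def
proof (intro allI impI)
  fix r assume r: "max 1 (2 * \<rho>) \<le> r"
  define c where "c = real (Suc k) / real (Suc l)"
  define v where "v = pi / 2 - u"
  define \<phi> where "\<phi> = \<theta> / 2 + u * c"
  have c: "0 < c" "c \<le> 1" using k_less_l by (auto simp: c_def)
  have v: "0 \<le> v" "v \<le> pi / 2" using u by (auto simp: v_def)
  have ph: "\<phi> = pi / 2 - v * c" using theta_half unfolding \<phi>_def v_def c_def[symmetric] by (simp add: algebra_simps)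
  have r1: "1 \<le> r" and r2: "2 * \<rho> \<le> r" using r by auto
  have rl: "r * r ^ k \<le> r ^ l" using r1 k_less_l power_increasing[of "Suc k" l r] by simp
  have "\<rho> * r ^ k \<le> (r / 2) * r ^ k" using r2 r1 by (intro mult_right_mono) auto
  then have rk: "\<rho> * r ^ k \<le> r ^ l / 2" using rl by simp
  let ?A = "cis u" and ?B = "- of_real \<rho> * cis (\<theta> / 2 + u * (real (Suc k) / real (Suc l)))"
  have S: "coef_size ?A ?B r = r ^ l + \<rho> * r ^ k" using \<rho> by (simp add: coef_size_def norm_mult)
  have "Re (Q ?A ?B (of_real r)) = cos u * r ^ l - \<rho> * cos \<phi> * r ^ k"
    unfolding Q_def \<phi>_def c_def by (simp flip: of_real_power)
  also have "\<dots> = sin v * r ^ l - \<rho> * r ^ k * sin (v * c)"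
    unfolding ph v_def by (simp add: cos_diff sin_diff)
  also have "\<dots> \<ge> sin v * r ^ l - r ^ l / 2 * sin v"
  proof -
    have "v * c \<le> v * 1" using v c by (intro mult_left_mono) auto
    then have "sin (v * c) \<le> sin v" using v c pi_gt_zero by (intro sin_monotone_2pi_le) (auto intro: order_trans[of _ 0])
    moreover have "0 \<le> v * c" using v c by simp
    then have "0 \<le> sin (v * c)" using v c \<open>v * c \<le> v * 1\<close> by (intro sin_ge_zero) auto
    ultimately have "\<rho> * r ^ k * sin (v * c) \<le> r ^ l / 2 * sin v"
      using rk \<rho> r1 by (intro mult_mono) auto
    then show ?thesis by (simp add: mult.commute)
  qed
  finally have Re: "sin v * r ^ l / 2 \<le> Re (Q ?A ?B (of_real r))" by simp
  have "0 \<le> sin v" using v by (intro sin_ge_zero) auto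
  then have Re0: "0 \<le> Re (Q ?A ?B (of_real r))" using Re r1 by (smt (verit) divide_nonneg_pos mult_nonneg_nonneg zero_le_power)
  have rl1: "1 \<le> r ^ l" using r1 by simp
  have "cmod (?A * of_real r ^ l) - cmod (- (?B * of_real r ^ k)) \<le> cmod (?A * of_real r ^ l - - (?B * of_real r ^ k))"
    by (rule norm_triangle_ineq2)
  then have "r ^ l - \<rho> * r ^ k \<le> cmod (Q ?A ?B (of_real r))"
    unfolding Q_def using \<rho> r1 by (simp add: norm_mult norm_power)
  moreover have "1/3 * coef_size ?A ?B r \<le> r ^ l - \<rho> * r ^ k" unfolding S using rk by (simp add: field_simps)
  ultimately have "1/3 * coef_size ?A ?B r \<le> cmod (Q ?A ?B (of_real r))" by (rule order_trans[rotated])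
  moreover have "1 \<le> coef_size ?A ?B r" unfolding S using rl1 \<rho> r1 by (simp add: add_increasing2)
  ultimately show "0 \<le> Re (Q ?A ?B (of_real r)) \<and> 1/3 * coef_size ?A ?B r \<le> cmod (Q ?A ?B (of_real r)) \<and> 1 \<le> coef_size ?A ?B r"
    using Re0 by blast
qed

text \<open>\<open>conn_rotate\<close> covers the angles u < pi/2. Both sides are continuous on the
  closed interval, which carries the identity to u = pi/2, outside the reach of the strip.\<close>

lemma conn_neutral:
  assumes \<rho>: "0 < \<rho>"
  shows "fa (of_real \<rho> * cis (\<theta> / 2)) = cis (\<alpha> / 4) * conn0 \<i> (- \<i> * of_real \<rho>)"
    "fb (of_real \<rho> * cis (\<theta> / 2)) = cis (- \<alpha> / 4) * conn1 \<i> (- \<i> * of_real \<rho>)"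
proof -
  define c where "c = real (Suc k) / real (Suc l)"
  let ?a = "\<lambda>u::real. cis u" and ?b = "\<lambda>u::real. - of_real \<rho> * cis (\<theta> / 2 + u * c)"
  let ?T = "{0..pi/2}"
  have adm: "admissible (1/3) 1 (max 1 (2 * \<rho>)) (?a u) (?b u)" if "u \<in> ?T" for u
    using neutral_admissible[OF \<rho>, of u] that by (simp add: c_def)
  have cont: "continuous_on ?T (\<lambda>u. lim_wr (?a u) (?b u) p q)" for p q
    by (rule lim_wr_continuous[where N = "max 1 \<rho>", OF _ _ _ _ adm]) (use \<rho> in \<open>auto simp: norm_mult intro!: continuous_intros\<close>)
  have c0: "continuous_on ?T (\<lambda>u. cis (u / (2 * real (Suc l))) * conn0 (?a u) (?b u) - fa (of_real \<rho> * cis (\<theta> / 2)))"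
    unfolding conn0_def by (intro continuous_intros cont) auto
  have c1: "continuous_on ?T (\<lambda>u. cis (- u / (2 * real (Suc l))) * conn1 (?a u) (?b u) - fb (of_real \<rho> * cis (\<theta> / 2)))"
    unfolding conn1_def by (intro continuous_intros cont) auto
  have cl: "closure {0..<pi/2} = ?T" by (simp add: closure_atLeastLessThan)
  have eq: "fa (of_real \<rho> * cis (\<theta> / 2)) = cis (u / (2 * real (Suc l))) * conn0 (?a u) (?b u)"
      "fb (of_real \<rho> * cis (\<theta> / 2)) = cis (- u / (2 * real (Suc l))) * conn1 (?a u) (?b u)" if u: "u \<in> {0..<pi/2}" for u
  proof -
    define x where "x = \<i> * of_real (u / real (Suc l))"
    have x: "x \<in> strip (pi / (2 * real (Suc l)))"
      using u by (simp add: strip_def x_def field_simps abs_if del: of_nat_Suc)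
    have e: "exp (of_nat (Suc l) * x) = cis u" "exp (of_nat (Suc k) * x) = cis (u * c)"
      "exp (x / 2) = cis (u / (2 * real (Suc l)))" "exp (- x / 2) = cis (- u / (2 * real (Suc l)))"
      unfolding cis_conv_exp x_def c_def by (simp_all add: mult_ac del: of_nat_Suc)
    have b: "- (of_real \<rho> * cis (\<theta> / 2)) * cis (u * c) = ?b u" by (simp add: cis_mult)
    show "fa (of_real \<rho> * cis (\<theta> / 2)) = cis (u / (2 * real (Suc l))) * conn0 (?a u) (?b u)"
      "fb (of_real \<rho> * cis (\<theta> / 2)) = cis (- u / (2 * real (Suc l))) * conn1 (?a u) (?b u)"
      unfolding fa_def fb_def using conn_rotate[OF x, of "- (of_real \<rho> * cis (\<theta> / 2))"] unfolding e b by simp_all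
  qed
  have h: "pi / 2 \<in> closure {0..<pi/2}" unfolding cl by simp
  have 0: "cis (pi / 2 / (2 * real (Suc l))) * conn0 (?a (pi/2)) (?b (pi/2)) - fa (of_real \<rho> * cis (\<theta> / 2)) = 0"
    by (rule continuous_constant_on_closure[OF c0[folded cl] _ h]) (simp add: eq(1))
  have 1: "cis (- (pi / 2) / (2 * real (Suc l))) * conn1 (?a (pi/2)) (?b (pi/2)) - fb (of_real \<rho> * cis (\<theta> / 2)) = 0"
    by (rule continuous_constant_on_closure[OF c1[folded cl] _ h]) (simp add: eq(2))
  have t: "\<theta> / 2 + pi / 2 * c = pi / 2" unfolding c_def by (rule theta_half)
  have al: "pi / 2 / (2 * real (Suc l)) = \<alpha> / 4" "- (pi / 2) / (2 * real (Suc l)) = - \<alpha> / 4"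
    by (simp_all add: \<alpha>_def)
  show "fa (of_real \<rho> * cis (\<theta> / 2)) = cis (\<alpha> / 4) * conn0 \<i> (- \<i> * of_real \<rho>)"
    "fb (of_real \<rho> * cis (\<theta> / 2)) = cis (- \<alpha> / 4) * conn1 \<i> (- \<i> * of_real \<rho>)"
    using 0 1 unfolding t al by (simp_all add: mult.commute)
qed

text \<open>\<open>neutral_flux\<close> gives the value 2i at each large r; the coefficients in it
  converge to the data of the decaying solution.\<close>

lemma conn_flux:
  assumes \<rho>: "0 < \<rho>"
  defines "a \<equiv> conn0 \<i> (- \<i> * of_real \<rho>)" and "b \<equiv> conn1 \<i> (- \<i> * of_real \<rho>)"
  shows "a * cnj b - b * cnj a = 2 * \<i>"
proof -
  have adm: "admissible (1/3) 1 (max 1 (2 * \<rho>)) \<i> (- \<i> * of_real \<rho>)"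
    using neutral_admissible[OF \<rho>, of "pi/2"] unfolding theta_half by (simp add: mult.commute)
  let ?w = "\<lambda>p q r. wr (-1) \<i> (- \<i> * of_real \<rho>) p q (of_real r)"
  have t: "(?w p q \<longlongrightarrow> lim_wr \<i> (- \<i> * of_real \<rho>) p q) at_top" for p q
    by (rule wr_tendsto_lim_wr[OF adm]) auto
  have "((\<lambda>r. ?w 0 1 r * cnj (- ?w 1 0 r) - (- ?w 1 0 r) * cnj (?w 0 1 r)) \<longlongrightarrow> a * cnj b - b * cnj a) at_top"
    unfolding a_def b_def conn0_def conn1_def by (intro tendsto_intros t)
  moreover have "\<forall>\<^sub>F r in at_top. ?w 0 1 r * cnj (- ?w 1 0 r) - (- ?w 1 0 r) * cnj (?w 0 1 r) = 2 * \<i>"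
    using eventually_ge_at_top[of "max 1 (2 * \<rho>)"]
  proof eventually_elim
    case (elim r)
    then have r1: "1 \<le> r" and r2: "2 * \<rho> \<le> r" by auto
    have "r * r ^ k \<le> r ^ l" using r1 k_less_l power_increasing[of "Suc k" l r] by simp
    moreover have "\<rho> * r ^ k < r * r ^ k" using r1 r2 \<rho> by (intro mult_strict_right_mono) auto
    ultimately have "0 < 1 * r ^ l + (- \<rho>) * r ^ k" by simp
    from neutral_flux[OF this] show ?case by simp
  qed
  ultimately have "((\<lambda>r. 2 * \<i>) \<longlongrightarrow> a * cnj b - b * cnj a) (at_top :: real filter)" by (rule Lim_transform_eventually)
  then show ?thesis using tendsto_const[of "2 * \<i>" "at_top :: real filter"] tendsto_unique by (metis trivial_limit_at_top_linorder)
qed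

text \<open>The left side is the Wronskian of the decaying solution with its rotated copy. On the
  ray arg zeta = \<open>\<theta>\<close>/2 the rotated parameter is the conjugate of zeta, so the
  second pair of data is the conjugate of the first and the Wronskian is the flux 2i times a phase.
  As the left side is entire in zeta, a ray accumulating at 0 determines it everywhere.\<close>

lemma quantum_wronskian:
  "cis (- \<alpha>) * fa \<zeta> * fb (cis (- \<theta>) * \<zeta>) - fb \<zeta> * fa (cis (- \<theta>) * \<zeta>) = 2 * \<i> * cis (- \<alpha> / 2)"
proof -
  let ?g = "\<lambda>\<zeta>. cis (- \<alpha>) * fa \<zeta> * fb (cis (- \<theta>) * \<zeta>) - fb \<zeta> * fa (cis (- \<theta>) * \<zeta>) - 2 * \<i> * cis (- \<alpha> / 2)"
  have comp: "(\<lambda>\<zeta>. fa (cis (- \<theta>) * \<zeta>)) holomorphic_on UNIV" "(\<lambda>\<zeta>. fb (cis (- \<theta>) * \<zeta>)) holomorphic_on UNIV"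
    using holomorphic_on_compose[OF _ fa_fb_holomorphic(1), of "\<lambda>\<zeta>. cis (- \<theta>) * \<zeta>" UNIV]
      holomorphic_on_compose[OF _ fa_fb_holomorphic(2), of "\<lambda>\<zeta>. cis (- \<theta>) * \<zeta>" UNIV]
    by (auto simp: o_def intro!: holomorphic_intros)
  have hol: "?g holomorphic_on UNIV" by (intro holomorphic_intros fa_fb_holomorphic comp)
  let ?U = "(\<lambda>\<rho>. of_real \<rho> * cis (\<theta> / 2)) ` {0<..}"
  have z: "?g x = 0" if "x \<in> ?U" for x
  proof -
    obtain \<rho> where \<rho>: "0 < \<rho>" "x = of_real \<rho> * cis (\<theta> / 2)" using \<open>x \<in> ?U\<close> by auto
    define a where "a = conn0 \<i> (- \<i> * of_real \<rho>)"
    define b where "b = conn1 \<i> (- \<i> * of_real \<rho>)"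
    note n = conn_neutral[OF \<rho>(1), folded \<rho>(2) a_def b_def]
    have "cis (- \<theta>) * x = cnj x" unfolding \<rho> by (simp add: cis_cnj cis_mult mult.left_commute)
    then have c: "fa (cis (- \<theta>) * x) = cis (- \<alpha> / 4) * cnj a" "fb (cis (- \<theta>) * x) = cis (\<alpha> / 4) * cnj b"
      by (simp_all add: fa_fb_cnj n cis_cnj)
    have "cis (- \<alpha>) * fa x * fb (cis (- \<theta>) * x) = (cis (- \<alpha>) * (cis (\<alpha> / 4) * cis (\<alpha> / 4))) * (a * cnj b)"
      unfolding c n by (simp add: mult_ac)
    moreover have "cis (- \<alpha>) * (cis (\<alpha> / 4) * cis (\<alpha> / 4)) = cis (- \<alpha> / 2)" by (simp add: cis_mult)
    moreover have "fb x * fa (cis (- \<theta>) * x) = (cis (- \<alpha> / 4) * cis (- \<alpha> / 4)) * (b * cnj a)"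
      unfolding c n by (simp add: mult_ac)
    moreover have "cis (- \<alpha> / 4) * cis (- \<alpha> / 4) = cis (- \<alpha> / 2)" by (simp add: cis_mult)
    ultimately have "?g x = cis (- \<alpha> / 2) * (a * cnj b - b * cnj a - 2 * \<i>)" by (simp add: algebra_simps)
    then show ?thesis using conn_flux[OF \<rho>(1)] unfolding a_def b_def by simp
  qed
  have lim: "0 islimpt ?U"
  proof (rule islimptI)
    fix T assume "(0::complex) \<in> T" "open T"
    then obtain e where e: "e > 0" "ball 0 e \<subseteq> T" using open_contains_ball by blast
    then have "complex_of_real (e / 2) * cis (\<theta> / 2) \<in> T" by (auto simp: subset_iff norm_mult)
    then show "\<exists>y\<in>?U. y \<in> T \<and> y \<noteq> 0"       using e(1) by (intro bexI[of _ "complex_of_real (e/2) * cis (\<theta> / 2)"] image_eqI[of _ _ "e/2"]) auto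
  qed
  have "?g \<zeta> = 0" by (rule analytic_continuation[OF hol open_UNIV connected_UNIV subset_UNIV UNIV_I lim z UNIV_I])
  then show ?thesis by simp
qed

section \<open>Asymptotics in a sector\<close>

text \<open>Homogeneity exponent of the equation f'' = (B x^k)^2 f, which is the rescaled limit for
  large zeta: its decaying solution has value B^(-\<open>pw\<close>) \<open>u0\<close> and slope
  B^\<open>pw\<close> \<open>u1\<close> at 0.\<close>

definition pw :: real where "pw = 1 / (2 * real (Suc k))"

definition u0 :: complex where "u0 = conn0 0 1"

definition u1 :: complex where "u1 = conn1 0 1"

text \<open>\<open>fa\<close> at zeta = -\<open>\<rho>\<close> exp(i \<open>\<psi>\<close>) with the
  expected power removed, and \<open>sc1\<close> likewise for \<open>fb\<close>. The angle is that
  of -zeta, so that \<open>\<psi>\<close> = 0 is the harmless direction in which both coefficients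
  of Q are positive.\<close>

definition sc0 :: "real \<Rightarrow> real \<Rightarrow> complex" where
  "sc0 \<rho> \<psi> = of_real (\<rho> powr pw) * cis (pw * \<psi>) * conn0 1 (of_real \<rho> * cis \<psi>)"

definition sc1 :: "real \<Rightarrow> real \<Rightarrow> complex" where
  "sc1 \<rho> \<psi> = of_real (\<rho> powr - pw) * cis (- pw * \<psi>) * conn1 1 (of_real \<rho> * cis \<psi>)"

definition cr :: real where "cr = real (Suc k) / real (Suc l)"

lemma cr: "0 < cr" "cr < 1" "pi - \<theta> = pi * cr" "0 < \<theta>" "\<theta> < pi"
proof -
  show c: "0 < cr" "cr < 1" using k_less_l by (auto simp: cr_def)
  have "real (l - k) = real (Suc l) - real (Suc k)" using k_less_l by simp
  then have t: "\<theta> = pi - pi * cr" unfolding \<theta>_def cr_def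
    by (simp only: right_diff_distrib diff_divide_distrib) simp
  then show "pi - \<theta> = pi * cr" by simp
  have "pi * cr < pi * 1" using c by (intro mult_strict_left_mono) auto
  then show "0 < \<theta>" unfolding t by simp
  have "0 < pi * cr" using c by simp
  then show "\<theta> < pi" unfolding t by simp
qed

lemma alpha_eq: "\<alpha> = 2 * pw * (pi - \<theta>)"
  unfolding cr(3) \<alpha>_def pw_def cr_def by (simp del: of_nat_Suc)

text \<open>The rotation divides the angle between the coefficients: A receives
  -\<open>\<psi>\<close>/2 and B keeps (1 - cr/2) \<open>\<psi>\<close>. For |\<open>\<psi>\<close>|
  <= pi - \<open>\<theta>\<close> = pi cr, B stays in the right half plane because (1 - cr/2) cr <
  1/2 says (1 - cr)^2 > 0. The constants persist down to \<open>\<tau>\<close> = 0.\<close>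

lemma sector_admissible:
  "\<exists>\<kappa>. 0 < \<kappa> \<and> \<kappa> \<le> 1 \<and> (\<forall>\<tau> \<psi>. 0 \<le> \<tau> \<longrightarrow> \<bar>\<psi>\<bar> \<le> pi - \<theta> \<longrightarrow>
     admissible \<kappa> 1 1 (of_real \<tau> * cis (- \<psi> / 2)) (cis ((1 - cr / 2) * \<psi>)))"
  and sector_angle: "\<bar>\<psi>\<bar> \<le> pi - \<theta> \<Longrightarrow> \<bar>(1 - cr / 2) * \<psi>\<bar> < pi / 2"
proof -
  define b where "b = (1 - cr / 2) * (pi - \<theta>)"
  have b: "0 \<le> b" "b < pi / 2"
  proof -
    show "0 \<le> b" unfolding b_def using cr by (intro mult_nonneg_nonneg) auto
    have "0 < (1 - cr)\<^sup>2" using cr by simp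
    then have "(1 - cr / 2) * cr < 1 / 2" by (simp add: power2_eq_square field_simps)
    then have "pi * ((1 - cr / 2) * cr) < pi * (1 / 2)" by (intro mult_strict_left_mono) auto
    then show "b < pi / 2" unfolding b_def cr(3) by (simp add: mult_ac)
  qed
  have a: "0 \<le> (pi - \<theta>) / 2" "(pi - \<theta>) / 2 < pi / 2" using cr by auto
  show s: "\<bar>(1 - cr / 2) * \<psi>\<bar> < pi / 2" if "\<bar>\<psi>\<bar> \<le> pi - \<theta>" for \<psi>
  proof -
    have "\<bar>(1 - cr / 2) * \<psi>\<bar> \<le> b" unfolding abs_mult b_def using that cr by (intro mult_mono) auto
    then show ?thesis using b by linarith
  qed
  define \<kappa> where "\<kappa> = min (cos ((pi - \<theta>) / 2)) (cos b)"
  have \<kappa>: "0 < \<kappa>" "\<kappa> \<le> 1" unfolding \<kappa>_def using a b by (auto intro!: cos_gt_zero_pi simp: min_le_iff_disj)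
  have "admissible \<kappa> 1 1 (of_real \<tau> * cis (- \<psi> / 2)) (cis ((1 - cr / 2) * \<psi>))" if \<tau>: "0 \<le> \<tau>" and \<psi>: "\<bar>\<psi>\<bar> \<le> pi - \<theta>" for \<tau> \<psi>
  proof (rule admissible_Re_sector)
    have "cos ((pi - \<theta>) / 2) \<le> cos \<bar>\<psi> / 2\<bar>" using \<psi> a by (intro cos_monotone_0_pi_le) auto
    then have "\<kappa> \<le> cos (\<psi> / 2)" unfolding \<kappa>_def cos_abs_real by simp
    then show "\<kappa> * cmod (of_real \<tau> * cis (- \<psi> / 2)) \<le> Re (of_real \<tau> * cis (- \<psi> / 2))"
      using \<tau> by (simp add: norm_mult mult.commute[of \<kappa>] mult_left_mono)
    have "\<bar>(1 - cr / 2) * \<psi>\<bar> \<le> b" unfolding abs_mult b_def using \<psi> cr by (intro mult_mono) auto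
    then have "cos b \<le> cos \<bar>(1 - cr / 2) * \<psi>\<bar>" using b by (intro cos_monotone_0_pi_le) auto
    then have "\<kappa> \<le> cos ((1 - cr / 2) * \<psi>)" unfolding \<kappa>_def cos_abs_real by simp
    then show "\<kappa> * cmod (cis ((1 - cr / 2) * \<psi>)) \<le> Re (cis ((1 - cr / 2) * \<psi>))" by simp
  qed (use \<kappa> in auto)
  then show "\<exists>\<kappa>. 0 < \<kappa> \<and> \<kappa> \<le> 1 \<and> (\<forall>\<tau> \<psi>. 0 \<le> \<tau> \<longrightarrow> \<bar>\<psi>\<bar> \<le> pi - \<theta> \<longrightarrow>
     admissible \<kappa> 1 1 (of_real \<tau> * cis (- \<psi> / 2)) (cis ((1 - cr / 2) * \<psi>)))"
    using \<kappa> by blast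
qed

text \<open>Angles of -zeta; in terms of zeta, the directions at angular distance at least
  \<open>\<theta>\<close> from the positive axis.\<close>

definition good :: "real set" where "good = {\<psi>. \<bar>\<psi>\<bar> \<le> pi - \<theta>}"

lemma phase_eq: "pw * \<psi> - \<psi> / (4 * real (Suc l)) = pw * ((1 - cr / 2) * \<psi>)"
  unfolding pw_def cr_def by (simp add: field_simps del: of_nat_Suc)

text \<open>The real part of x scales |B| to 1, its imaginary part performs the rotation of
  \<open>sector_admissible\<close>. What is left of A has modulus \<open>\<tau>\<close>, which tends
  to 0 as \<open>\<rho>\<close> grows, so the asymptotics reduce to continuity at
  \<open>\<tau>\<close> = 0.\<close>

lemma sc_scaled:
  assumes \<rho>: "0 < \<rho>" and \<psi>: "\<psi> \<in> good"
  defines "\<tau> \<equiv> \<rho> powr (- 1 / cr)"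
  shows "sc0 \<rho> \<psi> = cis (pw * ((1 - cr / 2) * \<psi>)) * conn0 (of_real \<tau> * cis (- \<psi> / 2)) (cis ((1 - cr / 2) * \<psi>))"
    "sc1 \<rho> \<psi> = cis (- (pw * ((1 - cr / 2) * \<psi>))) * conn1 (of_real \<tau> * cis (- \<psi> / 2)) (cis ((1 - cr / 2) * \<psi>))"
proof -
  define x where "x = Complex (- ln \<rho> / real (Suc k)) (- \<psi> / (2 * real (Suc l)))"
  have "\<bar>\<psi>\<bar> < pi" using \<psi> cr by (auto simp: good_def)
  then have x: "x \<in> strip (pi / (2 * real (Suc l)))"
    by (simp add: strip_def x_def abs_divide divide_strict_right_mono del: of_nat_Suc)
  have ex: "exp (Complex a b) = of_real (exp a) * cis b" for a b by (simp add: exp_eq_polar)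
  have n: "of_nat n * x = Complex (real n * (- ln \<rho> / real (Suc k))) (real n * (- \<psi> / (2 * real (Suc l))))" for n
    by (simp add: complex_eq_iff x_def)
  have 1: "exp (of_nat (Suc l) * x) = of_real \<tau> * cis (- \<psi> / 2)"
  proof -
    have "exp (real (Suc l) * (- ln \<rho> / real (Suc k))) = \<tau>"
      unfolding \<tau>_def powr_def cr_def using \<rho> by (simp del: of_nat_Suc)
    then show ?thesis unfolding n ex by (simp del: of_nat_Suc)
  qed
  have 2: "of_real \<rho> * cis \<psi> * exp (of_nat (Suc k) * x) = cis ((1 - cr / 2) * \<psi>)"
  proof -
    have e1: "exp (real (Suc k) * (- ln \<rho> / real (Suc k))) = 1 / \<rho>"
      using \<rho> by (simp add: exp_minus inverse_eq_divide del: of_nat_Suc)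
    have e2: "real (Suc k) * (- \<psi> / (2 * real (Suc l))) = - cr / 2 * \<psi>" unfolding cr_def by (simp del: of_nat_Suc)
    have "of_real \<rho> * cis \<psi> * exp (of_nat (Suc k) * x) = of_real \<rho> * cis \<psi> * (of_real (1 / \<rho>) * cis (- cr / 2 * \<psi>))"
      unfolding n ex e1 e2 ..
    also have "\<dots> = cis \<psi> * cis (- cr / 2 * \<psi>)" using \<rho> by simp
    also have "\<dots> = cis ((1 - cr / 2) * \<psi>)" unfolding cis_mult by (simp add: algebra_simps)
    finally show ?thesis .
  qed
  have h: "exp (- ln \<rho> / real (Suc k) / 2) = \<rho> powr - pw" unfolding powr_def pw_def using \<rho> by (simp add: mult.commute del: of_nat_Suc)
  have x2: "x / 2 = Complex (- ln \<rho> / real (Suc k) / 2) (- \<psi> / (4 * real (Suc l)))"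
    "- x / 2 = Complex (- (- ln \<rho> / real (Suc k) / 2)) (\<psi> / (4 * real (Suc l)))"
    by (simp_all add: complex_eq_iff x_def del: of_nat_Suc)
  have 3: "exp (x / 2) = of_real (\<rho> powr - pw) * cis (- \<psi> / (4 * real (Suc l)))"
    unfolding x2 ex h ..
  have 4: "exp (- x / 2) = of_real (\<rho> powr pw) * cis (\<psi> / (4 * real (Suc l)))"
    unfolding x2 ex exp_minus h by (simp add: powr_minus)
  have pp: "complex_of_real (\<rho> powr pw) * of_real (\<rho> powr - pw) = 1"
    using \<rho> by (simp add: powr_minus field_simps)
  note c = conn_rotate[OF x, of "of_real \<rho> * cis \<psi>", unfolded 1 2 3 4]
  have "sc0 \<rho> \<psi> = (complex_of_real (\<rho> powr pw) * of_real (\<rho> powr - pw)) * (cis (pw * \<psi>) * cis (- \<psi> / (4 * real (Suc l)))) * conn0 (of_real \<tau> * cis (- \<psi> / 2)) (cis ((1 - cr / 2) * \<psi>))"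
    unfolding sc0_def c by (simp only: mult_ac)
  then show "sc0 \<rho> \<psi> = cis (pw * ((1 - cr / 2) * \<psi>)) * conn0 (of_real \<tau> * cis (- \<psi> / 2)) (cis ((1 - cr / 2) * \<psi>))"
    unfolding pp cis_mult phase_eq[symmetric] by simp
  have "sc1 \<rho> \<psi> = (complex_of_real (\<rho> powr pw) * of_real (\<rho> powr - pw)) * (cis (- pw * \<psi>) * cis (\<psi> / (4 * real (Suc l)))) * conn1 (of_real \<tau> * cis (- \<psi> / 2)) (cis ((1 - cr / 2) * \<psi>))"
    unfolding sc1_def c by (simp only: mult_ac)
  then show "sc1 \<rho> \<psi> = cis (- (pw * ((1 - cr / 2) * \<psi>))) * conn1 (of_real \<tau> * cis (- \<psi> / 2)) (cis ((1 - cr / 2) * \<psi>))"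
    unfolding pp cis_mult phase_eq[symmetric] by simp
qed

text \<open>At \<open>\<tau>\<close> = 0 all directions are rotations of one and the same monomial
  equation, which is why the limits do not depend on \<open>\<psi>\<close>.\<close>

lemma sc_limit_values:
  assumes \<psi>: "\<psi> \<in> good"
  shows "u0 = cis (pw * ((1 - cr / 2) * \<psi>)) * conn0 0 (cis ((1 - cr / 2) * \<psi>))"
    "u1 = cis (- (pw * ((1 - cr / 2) * \<psi>))) * conn1 0 (cis ((1 - cr / 2) * \<psi>))"
proof -
  define \<xi> where "\<xi> = (1 - cr / 2) * \<psi>"
  have \<xi>: "\<bar>\<xi>\<bar> < pi / 2" unfolding \<xi>_def using sector_angle \<psi> by (simp add: good_def)
  define x where "x = \<i> * of_real (\<xi> / real (Suc k))"
  have x: "x \<in> strip (pi / (2 * real (Suc k)))"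
    using divide_strict_right_mono[OF \<xi>, of "real (Suc k)"] by (simp add: strip_def x_def abs_divide del: of_nat_Suc)
  have 1: "exp (of_nat (Suc k) * x) = cis \<xi>" unfolding cis_conv_exp x_def by (simp del: of_nat_Suc)
  have 2: "exp (x / 2) = cis (pw * \<xi>)" "exp (- x / 2) = cis (- (pw * \<xi>))"
    unfolding cis_conv_exp x_def pw_def by (simp_all del: of_nat_Suc add: mult_ac)
  show "u0 = cis (pw * ((1 - cr / 2) * \<psi>)) * conn0 0 (cis ((1 - cr / 2) * \<psi>))"
    "u1 = cis (- (pw * ((1 - cr / 2) * \<psi>))) * conn1 0 (cis ((1 - cr / 2) * \<psi>))"
    using conn_rotate_monomial[OF x, unfolded 1 2] unfolding u0_def u1_def \<xi>_def by simp_all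
qed

text \<open>Continuity on the compact set of pairs (\<open>\<tau>\<close>, \<open>\<psi>\<close>),
  the edge \<open>\<tau>\<close> = 0 included, gives uniformity in the direction.\<close>

lemma uniform_limit_lim_wr_sector:
  assumes e: "0 < e"
  shows "\<exists>\<delta>>0. \<forall>\<tau> \<psi>. 0 \<le> \<tau> \<longrightarrow> \<tau> < \<delta> \<longrightarrow> \<psi> \<in> good \<longrightarrow>
     cmod (lim_wr (of_real \<tau> * cis (- \<psi> / 2)) (cis ((1 - cr / 2) * \<psi>)) p q - lim_wr 0 (cis ((1 - cr / 2) * \<psi>)) p q) < e"
proof -
  obtain \<kappa> where \<kappa>: "0 < \<kappa>" "\<kappa> \<le> 1" and adm: "\<And>\<tau> \<psi>. 0 \<le> \<tau> \<Longrightarrow> \<bar>\<psi>\<bar> \<le> pi - \<theta> \<Longrightarrow>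
     admissible \<kappa> 1 1 (of_real \<tau> * cis (- \<psi> / 2)) (cis ((1 - cr / 2) * \<psi>))"
    using sector_admissible by blast
  let ?K = "{0..1} \<times> {- (pi - \<theta>)..pi - \<theta>} :: (real \<times> real) set"
  let ?G = "\<lambda>x::real \<times> real. lim_wr (of_real (fst x) * cis (- snd x / 2)) (cis ((1 - cr / 2) * snd x)) p q"
  have K: "admissible \<kappa> 1 1 (of_real (fst x) * cis (- snd x / 2)) (cis ((1 - cr / 2) * snd x))" if "x \<in> ?K" for x
    using that by (intro adm) auto
  have "continuous_on ?K ?G"
    by (rule lim_wr_continuous[OF \<kappa> zero_less_one zero_less_one K, where N = 1])
       (auto intro!: continuous_intros simp: norm_mult)
  then have "uniformly_continuous_on ?K ?G" by (intro compact_uniformly_continuous compact_Times) auto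
  then obtain \<delta> where \<delta>: "\<delta> > 0" "\<And>x y. x \<in> ?K \<Longrightarrow> y \<in> ?K \<Longrightarrow> dist y x < \<delta> \<Longrightarrow> dist (?G y) (?G x) < e"
    unfolding uniformly_continuous_on_def using e by metis
  show ?thesis
  proof (intro exI[of _ "min \<delta> 1"] conjI allI impI)
    fix \<tau> \<psi> :: real assume t: "0 \<le> \<tau>" "\<tau> < min \<delta> 1" "\<psi> \<in> good"
    have "dist (\<tau>, \<psi>) (0, \<psi>) < \<delta>" using t by (simp add: dist_Pair_Pair)
    moreover have "(\<tau>, \<psi>) \<in> ?K" "(0, \<psi>) \<in> ?K" using t by (auto simp: good_def)
    ultimately have "dist (?G (\<tau>, \<psi>)) (?G (0, \<psi>)) < e" using \<delta>(2) by blast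
    then show "cmod (lim_wr (of_real \<tau> * cis (- \<psi> / 2)) (cis ((1 - cr / 2) * \<psi>)) p q - lim_wr 0 (cis ((1 - cr / 2) * \<psi>)) p q) < e"
      by (simp add: dist_norm)
  qed (use \<delta> in auto)
qed

lemma tau_small: "0 < \<delta> \<Longrightarrow> \<forall>\<^sub>F \<rho> in at_top. 0 \<le> \<rho> powr (- 1 / cr) \<and> \<rho> powr (- 1 / cr) < \<delta>"
proof -
  assume d: "0 < \<delta>"
  have "((\<lambda>\<rho>::real. \<rho> powr (- (1 / cr))) \<longlongrightarrow> 0) at_top" using cr by (intro tendsto_neg_powr filterlim_ident) auto
  from order_tendstoD(2)[OF this d] show ?thesis by simp
qed

lemma sc_uniform_limit:
  "uniform_limit good sc0 (\<lambda>_. u0) at_top" "uniform_limit good sc1 (\<lambda>_. u1) at_top"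
proof -
  show "uniform_limit good sc0 (\<lambda>_. u0) at_top"
  proof (rule uniform_limitI)
    fix e :: real assume e: "0 < e"
    obtain \<delta> where \<delta>: "\<delta> > 0" "\<And>\<tau> \<psi>. 0 \<le> \<tau> \<Longrightarrow> \<tau> < \<delta> \<Longrightarrow> \<psi> \<in> good \<Longrightarrow>
       cmod (conn0 (of_real \<tau> * cis (- \<psi> / 2)) (cis ((1 - cr / 2) * \<psi>)) - conn0 0 (cis ((1 - cr / 2) * \<psi>))) < e"
      using uniform_limit_lim_wr_sector[OF e, of 0 1] unfolding conn0_def by blast
    show "\<forall>\<^sub>F \<rho> in at_top. \<forall>\<psi>\<in>good. dist (sc0 \<rho> \<psi>) u0 < e"
      using tau_small[OF \<delta>(1)] eventually_gt_at_top[of 0]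
    proof eventually_elim
      case (elim \<rho>)
      show ?case
      proof
        fix \<psi> assume \<psi>: "\<psi> \<in> good"
        show "dist (sc0 \<rho> \<psi>) u0 < e"
          unfolding sc_scaled(1)[OF elim(2) \<psi>] sc_limit_values(1)[OF \<psi>] dist_norm right_diff_distrib[symmetric]
          using \<delta>(2)[OF _ _ \<psi>, of "\<rho> powr (- 1 / cr)"] elim by (simp add: norm_mult)
      qed
    qed
  qed
  show "uniform_limit good sc1 (\<lambda>_. u1) at_top"
  proof (rule uniform_limitI)
    fix e :: real assume e: "0 < e"
    obtain \<delta> where \<delta>: "\<delta> > 0" "\<And>\<tau> \<psi>. 0 \<le> \<tau> \<Longrightarrow> \<tau> < \<delta> \<Longrightarrow> \<psi> \<in> good \<Longrightarrow>
       cmod (conn1 (of_real \<tau> * cis (- \<psi> / 2)) (cis ((1 - cr / 2) * \<psi>)) - conn1 0 (cis ((1 - cr / 2) * \<psi>))) < e"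
      using uniform_limit_lim_wr_sector[OF e, of 1 0] unfolding conn1_def minus_diff_minus norm_minus_cancel by blast
    show "\<forall>\<^sub>F \<rho> in at_top. \<forall>\<psi>\<in>good. dist (sc1 \<rho> \<psi>) u1 < e"
      using tau_small[OF \<delta>(1)] eventually_gt_at_top[of 0]
    proof eventually_elim
      case (elim \<rho>)
      show ?case
      proof
        fix \<psi> assume \<psi>: "\<psi> \<in> good"
        show "dist (sc1 \<rho> \<psi>) u1 < e"
          unfolding sc_scaled(2)[OF elim(2) \<psi>] sc_limit_values(2)[OF \<psi>] dist_norm right_diff_distrib[symmetric]
          using \<delta>(2)[OF _ _ \<psi>, of "\<rho> powr (- 1 / cr)"] elim by (simp add: norm_mult)
      qed
    qed
  qed
qed

lemma fa_fb_sc: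
  assumes "0 < \<rho>" "cis \<xi> = - cis \<psi>"
  shows "fa (of_real \<rho> * cis \<xi>) = of_real (\<rho> powr - pw) * cis (- pw * \<psi>) * sc0 \<rho> \<psi>"
    "fb (of_real \<rho> * cis \<xi>) = of_real (\<rho> powr pw) * cis (pw * \<psi>) * sc1 \<rho> \<psi>"
proof -
  have pp: "complex_of_real (\<rho> powr - pw) * of_real (\<rho> powr pw) = 1"
    using assms by (simp add: powr_minus field_simps)
  have cc: "cis (- pw * \<psi>) * cis (pw * \<psi>) = 1" by (simp add: cis_mult)
  have "of_real (\<rho> powr - pw) * cis (- pw * \<psi>) * sc0 \<rho> \<psi> = (complex_of_real (\<rho> powr - pw) * of_real (\<rho> powr pw)) * (cis (- pw * \<psi>) * cis (pw * \<psi>)) * conn0 1 (of_real \<rho> * cis \<psi>)"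
    unfolding sc0_def by (simp only: mult_ac)
  then show "fa (of_real \<rho> * cis \<xi>) = of_real (\<rho> powr - pw) * cis (- pw * \<psi>) * sc0 \<rho> \<psi>"
    unfolding pp cc fa_def assms(2) by simp
  have "of_real (\<rho> powr pw) * cis (pw * \<psi>) * sc1 \<rho> \<psi> = (complex_of_real (\<rho> powr - pw) * of_real (\<rho> powr pw)) * (cis (- pw * \<psi>) * cis (pw * \<psi>)) * conn1 1 (of_real \<rho> * cis \<psi>)"
    unfolding sc1_def by (simp only: mult_ac)
  then show "fb (of_real \<rho> * cis \<xi>) = of_real (\<rho> powr pw) * cis (pw * \<psi>) * sc1 \<rho> \<psi>"
    unfolding pp cc fb_def assms(2) by simp
qed

text \<open>\<open>fa\<close> and \<open>fb\<close> carry opposite powers of \<open>\<rho>\<close>;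
  in a product of the two only a phase is left, so brackets have finite limits.\<close>

lemma fa_times_fb:
  assumes "0 < \<rho>" "cis \<xi> = - cis \<psi>" "cis \<xi>' = - cis \<psi>'"
  shows "fa (of_real \<rho> * cis \<xi>) * fb (of_real \<rho> * cis \<xi>') = cis (pw * (\<psi>' - \<psi>)) * (sc0 \<rho> \<psi> * sc1 \<rho> \<psi>')"
proof -
  have pp: "complex_of_real (\<rho> powr - pw) * of_real (\<rho> powr pw) = 1"
    using assms by (simp add: powr_minus field_simps)
  have "fa (of_real \<rho> * cis \<xi>) * fb (of_real \<rho> * cis \<xi>') = (complex_of_real (\<rho> powr - pw) * of_real (\<rho> powr pw)) * (cis (- pw * \<psi>) * cis (pw * \<psi>')) * (sc0 \<rho> \<psi> * sc1 \<rho> \<psi>')"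
    unfolding fa_fb_sc(1)[OF assms(1,2)] fa_fb_sc(2)[OF assms(1,3)] by (simp only: mult_ac)
  then show ?thesis unfolding pp cis_mult by (simp add: algebra_simps)
qed

lemma uniform_limit_pull:
  assumes "uniform_limit Y f (\<lambda>_. c) F" "\<And>x. x \<in> X \<Longrightarrow> g x \<in> Y"
  shows "uniform_limit X (\<lambda>\<rho> x. f \<rho> (g x)) (\<lambda>_. c :: complex) F"
  using assms unfolding uniform_limit_iff by (auto elim!: eventually_mono)

text \<open>A bracket of two vectors \<open>(fa, \<omega> fb)\<close> taken at two rotated arguments tends to a constant as soon as
  both arguments stay away from the positive axis.\<close>

lemma bracket_limit:
  assumes g: "\<And>\<phi>. \<phi> \<in> X \<Longrightarrow> \<phi> + s \<in> good" "\<And>\<phi>. \<phi> \<in> X \<Longrightarrow> \<phi> + t \<in> good"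
    and c: "\<And>\<phi>. cis (\<phi> + s') = - cis (\<phi> + s)" "\<And>\<phi>. cis (\<phi> + t') = - cis (\<phi> + t)"
  shows "uniform_limit X (\<lambda>\<rho> \<phi>. \<omega> * (fa (of_real \<rho> * cis (\<phi> + s')) * fb (of_real \<rho> * cis (\<phi> + t')))
              + \<omega>' * (fa (of_real \<rho> * cis (\<phi> + t')) * fb (of_real \<rho> * cis (\<phi> + s'))))
     (\<lambda>_. u0 * u1 * (\<omega> * cis (pw * (t - s)) + \<omega>' * cis (- pw * (t - s)))) at_top"
proof -
  have b: "bounded ((\<lambda>_. c) ` X)" for c :: complex by (rule bounded_subset[of "{c}"]) auto
  have m: "uniform_limit X (\<lambda>\<rho> \<phi>. sc0 \<rho> (\<phi> + s) * sc1 \<rho> (\<phi> + t)) (\<lambda>_. u0 * u1) at_top"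
    if "\<And>\<phi>. \<phi> \<in> X \<Longrightarrow> \<phi> + s \<in> good" "\<And>\<phi>. \<phi> \<in> X \<Longrightarrow> \<phi> + t \<in> good" for s t
    by (intro uniform_lim_mult b uniform_limit_pull[OF sc_uniform_limit(1)] uniform_limit_pull[OF sc_uniform_limit(2)] that)
  have "uniform_limit X (\<lambda>\<rho> \<phi>. \<omega> * cis (pw * (t - s)) * (sc0 \<rho> (\<phi> + s) * sc1 \<rho> (\<phi> + t)) + \<omega>' * cis (- pw * (t - s)) * (sc0 \<rho> (\<phi> + t) * sc1 \<rho> (\<phi> + s)))
     (\<lambda>_. \<omega> * cis (pw * (t - s)) * (u0 * u1) + \<omega>' * cis (- pw * (t - s)) * (u0 * u1)) at_top"
    by (intro uniform_limit_intros uniform_lim_mult b m g)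
  then show ?thesis
  proof (rule uniform_limit_cong[THEN iffD1, rotated -1])
    show "\<forall>\<^sub>F \<rho> in at_top. \<forall>\<phi>\<in>X. \<omega> * cis (pw * (t - s)) * (sc0 \<rho> (\<phi> + s) * sc1 \<rho> (\<phi> + t)) + \<omega>' * cis (- pw * (t - s)) * (sc0 \<rho> (\<phi> + t) * sc1 \<rho> (\<phi> + s))
      = \<omega> * (fa (of_real \<rho> * cis (\<phi> + s')) * fb (of_real \<rho> * cis (\<phi> + t')))
              + \<omega>' * (fa (of_real \<rho> * cis (\<phi> + t')) * fb (of_real \<rho> * cis (\<phi> + s')))"
      using eventually_gt_at_top[of 0]
    proof eventually_elim
      case (elim \<rho>)
      show ?case
        unfolding fa_times_fb[OF elim c(1) c(2)] fa_times_fb[OF elim c(2) c(1)]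
        by (auto simp: algebra_simps)
    qed
  qed (simp add: algebra_simps)
qed

section \<open>Growth of the connection coefficients\<close>

lemma cmod_wkb: "cmod (wkb (-1) A B z) = exp (- Re (\<Phi> A B z)) / sqrt (cmod (Q A B z))"
  by (simp add: wkb_def norm_divide)

lemma Re_Phi_mono:
  assumes adm: "admissible \<kappa> \<mu> R A B" and r: "R \<le> r"
  shows "Re (\<Phi> A B (of_real R)) \<le> Re (\<Phi> A B (of_real r))"
proof (rule DERIV_nonneg_imp_nondecreasing[OF r])
  fix x assume x: "R \<le> x" "x \<le> r"
  have "((\<lambda>r. \<Phi> A B (of_real r)) has_vector_derivative Q A B (of_real x)) (at x)"
    by (rule has_vector_derivative_of_real_comp[OF Phi_has_field_derivative])
  then have "((\<lambda>r. Re (\<Phi> A B (of_real r))) has_real_derivative Re (Q A B (of_real x))) (at x)"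
    unfolding has_real_derivative_iff_has_vector_derivative
    by (rule bounded_linear.has_vector_derivative[OF bounded_linear_Re])
  moreover have "0 \<le> Re (Q A B (of_real x))" using adm x unfolding admissible_def by auto
  ultimately show "\<exists>y. ((\<lambda>r. Re (\<Phi> A B (of_real r))) has_real_derivative y) (at x) \<and> 0 \<le> y" by blast
qed

text \<open>Beyond R the WKB function controls the solution, and it is bounded because Re
  \<open>\<Phi>\<close> is nondecreasing and |Q| is bounded below; continuity handles the
  rest.\<close>

lemma rec_sol_bounded:
  assumes adm: "admissible \<kappa> \<mu> R A B" and \<kappa>: "0 < \<kappa>" "\<kappa> \<le> 1" and \<mu>: "0 < \<mu>" and R: "0 < R"
  shows "\<exists>C. \<forall>r\<ge>0. cmod (rec_sol A B (of_real r)) \<le> C"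
proof -
  define K where "K = err_const \<kappa> \<mu>"
  have K0: "0 \<le> K" using err_const_nonneg \<kappa> \<mu> by (simp add: K_def)
  define C1 where "C1 = exp (- Re (\<Phi> A B (of_real R))) / sqrt (\<kappa> * \<mu>) * (1 + sqrt ((exp (4 * K / R) - 1) / 2))"
  have 1: "cmod (rec_sol A B (of_real r)) \<le> C1" if r: "R \<le> r" for r
  proof -
    let ?w = "cmod (wkb (-1) A B (of_real r))"
    have "cmod (rec_sol A B (of_real r)) \<le> ?w + cmod (rec_sol A B (of_real r) - wkb (-1) A B (of_real r))"
      by (rule norm_triangle_sub)
    also have "\<dots> \<le> ?w + ?w * sqrt ((exp (4 * K / r) - 1) / 2)"
      using rec_sol_wkb[OF adm \<kappa> \<mu> R r] by (simp add: K_def)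
    also have "\<dots> = ?w * (1 + sqrt ((exp (4 * K / r) - 1) / 2))" by (simp add: algebra_simps)
    also have "\<dots> \<le> C1"
      unfolding C1_def
    proof (rule mult_mono)
      have q: "0 < \<kappa> * \<mu>" using \<kappa> \<mu> by simp
      show "?w \<le> exp (- Re (\<Phi> A B (of_real R))) / sqrt (\<kappa> * \<mu>)"
        unfolding cmod_wkb using Re_Phi_mono[OF adm r] admissible_Q(4)[OF adm \<kappa>(1) \<mu> r] q
        by (intro frac_le) auto
      have "4 * K / r \<le> 4 * K / R" using r R K0 by (intro divide_left_mono) auto
      then show "1 + sqrt ((exp (4 * K / r) - 1) / 2) \<le> 1 + sqrt ((exp (4 * K / R) - 1) / 2)" by simp
      show "0 \<le> 1 + sqrt ((exp (4 * K / r) - 1) / 2)" using K0 r R by simp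
      show "0 \<le> exp (- Re (\<Phi> A B (of_real R))) / sqrt (\<kappa> * \<mu>)" using q by simp
    qed
    finally show ?thesis .
  qed
  have "continuous_on {0..R} (\<lambda>r. rec_sol A B (of_real r))"
    unfolding rec_sol_def
    by (intro continuous_at_imp_continuous_on ballI has_vector_derivative_continuous[OF has_vector_derivative_of_real_comp[OF sol_has_field_derivative]])
  then have "bounded ((\<lambda>r. rec_sol A B (of_real r)) ` {0..R})"
    by (intro compact_imp_bounded compact_continuous_image) auto
  then obtain C2 where C2: "\<And>r. r \<in> {0..R} \<Longrightarrow> cmod (rec_sol A B (of_real r)) \<le> C2" unfolding bounded_iff by blast
  show ?thesis
  proof (intro exI[of _ "max C1 C2"] allI impI)
    fix r :: real assume "0 \<le> r"
    then show "cmod (rec_sol A B (of_real r)) \<le> max C1 C2" using 1[of r] C2[of r] by (cases "R \<le> r") auto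
  qed
qed

text \<open>Gronwall's argument with |f|^2 weighted by L^2. Since |f''| is of order L^2 |f|, this
  weight balances the two terms and makes the exponential rate linear in L; a quadratic rate would
  exceed the exponential type that Phragmen-Lindelof tolerates.\<close>

lemma sol_growth:
  assumes L: "1 \<le> L" and AB: "cmod A \<le> L" "cmod B \<le> L" and r: "0 \<le> r" "r \<le> R" and R: "1 \<le> R"
    and pq: "cmod p \<le> 1" "cmod q \<le> 1"
  defines "c \<equiv> 1 + (2 * R ^ l)\<^sup>2"
  shows "L\<^sup>2 * (cmod (sol A B p q (of_real r)))\<^sup>2 + (cmod (sol' A B p q (of_real r)))\<^sup>2 \<le> 2 * L\<^sup>2 * exp (L * c * R)"
proof -
  let ?f = "\<lambda>r::real. sol A B p q (of_real r)" and ?f' = "\<lambda>r::real. sol' A B p q (of_real r)"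
  define N where "N r = L\<^sup>2 * (cmod (?f r))\<^sup>2 + (cmod (?f' r))\<^sup>2" for r
  define N' where "N' r = L\<^sup>2 * (2 * Re (cnj (?f r) * ?f' r)) + 2 * Re (cnj (?f' r) * ((Q A B (of_real r))\<^sup>2 * ?f r))" for r :: real
  have N: "(N has_real_derivative N' r) (at r)" for r
    unfolding N_def[abs_def] N'_def
    by (intro DERIV_add DERIV_cmult has_real_derivative_cmod_power2
         has_vector_derivative_of_real_comp sol_has_field_derivative sol'_has_field_derivative)
  have N'_le: "N' x \<le> L * c * N x" if x: "0 \<le> x" "x \<le> R" for x
  proof -
    have "cmod (Q A B (of_real x)) \<le> cmod A * x ^ l + cmod B * x ^ k"
      unfolding Q_def using x by (intro norm_triangle_le) (simp add: norm_mult norm_power)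
    also have "\<dots> \<le> L * R ^ l + L * R ^ l"
    proof (intro add_mono mult_mono AB)
      show "x ^ l \<le> R ^ l" using x by (intro power_mono) auto
      have "x ^ k \<le> R ^ k" using x by (intro power_mono) auto
      also have "\<dots> \<le> R ^ l" using R k_less_l by (intro power_increasing) auto
      finally show "x ^ k \<le> R ^ l" .
    qed (use L x in auto)
    finally have "cmod (Q A B (of_real x)) \<le> L * (2 * R ^ l)" by simp
    then have "(cmod (Q A B (of_real x)))\<^sup>2 \<le> (L * (2 * R ^ l))\<^sup>2" by (rule power_mono) simp
    then have Q: "L\<^sup>2 + (cmod (Q A B (of_real x)))\<^sup>2 \<le> L\<^sup>2 * c"
      unfolding c_def by (simp add: power_mult_distrib algebra_simps)
    let ?a = "cmod (?f x)" and ?b = "cmod (?f' x)"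
    have "N' x \<le> L\<^sup>2 * (2 * (?a * ?b)) + 2 * (?b * ((cmod (Q A B (of_real x)))\<^sup>2 * ?a))"
      unfolding N'_def
      using complex_Re_le_cmod[of "cnj (?f x) * ?f' x"] complex_Re_le_cmod[of "cnj (?f' x) * ((Q A B (of_real x))\<^sup>2 * ?f x)"]
      by (intro add_mono mult_left_mono) (auto simp: norm_mult norm_power)
    also have "\<dots> = (L\<^sup>2 + (cmod (Q A B (of_real x)))\<^sup>2) * (2 * ?a * ?b)" by (simp add: algebra_simps)
    also have "\<dots> \<le> L\<^sup>2 * c * (2 * ?a * ?b)" by (rule mult_right_mono[OF Q]) simp
    also have "\<dots> = L * c * (2 * (L * ?a) * ?b)" by (simp add: power2_eq_square)
    also have "\<dots> \<le> L * c * N x"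
    proof (rule mult_left_mono)
      show "2 * (L * ?a) * ?b \<le> N x"
        unfolding N_def using zero_le_power2[of "L * ?a - ?b"] by (simp add: power2_diff power_mult_distrib)
      show "0 \<le> L * c" using L unfolding c_def by simp
    qed
    finally show ?thesis .
  qed
  have "N r * exp (- L * c * r) \<le> N 0 * exp (- L * c * 0)"
  proof (rule DERIV_nonpos_imp_nonincreasing[OF r(1)])
    fix x assume x: "0 \<le> x" "x \<le> r"
    have "((\<lambda>r. N r * exp (- L * c * r)) has_real_derivative N' x * exp (- L * c * x) + exp (- L * c * x) * (- L * c) * N x) (at x)"
      by (auto intro!: derivative_eq_intros N)
    moreover have "N' x * exp (- L * c * x) + exp (- L * c * x) * (- L * c) * N x = (N' x - L * c * N x) * exp (- L * c * x)"
      by (simp add: algebra_simps)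
    moreover have "\<dots> \<le> 0" using N'_le[of x] x r by (simp add: mult_nonpos_nonneg)
    ultimately show "\<exists>y. ((\<lambda>r. N r * exp (- L * c * r)) has_real_derivative y) (at x) \<and> y \<le> 0" by metis
  qed
  also have "N 0 * exp (- L * c * 0) \<le> 2 * L\<^sup>2"
  proof -
    have "(cmod p)\<^sup>2 \<le> 1" "(cmod q)\<^sup>2 \<le> 1" using pq by (auto intro: power_le_one)
    moreover have "1 \<le> L\<^sup>2" using L by simp
    ultimately have "L\<^sup>2 * (cmod p)\<^sup>2 \<le> L\<^sup>2 * 1" "(cmod q)\<^sup>2 \<le> L\<^sup>2"
      using mult_left_mono[of "(cmod p)\<^sup>2" 1 "L\<^sup>2"] by auto
    then show ?thesis by (simp add: N_def)
  qed
  finally have "N r * exp (- L * c * r) * exp (L * c * r) \<le> 2 * L\<^sup>2 * exp (L * c * r)" by (rule mult_right_mono) simp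
  then have "N r \<le> 2 * L\<^sup>2 * exp (L * c * r)" by (simp add: mult.assoc exp_add[symmetric])
  also have "\<dots> \<le> 2 * L\<^sup>2 * exp (L * c * R)" using r L unfolding c_def by (intro mult_left_mono) (auto intro!: mult_left_mono)
  finally show ?thesis unfolding N_def .
qed

lemma admissible_large:
  assumes L: "1 \<le> L"
  shows "admissible (1/3) L 2 (of_real L) (- of_real L * cis \<phi>)"
  unfolding admissible_def
proof (intro allI impI)
  fix r :: real assume r: "2 \<le> r"
  have "r * r ^ k \<le> r ^ l" using r k_less_l power_increasing[of "Suc k" l r] by simp
  moreover have "2 * r ^ k \<le> r * r ^ k" using r by (intro mult_right_mono) auto
  ultimately have rk: "2 * r ^ k \<le> r ^ l" by linarith
  have rk0: "0 \<le> r ^ k" using r by simp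
  let ?A = "complex_of_real L" and ?B = "- of_real L * cis \<phi>"
  have S: "coef_size ?A ?B r = L * (r ^ l + r ^ k)" using L by (simp add: coef_size_def norm_mult algebra_simps)
  have Re: "Re (Q ?A ?B (of_real r)) = L * (r ^ l - cos \<phi> * r ^ k)"
    unfolding Q_def by (simp flip: of_real_power add: algebra_simps)
  have "cos \<phi> * r ^ k \<le> 1 * r ^ k" using r by (intro mult_right_mono) auto
  then have *: "r ^ l / 2 \<le> r ^ l - cos \<phi> * r ^ k" using rk by simp
  then have "L * (r ^ l / 2) \<le> Re (Q ?A ?B (of_real r))" unfolding Re using L by (intro mult_left_mono) auto
  moreover have "0 \<le> L * (r ^ l / 2)" using L r by simp
  moreover have "1/3 * (L * (r ^ l + r ^ k)) \<le> L * (r ^ l / 2)"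
    using mult_left_mono[of "1/3 * (r ^ l + r ^ k)" "r ^ l / 2" L] rk L by (simp add: algebra_simps)
  moreover have "L * 1 \<le> L * (r ^ l + r ^ k)"
  proof -
    have "1 \<le> r ^ l" using r by simp
    then show ?thesis using L rk0 by (intro mult_left_mono) auto
  qed
  ultimately show "0 \<le> Re (Q ?A ?B (of_real r)) \<and> 1/3 * coef_size ?A ?B r \<le> cmod (Q ?A ?B (of_real r)) \<and> L \<le> coef_size ?A ?B r"
    unfolding S using complex_Re_le_cmod[of "Q ?A ?B (of_real r)"] by auto
qed

text \<open>The nonzero turning points have modulus 1. Up to r = 2 the growth of solutions is
  bounded by the energy inequality from 0; from r = 2 on the forward estimate adds at most a bounded
  factor, uniformly in L and in the direction.\<close>

lemma lim_wr_growth: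
  assumes pq: "cmod p \<le> 1" "cmod q \<le> 1"
  shows "\<exists>C\<ge>0. \<forall>L\<ge>1. \<forall>\<phi>. cmod (lim_wr (of_real L) (- of_real L * cis \<phi>) p q) \<le> C * exp (C * L)"
proof -
  define c where "c = 1 + (2 * 2 ^ l :: real)\<^sup>2"
  \<comment> \<open>\<open>err_const (1/3) L\<close> equals 54 l^2 / L, and L >= 1.\<close>
  define K where "K = 54 * (real l)\<^sup>2"
  define D where "D = 2 * 2 ^ Suc l + 2 * c + 2"
  define E where "E = sqrt 2 * (2 + 2 * 2 ^ l + real l * 2 ^ Suc l :: real)"
  have E0: "0 \<le> E" by (simp add: E_def)
  define C where "C = max D (E + 2 * K * E * exp (K / 2) / 2)"
  have K0: "0 \<le> K" by (simp add: K_def)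
  have D0: "0 \<le> D" by (simp add: D_def c_def)
  show ?thesis
  proof (intro exI[of _ C] conjI allI impI)
    show "0 \<le> C" using D0 by (simp add: C_def)
    fix L \<phi> :: real assume L: "1 \<le> L"
    let ?A = "complex_of_real L" and ?B = "- of_real L * cis \<phi>" and ?z = "complex_of_real 2"
    note adm = admissible_large[OF L, of \<phi>]
    have AB: "cmod ?A \<le> L" "cmod ?B \<le> L" using L by (auto simp: norm_mult)
    have K_le: "err_const (1/3) L \<le> K" and K_0: "0 \<le> err_const (1/3) L"
      unfolding err_const_def K_def using L by (simp_all add: power3_eq_cube divide_le_eq mult_le_cancel_left1)
    have qb: "1 \<le> cmod (Q ?A ?B ?z)" "cmod (Q ?A ?B ?z) \<le> L * (2 * 2 ^ l)" "cmod (dQ ?A ?B ?z) \<le> L * (real l * 2 ^ Suc l)"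
    proof -
      have kl: "(2::real) ^ k \<le> 2 ^ l" "(2::real) ^ (k - 1) \<le> 2 ^ l" "(2::real) ^ (l - 1) \<le> 2 ^ l"
        using k_less_l by (intro power_increasing; simp)+
      have "Suc k \<le> l" using k_less_l by simp
      then have "(2::real) ^ Suc k \<le> 2 ^ l" by (intro power_increasing) auto
      then have kl2: "2 * (2::real) ^ k \<le> 2 ^ l" by simp
      have "(4::real) \<le> 2 ^ l" using power_increasing[of 2 l "2::real"] k_pos k_less_l by simp
      have "cmod (?A * ?z ^ l) - cmod (- (?B * ?z ^ k)) \<le> cmod (?A * ?z ^ l - - (?B * ?z ^ k))" by (rule norm_triangle_ineq2)
      then have "L * 2 ^ l - L * 2 ^ k \<le> cmod (Q ?A ?B ?z)" unfolding Q_def using L by (simp add: norm_mult norm_power)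
      moreover have "L * 1 \<le> L * (2 ^ l - 2 ^ k)" using L kl2 \<open>(4::real) \<le> 2 ^ l\<close> by (intro mult_left_mono) auto
      ultimately show "1 \<le> cmod (Q ?A ?B ?z)" using L by (simp add: algebra_simps)
      have "cmod (Q ?A ?B ?z) \<le> L * 2 ^ l + L * 2 ^ k"
        unfolding Q_def using L by (intro norm_triangle_le) (simp add: norm_mult norm_power)
      also have "\<dots> \<le> L * 2 ^ l + L * 2 ^ l" using kl L by (intro add_left_mono mult_left_mono) auto
      finally show "cmod (Q ?A ?B ?z) \<le> L * (2 * 2 ^ l)" by simp
      have "cmod (dQ ?A ?B ?z) \<le> real l * L * 2 ^ (l - 1) + real k * L * 2 ^ (k - 1)"
        unfolding dQ_def using L by (intro norm_triangle_le) (simp add: norm_mult norm_power)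
      also have "\<dots> \<le> real l * L * 2 ^ l + real l * L * 2 ^ l" using kl L k_less_l by (intro add_mono mult_mono mult_left_mono) auto
      finally show "cmod (dQ ?A ?B ?z) \<le> L * (real l * 2 ^ Suc l)" by (simp add: algebra_simps)
    qed
    define X where "X = L * exp (L * c)"
    have fb: "L * cmod (sol ?A ?B p q ?z) \<le> sqrt 2 * X" "cmod (sol' ?A ?B p q ?z) \<le> sqrt 2 * X"
    proof -
      have "L\<^sup>2 * (cmod (sol ?A ?B p q ?z))\<^sup>2 + (cmod (sol' ?A ?B p q ?z))\<^sup>2 \<le> 2 * L\<^sup>2 * exp (L * c * 2)"
        using sol_growth[OF L AB _ _ _ pq, of 2 2] unfolding c_def by simp
      also have "\<dots> = (sqrt 2 * X)\<^sup>2" unfolding X_def by (simp add: power_mult_distrib exp_double[symmetric] mult.commute)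
      finally have *: "L\<^sup>2 * (cmod (sol ?A ?B p q ?z))\<^sup>2 + (cmod (sol' ?A ?B p q ?z))\<^sup>2 \<le> (sqrt 2 * X)\<^sup>2" .
      have "0 \<le> L\<^sup>2 * (cmod (sol ?A ?B p q ?z))\<^sup>2" by simp
      then have "(L * cmod (sol ?A ?B p q ?z))\<^sup>2 \<le> (sqrt 2 * X)\<^sup>2" "(cmod (sol' ?A ?B p q ?z))\<^sup>2 \<le> (sqrt 2 * X)\<^sup>2"
        using * zero_le_power2[of "cmod (sol' ?A ?B p q ?z)"] unfolding power_mult_distrib by linarith+
      moreover have "0 \<le> sqrt 2 * X" using L by (simp add: X_def)
      ultimately show "L * cmod (sol ?A ?B p q ?z) \<le> sqrt 2 * X" "cmod (sol' ?A ?B p q ?z) \<le> sqrt 2 * X"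
        using power2_le_imp_le by blast+
    qed
    have Phi: "- Re (\<Phi> ?A ?B ?z) \<le> L * (2 * 2 ^ Suc l)"
    proof -
      have "- Re (\<Phi> ?A ?B ?z) \<le> cmod (\<Phi> ?A ?B ?z)" using complex_Re_le_cmod[of "- \<Phi> ?A ?B ?z"] by simp
      also have "\<dots> \<le> L * 2 ^ Suc l / real (Suc l) + L * 2 ^ Suc k / real (Suc k)"
        unfolding \<Phi>_def using L by (intro norm_triangle_le) (simp add: norm_mult norm_power norm_divide del: of_nat_Suc)
      also have "\<dots> \<le> L * 2 ^ Suc l / 1 + L * 2 ^ Suc l / 1"
        using L k_less_l by (intro add_mono frac_le mult_left_mono power_increasing) auto
      finally show ?thesis by simp
    qed
    have gen: "cmod (exp (- \<Phi> ?A ?B ?z) / csqrt (Q ?A ?B ?z) * (sol' ?A ?B p q ?z - (\<sigma> * Q ?A ?B ?z - dQ ?A ?B ?z / (2 * Q ?A ?B ?z)) * sol ?A ?B p q ?z)) \<le> E * exp (D * L)"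
      if \<sigma>: "cmod \<sigma> = 1" for \<sigma>
    proof -
      have t1: "cmod (exp (- \<Phi> ?A ?B ?z) / csqrt (Q ?A ?B ?z)) \<le> exp (L * (2 * 2 ^ Suc l)) / 1"
        unfolding norm_divide using Phi qb(1) by (intro frac_le) auto
      have t2: "cmod (\<sigma> * Q ?A ?B ?z - dQ ?A ?B ?z / (2 * Q ?A ?B ?z)) \<le> L * (2 * 2 ^ l + real l * 2 ^ Suc l)"
      proof -
        have "cmod (dQ ?A ?B ?z / (2 * Q ?A ?B ?z)) \<le> L * (real l * 2 ^ Suc l) / 1"
          unfolding norm_divide norm_mult using qb L by (intro frac_le) auto
        then show ?thesis using norm_triangle_ineq4[of "\<sigma> * Q ?A ?B ?z" "dQ ?A ?B ?z / (2 * Q ?A ?B ?z)"] qb(2) \<sigma>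
          by (simp add: norm_mult algebra_simps)
      qed
      have "cmod (\<sigma> * Q ?A ?B ?z - dQ ?A ?B ?z / (2 * Q ?A ?B ?z)) * cmod (sol ?A ?B p q ?z) \<le> L * (2 * 2 ^ l + real l * 2 ^ Suc l) * cmod (sol ?A ?B p q ?z)"
        by (rule mult_right_mono[OF t2]) simp
      also have "\<dots> = (2 * 2 ^ l + real l * 2 ^ Suc l) * (L * cmod (sol ?A ?B p q ?z))" by (simp only: mult_ac)
      also have "\<dots> \<le> (2 * 2 ^ l + real l * 2 ^ Suc l) * (sqrt 2 * X)" by (intro mult_left_mono fb) auto
      finally have "cmod (sol' ?A ?B p q ?z - (\<sigma> * Q ?A ?B ?z - dQ ?A ?B ?z / (2 * Q ?A ?B ?z)) * sol ?A ?B p q ?z) \<le> sqrt 2 * X + (2 * 2 ^ l + real l * 2 ^ Suc l) * (sqrt 2 * X)"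
        using fb(2) norm_triangle_ineq4[of "sol' ?A ?B p q ?z" "(\<sigma> * Q ?A ?B ?z - dQ ?A ?B ?z / (2 * Q ?A ?B ?z)) * sol ?A ?B p q ?z"]
        by (simp add: norm_mult)
      also have "\<dots> \<le> E * X" unfolding E_def using L by (simp add: X_def algebra_simps)
      finally have 2: "cmod (sol' ?A ?B p q ?z - (\<sigma> * Q ?A ?B ?z - dQ ?A ?B ?z / (2 * Q ?A ?B ?z)) * sol ?A ?B p q ?z) \<le> E * X" .
      have "L \<le> exp L" using exp_ge_add_one_self[of L] by linarith
      then have "X \<le> exp L * exp (L * c)" unfolding X_def by (intro mult_right_mono) auto
      then have "E * X \<le> E * exp (L + L * c)" unfolding exp_add using E0 by (rule mult_left_mono)
      with 2 have 3: "cmod (sol' ?A ?B p q ?z - (\<sigma> * Q ?A ?B ?z - dQ ?A ?B ?z / (2 * Q ?A ?B ?z)) * sol ?A ?B p q ?z) \<le> E * exp (L + L * c)" by linarith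
      have "cmod (exp (- \<Phi> ?A ?B ?z) / csqrt (Q ?A ?B ?z)) * cmod (sol' ?A ?B p q ?z - (\<sigma> * Q ?A ?B ?z - dQ ?A ?B ?z / (2 * Q ?A ?B ?z)) * sol ?A ?B p q ?z)
         \<le> exp (L * (2 * 2 ^ Suc l)) * (E * exp (L + L * c))"
        using t1 3 by (intro mult_mono) auto
      also have "\<dots> = E * exp (L * (2 * 2 ^ Suc l) + (L + L * c))" by (simp add: exp_add)
      also have "\<dots> \<le> E * exp (D * L)"
        unfolding D_def using L E0 by (intro mult_left_mono) (auto simp: algebra_simps c_def)
      finally show ?thesis by (simp only: norm_mult)
    qed
    have w1: "cmod (wr (-1) ?A ?B p q ?z) \<le> E * exp (D * L)"
    proof -
      have "wr (-1) ?A ?B p q ?z = exp (- \<Phi> ?A ?B ?z) / csqrt (Q ?A ?B ?z) * (sol' ?A ?B p q ?z - ((-1) * Q ?A ?B ?z - dQ ?A ?B ?z / (2 * Q ?A ?B ?z)) * sol ?A ?B p q ?z)"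
        unfolding wr_def wkb'_def wkb_def by (simp add: algebra_simps)
      then show ?thesis using gen[of "-1"] by simp
    qed
    have w2: "cmod (wr 1 ?A ?B p q ?z * exp (- 2 * \<Phi> ?A ?B ?z)) \<le> E * exp (D * L)"
    proof -
      have "exp (\<Phi> ?A ?B ?z) * exp (- 2 * \<Phi> ?A ?B ?z) = exp (- \<Phi> ?A ?B ?z)" by (simp add: exp_add[symmetric])
      moreover have "wr 1 ?A ?B p q ?z * exp (- 2 * \<Phi> ?A ?B ?z) = (exp (\<Phi> ?A ?B ?z) * exp (- 2 * \<Phi> ?A ?B ?z)) / csqrt (Q ?A ?B ?z) * (sol' ?A ?B p q ?z - (1 * Q ?A ?B ?z - dQ ?A ?B ?z / (2 * Q ?A ?B ?z)) * sol ?A ?B p q ?z)"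
        unfolding wr_def wkb'_def wkb_def by (simp add: algebra_simps)
      ultimately have "wr 1 ?A ?B p q ?z * exp (- 2 * \<Phi> ?A ?B ?z) = exp (- \<Phi> ?A ?B ?z) / csqrt (Q ?A ?B ?z) * (sol' ?A ?B p q ?z - (1 * Q ?A ?B ?z - dQ ?A ?B ?z / (2 * Q ?A ?B ?z)) * sol ?A ?B p q ?z)"
        by (simp only:)
      then show ?thesis using gen[of "1"] by simp
    qed
    let ?u = "\<lambda>r::real. wr (-1) ?A ?B p q (of_real r)"
    let ?M = "E * exp (D * L)"
    have M0: "0 \<le> ?M" using E0 by simp
    have "cmod (lim_wr ?A ?B p q) \<le> (E + 2 * K * E * exp (K / 2) / 2) * exp (D * L)"
    proof (rule tendsto_upperbound)
      show "((\<lambda>r. cmod (?u r)) \<longlongrightarrow> cmod (lim_wr ?A ?B p q)) at_top"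
        by (intro tendsto_intros wr_tendsto_lim_wr[OF adm]) (use L in auto)
      show "\<forall>\<^sub>F r in at_top. cmod (?u r) \<le> (E + 2 * K * E * exp (K / 2) / 2) * exp (D * L)"
        using eventually_ge_at_top[of 2]
      proof eventually_elim
        case (elim r)
        have "cmod (?u r - ?u 2) \<le> 2 * err_const (1/3) L * ?M * exp (err_const (1/3) L / 2) / 2"
          by (rule wr_forward[OF adm _ _ _ _ w1 w2 _ elim]) (use L in auto)
        also have "\<dots> \<le> 2 * K * ?M * exp (K / 2) / 2"
          using K_le K_0 K0 M0 E0 by (intro divide_right_mono mult_mono) auto
        finally show ?case using w1 norm_triangle_sub[of "?u r" "?u 2"] by (simp add: algebra_simps)
      qed
    qed simp
    also have "\<dots> \<le> C * exp (C * L)"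
      unfolding C_def using L D0 by (intro mult_mono) (auto intro!: mult_right_mono simp: le_max_iff_disj)
    finally show "cmod (lim_wr ?A ?B p q) \<le> C * exp (C * L)" .
  qed
qed

text \<open>With |zeta| = s^(l-k) both rescaled coefficients have modulus L = s^(l+1) =
  |zeta|^((l+1)/(l-k)). Exponential bounds in L are therefore bounds of exponential type in
  W.\<close>

lemma conn_scale_large:
  assumes s: "0 < s"
  shows "fa (of_real (s ^ (l - k)) * cis \<phi>) = of_real (sqrt s) * conn0 (of_real (s ^ Suc l)) (- of_real (s ^ Suc l) * cis \<phi>)"
    "of_real (sqrt s) * fb (of_real (s ^ (l - k)) * cis \<phi>) = conn1 (of_real (s ^ Suc l)) (- of_real (s ^ Suc l) * cis \<phi>)"
proof -
  obtain \<kappa> \<mu> R where adm: "admissible \<kappa> \<mu> R 1 (- (of_real (s ^ (l - k)) * cis \<phi>))" "0 < \<kappa>" "\<kappa> \<le> 1" "0 < \<mu>" "0 < R" using admissible_one by blast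
  have p: "s ^ (l - k) * s ^ Suc k = s ^ Suc l" using k_less_l by (simp add: power_add[symmetric] del: power_Suc)
  have 1: "of_real (s ^ Suc l) = 1 * complex_of_real s ^ Suc l" by simp
  have "- of_real (s ^ Suc l) * cis \<phi> = - (of_real (s ^ (l - k) * s ^ Suc k) * cis \<phi>)" unfolding p by simp
  also have "\<dots> = - (of_real (s ^ (l - k)) * cis \<phi>) * of_real s ^ Suc k" by (simp add: mult_ac)
  finally have 2: "- of_real (s ^ Suc l) * cis \<phi> = - (of_real (s ^ (l - k)) * cis \<phi>) * of_real s ^ Suc k" .
  show "fa (of_real (s ^ (l - k)) * cis \<phi>) = of_real (sqrt s) * conn0 (of_real (s ^ Suc l)) (- of_real (s ^ Suc l) * cis \<phi>)"
    "of_real (sqrt s) * fb (of_real (s ^ (l - k)) * cis \<phi>) = conn1 (of_real (s ^ Suc l)) (- of_real (s ^ Suc l) * cis \<phi>)"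
    unfolding fa_def fb_def using conn_scale[OF s 1 2 adm] by simp_all
qed

lemma fa_fb_growth:
  "\<exists>C\<ge>0. \<forall>s\<ge>1. \<forall>\<phi>. cmod (fa (of_real (s ^ (l - k)) * cis \<phi>)) \<le> C * exp (C * s ^ Suc l) \<and>
      cmod (fb (of_real (s ^ (l - k)) * cis \<phi>)) \<le> C * exp (C * s ^ Suc l)"
proof -
  obtain C1 where C1: "0 \<le> C1" "\<And>L \<phi>. 1 \<le> L \<Longrightarrow> cmod (lim_wr (of_real L) (- of_real L * cis \<phi>) 0 1) \<le> C1 * exp (C1 * L)"
    using lim_wr_growth[of 0 1] by auto
  obtain C2 where C2: "0 \<le> C2" "\<And>L \<phi>. 1 \<le> L \<Longrightarrow> cmod (lim_wr (of_real L) (- of_real L * cis \<phi>) 1 0) \<le> C2 * exp (C2 * L)"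
    using lim_wr_growth[of 1 0] by auto
  define C where "C = C1 + C2 + 1"
  show ?thesis
  proof (intro exI[of _ C] conjI allI impI)
    show "0 \<le> C" using C1 C2 by (simp add: C_def)
    fix s \<phi> :: real assume s: "1 \<le> s"
    then have s0: "0 < s" by simp
    have sl: "1 \<le> s ^ Suc l" "s \<le> s ^ Suc l" using s by (auto simp: one_le_power simp del: power_Suc intro: order_trans[OF _ self_le_power])
    have "sqrt s \<le> s" using s by (simp add: real_le_lsqrt power2_eq_square)
    then have sq: "sqrt s \<le> exp (s ^ Suc l)" using sl exp_ge_add_one_self[of "s ^ Suc l"] by linarith
    have "cmod (fa (of_real (s ^ (l - k)) * cis \<phi>)) = sqrt s * cmod (lim_wr (of_real (s ^ Suc l)) (- of_real (s ^ Suc l) * cis \<phi>) 0 1)"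
      unfolding conn_scale_large(1)[OF s0] conn0_def using s by (simp add: norm_mult)
    also have "\<dots> \<le> exp (s ^ Suc l) * (C1 * exp (C1 * s ^ Suc l))" using sq s by (intro mult_mono C1 sl) auto
    also have "\<dots> = C1 * exp ((C1 + 1) * s ^ Suc l)" by (simp add: exp_add[symmetric] algebra_simps)
    also have "\<dots> \<le> C * exp (C * s ^ Suc l)" using C1 C2 s unfolding C_def by (intro mult_mono) (auto intro!: mult_right_mono)
    finally show "cmod (fa (of_real (s ^ (l - k)) * cis \<phi>)) \<le> C * exp (C * s ^ Suc l)" .
    have "cmod (fb (of_real (s ^ (l - k)) * cis \<phi>)) \<le> sqrt s * cmod (fb (of_real (s ^ (l - k)) * cis \<phi>))"
      using s by (simp add: mult_le_cancel_right1)
    also have "\<dots> = cmod (of_real (sqrt s) * fb (of_real (s ^ (l - k)) * cis \<phi>))" using s by (simp add: norm_mult)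
    also have "\<dots> = cmod (lim_wr (of_real (s ^ Suc l)) (- of_real (s ^ Suc l) * cis \<phi>) 1 0)"
      unfolding conn_scale_large(2)[OF s0] conn1_def by simp
    also have "\<dots> \<le> C2 * exp (C2 * s ^ Suc l)" by (rule C2(2)[OF sl(1)])
    also have "\<dots> \<le> C * exp (C * s ^ Suc l)" using C1 C2 s unfolding C_def by (intro mult_mono) (auto intro!: mult_right_mono)
    finally show "cmod (fb (of_real (s ^ (l - k)) * cis \<phi>)) \<le> C * exp (C * s ^ Suc l)" .
  qed
qed


text \<open>f f' is nondecreasing, its derivative being f'^2 + (q f)^2. If it were positive at some
  point to the right of 0, f^2 would grow at least linearly from there, against boundedness; so f f'
  <= 0 and f^2 decreases.\<close>

lemma bounded_solution_decreasing:
  fixes f f' q :: "real \<Rightarrow> real"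
  assumes f: "\<And>r. (f has_real_derivative f' r) (at r)" and f': "\<And>r. (f' has_real_derivative (q r)\<^sup>2 * f r) (at r)"
    and bd: "\<And>r. 0 \<le> r \<Longrightarrow> \<bar>f r\<bar> \<le> C" and r: "0 \<le> r"
  shows "\<bar>f r\<bar> \<le> \<bar>f 0\<bar>"
proof -
  have G': "((\<lambda>r. f r * f' r) has_real_derivative (f' x)\<^sup>2 + (q x * f x)\<^sup>2) (at x)" for x
    by (rule derivative_eq_intros f f' refl)+ (simp add: power2_eq_square algebra_simps)
  have mono: "f x * f' x \<le> f y * f' y" if "x \<le> y" for x y
    by (rule DERIV_nonneg_imp_nondecreasing[OF that]) (use G' in \<open>auto intro!: exI\<close>)
  have neg: "f x * f' x \<le> 0" if x: "0 \<le> x" for x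
  proof (rule ccontr)
    assume "\<not> f x * f' x \<le> 0"
    then have g: "0 < f x * f' x" by simp
    define y where "y = x + (C\<^sup>2 + 1) / (f x * f' x)"
    have yx: "x \<le> y" unfolding y_def using g by simp
    have "(f x)\<^sup>2 - 2 * (f x * f' x) * x \<le> (f y)\<^sup>2 - 2 * (f x * f' x) * y"
    proof (rule DERIV_nonneg_imp_nondecreasing[OF yx])
      fix z assume "x \<le> z" "z \<le> y"
      have "((\<lambda>z. (f z)\<^sup>2 - 2 * (f x * f' x) * z) has_real_derivative 2 * (f z * f' z) - 2 * (f x * f' x)) (at z)"
        by (rule derivative_eq_intros f refl)+ simp
      moreover have "0 \<le> 2 * (f z * f' z) - 2 * (f x * f' x)" using mono[OF \<open>x \<le> z\<close>] by simp
      ultimately show "\<exists>w. ((\<lambda>z. (f z)\<^sup>2 - 2 * (f x * f' x) * z) has_real_derivative w) (at z) \<and> 0 \<le> w" by blast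
    qed
    moreover have "2 * (f x * f' x) * y = 2 * (f x * f' x) * x + 2 * (C\<^sup>2 + 1)"
    proof -
      have "2 * g * (x + b / g) = 2 * g * x + 2 * b" if "0 < g" for g b :: real using that by (simp add: field_simps)
      then show ?thesis unfolding y_def using g by blast
    qed
    moreover have "(f y)\<^sup>2 \<le> C\<^sup>2"
      using bd[of y] x yx by (metis abs_ge_zero order_trans power2_abs power_mono)
    ultimately have "(f x)\<^sup>2 + C\<^sup>2 + 2 \<le> 0" by (simp add: algebra_simps)
    then show False using zero_le_power2[of "f x"] zero_le_power2[of C] by linarith
  qed
  have "(f r)\<^sup>2 \<le> (f 0)\<^sup>2"
  proof (rule DERIV_nonpos_imp_nonincreasing[OF r])
    fix z assume z: "0 \<le> z" "z \<le> r"
    have "((\<lambda>z. (f z)\<^sup>2) has_real_derivative 2 * (f z * f' z)) (at z)"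
      by (rule derivative_eq_intros f refl)+ simp
    then show "\<exists>w. ((\<lambda>z. (f z)\<^sup>2) has_real_derivative w) (at z) \<and> w \<le> 0" using neg[OF z(1)] by (intro exI) auto
  qed
  then show ?thesis by (simp add: abs_le_square_iff)
qed

text \<open>For real coefficients the decaying solution is real, so the preceding convexity argument
  applies. It turns a lower bound at any r into one for \<open>conn0\<close>, without following the
  solution through the turning point.\<close>

lemma rec_sol_real_decreasing:
  fixes A B r :: real
  assumes adm: "admissible \<kappa> \<mu> R (of_real A) (of_real B)" and \<kappa>: "0 < \<kappa>" "\<kappa> \<le> 1" and \<mu>: "0 < \<mu>" and R: "0 < R"
    and r: "0 \<le> r"
  shows "cmod (rec_sol (of_real A) (of_real B) (of_real r)) \<le> cmod (conn0 (of_real A) (of_real B))"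
proof -
  let ?A = "complex_of_real A" and ?B = "complex_of_real B"
  note cc = conn_cnj[OF adm \<kappa> \<mu> R, simplified]
  have re: "Im (rec_sol ?A ?B (of_real r)) = 0" for r
    using sol_cnj[of ?A ?B "conn0 ?A ?B" "conn1 ?A ?B" "of_real r"] cc by (simp add: rec_sol_def complex_eq_iff)
  define f where "f r = Re (rec_sol ?A ?B (of_real r))" for r
  define f' where "f' r = Re (sol' ?A ?B (conn0 ?A ?B) (conn1 ?A ?B) (of_real r))" for r
  have ab: "\<bar>f r\<bar> = cmod (rec_sol ?A ?B (of_real r))" for r using re[of r] by (simp add: f_def cmod_eq_Re)
  have 1: "(f has_real_derivative f' r) (at r)" for r
    unfolding f_def[abs_def] f'_def has_real_derivative_iff_has_vector_derivative rec_sol_def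
    by (intro bounded_linear.has_vector_derivative[OF bounded_linear_Re] has_vector_derivative_of_real_comp sol_has_field_derivative)
  have "(f' has_real_derivative Re ((Q ?A ?B (of_real r))\<^sup>2 * rec_sol ?A ?B (of_real r))) (at r)" for r
    unfolding f'_def[abs_def] has_real_derivative_iff_has_vector_derivative rec_sol_def
    by (intro bounded_linear.has_vector_derivative[OF bounded_linear_Re] has_vector_derivative_of_real_comp sol'_has_field_derivative)
  moreover have "Re ((Q ?A ?B (of_real r))\<^sup>2 * rec_sol ?A ?B (of_real r)) = (A * r ^ l + B * r ^ k)\<^sup>2 * f r" for r
    unfolding Q_def f_def by (simp flip: of_real_power of_real_mult of_real_add)
  ultimately have 2: "(f' has_real_derivative (A * r ^ l + B * r ^ k)\<^sup>2 * f r) (at r)" for r by simp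
  obtain C where C: "\<And>r. 0 \<le> r \<Longrightarrow> cmod (rec_sol ?A ?B (of_real r)) \<le> C"
    using rec_sol_bounded[OF adm \<kappa> \<mu> R] by blast
  have "\<bar>f r\<bar> \<le> \<bar>f 0\<bar>" by (rule bounded_solution_decreasing[OF 1 2 _ r]) (use C ab in auto)
  then show ?thesis unfolding ab by (simp add: rec_sol_def)
qed

lemma admissible_past_turning_point:
  assumes L: "1 \<le> L" and R: "1 < R"
  shows "admissible ((R - 1) / (R + 1)) L R (of_real L) (- of_real L)"
  unfolding admissible_def
proof (intro allI impI)
  fix r assume r: "R \<le> r"
  let ?\<kappa> = "(R - 1) / (R + 1)"
  have "R * r ^ k \<le> r * r ^ k" using r R by (intro mult_right_mono) auto
  also have "\<dots> \<le> r ^ l" using r R k_less_l power_increasing[of "Suc k" l r] by simp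
  finally have rk: "R * r ^ k \<le> r ^ l" .
  have rk0: "0 \<le> r ^ k" using r R by simp
  have d: "r ^ k \<le> r ^ l" using rk mult_right_mono[of 1 R "r ^ k"] R rk0 by simp
  have Q: "Q (of_real L) (- of_real L) (of_real r) = of_real (L * (r ^ l - r ^ k))"
    unfolding Q_def by (simp add: algebra_simps)
  have S: "coef_size (of_real L) (- of_real L) r = L * (r ^ l + r ^ k)" using L by (simp add: coef_size_def algebra_simps)
  have "?\<kappa> * (r ^ l + r ^ k) \<le> r ^ l - r ^ k" using R rk by (simp add: divide_le_eq field_simps)
  then have "L * (?\<kappa> * (r ^ l + r ^ k)) \<le> L * (r ^ l - r ^ k)" using L by (intro mult_left_mono) auto
  moreover have "cmod (Q (of_real L) (- of_real L) (of_real r)) = L * (r ^ l - r ^ k)"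
    unfolding Q norm_of_real using L d by simp
  moreover have "L * 1 \<le> L * (r ^ l + r ^ k)"
  proof -
    have "1 \<le> r ^ l" using r R by simp
    then show ?thesis using L rk0 by (intro mult_left_mono) auto
  qed
  ultimately show "0 \<le> Re (Q (of_real L) (- of_real L) (of_real r)) \<and> ?\<kappa> * coef_size (of_real L) (- of_real L) r \<le> cmod (Q (of_real L) (- of_real L) (of_real r)) \<and> L \<le> coef_size (of_real L) (- of_real L) r"
    unfolding S Q using L d by (simp add: mult_ac)
qed

text \<open>Just past the turning point the phase \<open>\<Phi>\<close> is still negative, so the decaying solution is already
  exponentially large there, and it only grows towards the origin.\<close>

lemma conn0_lower_bound:
  "\<exists>c>0. \<exists>L0\<ge>1. \<forall>L\<ge>L0. exp (c * L) \<le> cmod (conn0 (of_real L) (- of_real L))"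
proof -
  define P where "P r = r ^ Suc l / real (Suc l) - r ^ Suc k / real (Suc k)" for r :: real
  have "isCont P 1" unfolding P_def by (intro continuous_intros) auto
  moreover have P1: "P 1 < 0" unfolding P_def using k_less_l by (simp add: frac_less2)
  ultimately have "\<forall>\<^sub>F r in at 1. P r < 0" unfolding isCont_def by (rule order_tendstoD)
  then obtain e where e: "e > 0" "\<And>r. r \<noteq> 1 \<Longrightarrow> dist r 1 < e \<Longrightarrow> P r < 0" unfolding eventually_at by blast
  define R where "R = 1 + e / 2"
  have R: "1 < R" "P R < 0" using e by (auto simp: R_def dist_real_def)
  define \<kappa> where "\<kappa> = (R - 1) / (R + 1)"
  have \<kappa>: "0 < \<kappa>" "\<kappa> \<le> 1" using R by (auto simp: \<kappa>_def)
  define D where "D = R ^ l - R ^ k"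
  have D: "0 < D" unfolding D_def using R k_less_l by (simp add: power_strict_increasing)
  \<comment> \<open>At R the WKB function has modulus exp(4 c L) / sqrt(L D). Half of the exponent
    is spent on the factor 2 sqrt(L D), the other half is the final bound.\<close>
  define c where "c = - P R / 4"
  have c: "0 < c" using R by (simp add: c_def)
  have lim1: "((\<lambda>L. sqrt ((exp (4 * err_const \<kappa> L / R) - 1) / 2)) \<longlongrightarrow> sqrt ((exp (4 * 0 / R) - 1) / 2)) at_top"
  proof -
    have "((\<lambda>L. 2 * (real l)\<^sup>2 / \<kappa> ^ 3 * (1 / L)) \<longlongrightarrow> 2 * (real l)\<^sup>2 / \<kappa> ^ 3 * 0) at_top"
      by (intro tendsto_mult tendsto_const tendsto_divide_0[OF tendsto_const]) (simp add: filterlim_at_top_imp_at_infinity filterlim_ident)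
    then have "((\<lambda>L. err_const \<kappa> L) \<longlongrightarrow> 0) at_top" unfolding err_const_def by simp
    then show ?thesis using R by (intro tendsto_intros) auto
  qed
  then have ev1: "\<forall>\<^sub>F L in at_top. sqrt ((exp (4 * err_const \<kappa> L / R) - 1) / 2) < 1 / 2"
    by (intro order_tendstoD(2)[OF lim1]) simp
  have ev2: "\<forall>\<^sub>F L in at_top. sqrt (L * D) * 2 \<le> exp (2 * c * L)"
  proof -
    have "\<forall>\<^sub>F L in at_top. max (1/D) (2 * D / c ^ 2) \<le> L" by (rule eventually_ge_at_top)
    then show ?thesis
    proof eventually_elim
      case (elim L)
      then have L: "1 / D \<le> L" "2 * D / c ^ 2 \<le> L" by auto
      have L0: "0 < L" using L(1) D by (smt (verit) divide_pos_pos)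
      have "D \<le> L * c ^ 2 / 2" using L(2) c by (simp add: divide_le_eq)
      then have "L * D \<le> L * (L * c ^ 2 / 2)" using L0 by (intro mult_left_mono) auto
      also have "\<dots> \<le> (c * L)\<^sup>2" using L0 by (simp add: power2_eq_square)
      finally have "sqrt (L * D) \<le> c * L" using c L0 by (simp add: real_le_lsqrt)
      then have "sqrt (L * D) * 2 \<le> 2 * c * L" by simp
      also have "\<dots> \<le> exp (2 * c * L)" using exp_ge_add_one_self[of "2 * c * L"] by linarith
      finally show ?case .
    qed
  qed
  obtain L1 where L1: "\<And>L. L \<ge> L1 \<Longrightarrow> sqrt ((exp (4 * err_const \<kappa> L / R) - 1) / 2) < 1 / 2 \<and> sqrt (L * D) * 2 \<le> exp (2 * c * L)"
    using eventually_conj[OF ev1 ev2] unfolding eventually_at_top_linorder by blast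
  have "exp (c * 2 * L) \<le> cmod (conn0 (of_real L) (- of_real L))" if L: "max 1 L1 \<le> L" for L
  proof -
    have L1': "1 \<le> L" and *: "sqrt ((exp (4 * err_const \<kappa> L / R) - 1) / 2) < 1 / 2" "sqrt (L * D) * 2 \<le> exp (2 * c * L)"
      using L L1[of L] by auto
    note adm = admissible_past_turning_point[OF L1' R(1), folded \<kappa>_def]
    let ?A = "complex_of_real L" and ?B = "- complex_of_real L" and ?R = "complex_of_real R"
    let ?w = "cmod (wkb (-1) ?A ?B ?R)"
    have "cmod (rec_sol ?A ?B ?R - wkb (-1) ?A ?B ?R) \<le> ?w * sqrt ((exp (4 * err_const \<kappa> L / R) - 1) / 2)"
      by (rule rec_sol_wkb[OF adm]) (use \<kappa> L1' R in auto)
    also have "\<dots> \<le> ?w * (1 / 2)" using * by (intro mult_left_mono) auto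
    finally have "?w / 2 \<le> cmod (rec_sol ?A ?B ?R)"
      using norm_triangle_ineq2[of "wkb (-1) ?A ?B ?R" "rec_sol ?A ?B ?R"] by (simp add: norm_minus_commute)
    also have "\<dots> \<le> cmod (conn0 ?A ?B)"
      using rec_sol_real_decreasing[of \<kappa> L R L "- L" R] adm \<kappa> L1' R by simp
    finally have 1: "?w / 2 \<le> cmod (conn0 ?A ?B)" .
    have "Re (\<Phi> ?A ?B ?R) = L * P R"
    proof -
      have "\<Phi> ?A ?B ?R = of_real (L * P R)" unfolding \<Phi>_def P_def by (simp add: right_diff_distrib del: of_nat_Suc)
      then show ?thesis by simp
    qed
    moreover have "cmod (Q ?A ?B ?R) = L * D"
    proof -
      have "Q ?A ?B ?R = of_real (L * D)" unfolding Q_def D_def by (simp add: algebra_simps)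
      then show ?thesis using D L1' by (simp only: norm_of_real) simp
    qed
    ultimately have w: "?w = exp (4 * c * L) / sqrt (L * D)"
      unfolding cmod_wkb c_def using D L1' by (simp add: mult.commute)
    have "exp (c * 2 * L) \<le> ?w / 2"
    proof -
      have "exp (c * 2 * L) * (sqrt (L * D) * 2) \<le> exp (c * 2 * L) * exp (2 * c * L)" using * by (intro mult_left_mono) auto
      also have "\<dots> = exp (4 * c * L)" by (simp add: exp_add[symmetric])
      finally show ?thesis unfolding w using D L1' by (simp add: field_simps)
    qed
    then show ?thesis using 1 by linarith
  qed
  then show ?thesis using c by (intro exI[of _ "c * 2"] conjI exI[of _ "max 1 L1"]) auto
qed

section \<open>The Plucker relation\<close>

definition qc :: complex where "qc = 2 * \<i> * cis (- \<alpha> / 2)"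

text \<open>Let g_j be the decaying solution rotated by j steps, with value \<open>fa\<close> and
  slope exp(-i j \<open>\<alpha>\<close>) \<open>fb\<close> at 0, both taken at exp(-i j
  \<open>\<theta>\<close>) zeta. \<open>E1\<close> is the Wronskian of g_0 and g_2,
  \<open>E2\<close> that of g_(-1) and g_1, \<open>EL\<close> that of g_(-1) and g_2. Neighbours
  have Wronskian \<open>qc\<close> up to a phase.\<close>

definition E1 :: "complex \<Rightarrow> complex" where
  "E1 \<zeta> = cis (- 2 * \<alpha>) * fa \<zeta> * fb (cis (- 2 * \<theta>) * \<zeta>) - fb \<zeta> * fa (cis (- 2 * \<theta>) * \<zeta>)"

definition E2 :: "complex \<Rightarrow> complex" where
  "E2 \<zeta> = cis (- \<alpha>) * fa (cis \<theta> * \<zeta>) * fb (cis (- \<theta>) * \<zeta>) - cis \<alpha> * fb (cis \<theta> * \<zeta>) * fa (cis (- \<theta>) * \<zeta>)"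

definition EL :: "complex \<Rightarrow> complex" where
  "EL \<zeta> = cis (- 2 * \<alpha>) * (fa (cis \<theta> * \<zeta>) * fb (cis (- 2 * \<theta>) * \<zeta>)) - cis \<alpha> * (fa (cis (- 2 * \<theta>) * \<zeta>) * fb (cis \<theta> * \<zeta>))"

lemma norm_qc: "cmod qc = 2" "qc \<noteq> 0"
  by (simp_all add: qc_def norm_mult)

lemma quantum_wronskian_shifts:
  "cis (- \<alpha>) * fa \<zeta> * fb (cis (- \<theta>) * \<zeta>) - fb \<zeta> * fa (cis (- \<theta>) * \<zeta>) = qc"
  "cis (- \<alpha>) * fa (cis \<theta> * \<zeta>) * fb \<zeta> - fb (cis \<theta> * \<zeta>) * fa \<zeta> = qc"
  "cis (- \<alpha>) * fa (cis (- \<theta>) * \<zeta>) * fb (cis (- 2 * \<theta>) * \<zeta>) - fb (cis (- \<theta>) * \<zeta>) * fa (cis (- 2 * \<theta>) * \<zeta>) = qc"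
proof -
  have h1: "cis (- \<theta>) * (cis \<theta> * \<zeta>) = \<zeta>" by (simp add: mult.assoc[symmetric] cis_mult)
  have h2: "cis (- \<theta>) * (cis (- \<theta>) * \<zeta>) = cis (- 2 * \<theta>) * \<zeta>" by (simp add: mult.assoc[symmetric] cis_mult)
  show "cis (- \<alpha>) * fa \<zeta> * fb (cis (- \<theta>) * \<zeta>) - fb \<zeta> * fa (cis (- \<theta>) * \<zeta>) = qc"
    using quantum_wronskian[of \<zeta>] unfolding qc_def .
  show "cis (- \<alpha>) * fa (cis \<theta> * \<zeta>) * fb \<zeta> - fb (cis \<theta> * \<zeta>) * fa \<zeta> = qc"
    using quantum_wronskian[of "cis \<theta> * \<zeta>"] unfolding qc_def h1 .
  show "cis (- \<alpha>) * fa (cis (- \<theta>) * \<zeta>) * fb (cis (- 2 * \<theta>) * \<zeta>) - fb (cis (- \<theta>) * \<zeta>) * fa (cis (- 2 * \<theta>) * \<zeta>) = qc"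
    using quantum_wronskian[of "cis (- \<theta>) * \<zeta>"] unfolding qc_def h2 .
qed

text \<open>Plucker relation for four consecutive subdominant solutions. It makes \<open>E1\<close> zero-free
  wherever \<open>EL\<close> is close to \<open>qc\<close>.\<close>

lemma E1_E2: "E1 \<zeta> * E2 \<zeta> = qc * (qc + EL \<zeta>)"
proof -
  define w where "w = cis (- \<alpha>)"
  define v where "v = cis \<alpha>"
  have wv: "w * v = 1" by (simp add: w_def v_def cis_mult)
  have w2: "cis (- 2 * \<alpha>) = w * w" by (simp add: w_def cis_mult)
  define a0 a1 a2 am b0 b1 b2 bm where ab: "a0 = fa \<zeta>" "a1 = fa (cis (- \<theta>) * \<zeta>)" "a2 = fa (cis (- 2 * \<theta>) * \<zeta>)" "am = fa (cis \<theta> * \<zeta>)"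
    "b0 = fb \<zeta>" "b1 = fb (cis (- \<theta>) * \<zeta>)" "b2 = fb (cis (- 2 * \<theta>) * \<zeta>)" "bm = fb (cis \<theta> * \<zeta>)"
  have q: "w * a0 * b1 - b0 * a1 = qc" "w * am * b0 - bm * a0 = qc" "w * a1 * b2 - b1 * a2 = qc"
    using quantum_wronskian_shifts[of \<zeta>] unfolding ab w_def by auto
  have "E1 \<zeta> * E2 \<zeta> = (w * w * a0 * b2 - b0 * a2) * (w * am * b1 - v * bm * a1)"
    unfolding E1_def E2_def w2 ab w_def[symmetric] v_def[symmetric] ..
  also have "\<dots> = (w * am * b0 - bm * a0) * (w * a1 * b2 - b1 * a2) + (w * a0 * b1 - b0 * a1) * (w * w * (am * b2) - v * (a2 * bm))"
    using wv by algebra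
  also have "\<dots> = qc * qc + qc * EL \<zeta>" unfolding q unfolding EL_def w2 ab w_def[symmetric] v_def[symmetric] ..
  finally show ?thesis by (simp add: algebra_simps)
qed

lemma brackets_holomorphic: "E1 holomorphic_on S" "E2 holomorphic_on S" "(\<lambda>\<zeta>. fa (c * \<zeta>)) holomorphic_on S" "(\<lambda>\<zeta>. fb (c * \<zeta>)) holomorphic_on S"
proof -
  have comp: "(\<lambda>\<zeta>. fa (c * \<zeta>)) holomorphic_on S" "(\<lambda>\<zeta>. fb (c * \<zeta>)) holomorphic_on S" for c
    using holomorphic_on_compose[OF _ fa_fb_holomorphic(1), of "\<lambda>\<zeta>. c * \<zeta>" S]
      holomorphic_on_compose[OF _ fa_fb_holomorphic(2), of "\<lambda>\<zeta>. c * \<zeta>" S]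
    by (auto simp: o_def intro!: holomorphic_intros)
  show "E1 holomorphic_on S" "E2 holomorphic_on S" unfolding E1_def[abs_def] E2_def[abs_def]
    by (intro holomorphic_intros comp fa_fb_holomorphic)+
  show "(\<lambda>\<zeta>. fa (c * \<zeta>)) holomorphic_on S" "(\<lambda>\<zeta>. fb (c * \<zeta>)) holomorphic_on S" by (rule comp)+
qed

lemma rot: "cis s * (of_real \<rho> * cis \<phi>) = of_real \<rho> * cis (\<phi> + s)"
  by (simp add: cis_mult[symmetric] mult_ac)

lemma cis_shift: "cis (\<phi> + s) = - cis (\<phi> + s + pi)" "cis (\<phi> + s) = - cis (\<phi> + (s - pi))" "cis (\<phi> + s) = - cis (\<phi> + (s + pi))"
proof -
  have "cis (x + pi) = - cis x" "cis (x - pi) = - cis x" for x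
    using cis_mult[of x pi, symmetric] cis_divide[of x pi, symmetric] by simp_all
  then show "cis (\<phi> + s) = - cis (\<phi> + s + pi)" "cis (\<phi> + s) = - cis (\<phi> + (s - pi))" "cis (\<phi> + s) = - cis (\<phi> + (s + pi))"
    by (simp_all add: add.assoc[symmetric] add_diff_eq)
qed

lemma uniform_limitD_norm:
  assumes "uniform_limit X f (\<lambda>_. c) at_top" "0 < e"
  shows "\<forall>\<^sub>F \<rho> in at_top. \<forall>x\<in>X. cmod (f (\<rho>::real) x - c) < e"
  using uniform_limitD[OF assms] by (simp add: dist_norm)

context
  assumes half: "\<theta> \<le> pi / 2"
begin

text \<open>These are the angles of -zeta after zeta has been rotated by \<open>\<theta>\<close>, by
  -2 \<open>\<theta>\<close> and by pi, for zeta in the sector from 0 to \<open>\<theta>\<close>.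
  The last one uses the full strength of \<open>\<theta>\<close> <= pi/2. The parameters of g_0 and
  g_1 can fall on the positive axis, so no such asymptotics is at hand for \<open>E1\<close>
  itself.\<close>

lemma good_shifts:
  assumes "\<phi> \<in> {0..\<theta>}"
  shows "\<phi> + (\<theta> - pi) \<in> good" "\<phi> + (- 2 * \<theta> + pi) \<in> good" "\<phi> + 0 \<in> good"
  using assms half cr(4,5) by (auto simp: good_def abs_le_iff)

lemma phase_relations:
  "- 2 * \<alpha> + pw * (2 * pi - 3 * \<theta>) = - \<alpha> - pw * \<theta>" "\<alpha> - pw * (2 * pi - 3 * \<theta>) = pw * \<theta>"
  by (simp_all add: alpha_eq algebra_simps)

text \<open>The Wronskian of neighbours is constant, so it may be evaluated as zeta -> -infinity,
  where both arguments are good. This ties \<open>u0 * u1\<close> to the known constant and shows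
  that neither factor vanishes.\<close>

lemma qc_eq: "qc = u0 * u1 * (cis (- \<alpha> - pw * \<theta>) - cis (pw * \<theta>))"
proof -
  have "uniform_limit {pi} (\<lambda>\<rho> \<phi>. cis (- \<alpha>) * (fa (of_real \<rho> * cis (\<phi> + 0)) * fb (of_real \<rho> * cis (\<phi> + - \<theta>)))
              + - 1 * (fa (of_real \<rho> * cis (\<phi> + - \<theta>)) * fb (of_real \<rho> * cis (\<phi> + 0))))
     (\<lambda>_. u0 * u1 * (cis (- \<alpha>) * cis (pw * ((- \<theta> - pi) - (0 - pi))) + - 1 * cis (- pw * ((- \<theta> - pi) - (0 - pi))))) at_top"
    by (rule bracket_limit[OF _ _ cis_shift(2) cis_shift(2)]) (use half cr(4,5) in \<open>auto simp: good_def\<close>)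
  then have "((\<lambda>\<rho>. cis (- \<alpha>) * (fa (of_real \<rho> * cis (pi + 0)) * fb (of_real \<rho> * cis (pi + - \<theta>)))
              + - 1 * (fa (of_real \<rho> * cis (pi + - \<theta>)) * fb (of_real \<rho> * cis (pi + 0)))) \<longlongrightarrow>
     u0 * u1 * (cis (- \<alpha>) * cis (pw * ((- \<theta> - pi) - (0 - pi))) + - 1 * cis (- pw * ((- \<theta> - pi) - (0 - pi))))) at_top"
    by (rule tendsto_uniform_limitI) simp
  moreover have "cis (- \<alpha>) * (fa (of_real \<rho> * cis (pi + 0)) * fb (of_real \<rho> * cis (pi + - \<theta>)))
              + - 1 * (fa (of_real \<rho> * cis (pi + - \<theta>)) * fb (of_real \<rho> * cis (pi + 0))) = qc" for \<rho>
  proof -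
    have "of_real \<rho> * cis (pi + - \<theta>) = cis (- \<theta>) * (of_real \<rho> * cis (pi + 0))" unfolding rot by simp
    then show ?thesis using quantum_wronskian_shifts(1)[of "of_real \<rho> * cis (pi + 0)"] by (simp add: mult_ac)
  qed
  ultimately have "((\<lambda>\<rho>::real. qc) \<longlongrightarrow>
     u0 * u1 * (cis (- \<alpha>) * cis (pw * ((- \<theta> - pi) - (0 - pi))) + - 1 * cis (- pw * ((- \<theta> - pi) - (0 - pi))))) at_top" by simp
  then have "qc = u0 * u1 * (cis (- \<alpha>) * cis (pw * ((- \<theta> - pi) - (0 - pi))) + - 1 * cis (- pw * ((- \<theta> - pi) - (0 - pi))))"
    using tendsto_unique[OF trivial_limit_at_top_linorder tendsto_const] by metis
  then show ?thesis by (simp add: cis_mult)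
qed

lemma u01_nonzero: "u0 \<noteq> 0" "u1 \<noteq> 0"
  using qc_eq norm_qc(2) by auto

lemma u01_real: "cnj u0 = u0" "cnj u1 = u1"
proof -
  have "admissible 1 1 1 0 1" by (rule admissible_Re_sector) auto
  from conn_cnj[OF this] show "cnj u0 = u0" "cnj u1 = u1" by (simp_all add: u0_def u1_def)
qed

text \<open>Both arguments in \<open>EL\<close> are good. Since \<open>\<alpha>\<close> = 2
  \<open>pw\<close> (pi - \<open>\<theta>\<close>), the limiting phases are the ones of
  \<open>qc_eq\<close>, so the limit is \<open>qc\<close> with the same sign and the factor
  \<open>qc + EL\<close> in \<open>E1_E2\<close> stays away from 0.\<close>

lemma EL_limit: "\<forall>\<^sub>F \<rho> in at_top. \<forall>\<phi>\<in>{0..\<theta>}. cmod (EL (of_real \<rho> * cis \<phi>) - qc) < 1"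
proof -
  have "uniform_limit {0..\<theta>} (\<lambda>\<rho> \<phi>. cis (- 2 * \<alpha>) * (fa (of_real \<rho> * cis (\<phi> + \<theta>)) * fb (of_real \<rho> * cis (\<phi> + - 2 * \<theta>)))
              + - cis \<alpha> * (fa (of_real \<rho> * cis (\<phi> + - 2 * \<theta>)) * fb (of_real \<rho> * cis (\<phi> + \<theta>))))
     (\<lambda>_. u0 * u1 * (cis (- 2 * \<alpha>) * cis (pw * ((- 2 * \<theta> + pi) - (\<theta> - pi))) + - cis \<alpha> * cis (- pw * ((- 2 * \<theta> + pi) - (\<theta> - pi))))) at_top"
    by (rule bracket_limit[OF good_shifts(1,2) cis_shift(2,3)])
  moreover have "u0 * u1 * (cis (- 2 * \<alpha>) * cis (pw * ((- 2 * \<theta> + pi) - (\<theta> - pi))) + - cis \<alpha> * cis (- pw * ((- 2 * \<theta> + pi) - (\<theta> - pi)))) = qc"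
  proof -
    have "(- 2 * \<theta> + pi) - (\<theta> - pi) = 2 * pi - 3 * \<theta>" by simp
    moreover have "cis (- 2 * \<alpha>) * cis (pw * (2 * pi - 3 * \<theta>)) = cis (- \<alpha> - pw * \<theta>)"
      unfolding cis_mult phase_relations ..
    moreover have "cis \<alpha> * cis (- pw * (2 * pi - 3 * \<theta>)) = cis (pw * \<theta>)"
      unfolding cis_mult using phase_relations(2) by simp
    ultimately show ?thesis unfolding qc_eq by simp
  qed
  ultimately show ?thesis
    using uniform_limitD_norm[where X = "{0..\<theta>}" and c = qc and e = 1] unfolding EL_def rot by simp
qed

text \<open>The modulus of the product is 2 |\<open>qc\<close> + \<open>EL\<close>|, which tends to
  8; an error below 1 in \<open>EL\<close> leaves the interval from 6 to 10.\<close>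

lemma E1_E2_bounds:
  "\<forall>\<^sub>F \<rho> in at_top. \<forall>\<phi>\<in>{0..\<theta>}. 6 \<le> cmod (E1 (of_real \<rho> * cis \<phi>)) * cmod (E2 (of_real \<rho> * cis \<phi>)) \<and>
      cmod (E1 (of_real \<rho> * cis \<phi>)) * cmod (E2 (of_real \<rho> * cis \<phi>)) \<le> 10"
  using EL_limit
proof eventually_elim
  case (elim \<rho>)
  show ?case
  proof
    fix \<phi> assume \<phi>: "\<phi> \<in> {0..\<theta>}"
    let ?z = "of_real \<rho> * cis \<phi>"
    have e: "cmod (EL ?z - qc) < 1" using elim \<phi> by blast
    have n2: "cmod (2 * qc) = 4" using norm_qc by (simp add: norm_mult)
    have "cmod (qc + EL ?z) \<le> cmod (2 * qc) + cmod (EL ?z - qc)" using norm_triangle_ineq[of "2 * qc" "EL ?z - qc"] by (simp add: algebra_simps)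
    moreover have "cmod (2 * qc) - cmod (qc - EL ?z) \<le> cmod (qc + EL ?z)" using norm_triangle_ineq2[of "2 * qc" "qc - EL ?z"] by (simp add: algebra_simps)
    ultimately have "cmod (qc + EL ?z) \<le> 5" "3 \<le> cmod (qc + EL ?z)" using e n2 by (auto simp: norm_minus_commute)
    moreover have "cmod (E1 ?z) * cmod (E2 ?z) = 2 * cmod (qc + EL ?z)"
      unfolding norm_mult[symmetric] E1_E2 unfolding norm_mult norm_qc ..
    ultimately show "6 \<le> cmod (E1 ?z) * cmod (E2 ?z) \<and> cmod (E1 ?z) * cmod (E2 ?z) \<le> 10" by simp
  qed
qed

text \<open>On this ray the parameters of g_(-1), g_0, g_1, g_2 have the angles 3/2, 1/2, -1/2, -3/2
  times \<open>\<theta>\<close>. Conjugation reverses their order and so exchanges the pair (-1, 1)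
  with the pair (2, 0).\<close>

lemma E1_E2_neutral: "cmod (E2 (of_real \<rho> * cis (\<theta> / 2))) = cmod (E1 (of_real \<rho> * cis (\<theta> / 2)))"
proof -
  let ?z = "of_real \<rho> * cis (\<theta> / 2)"
  have 1: "cis (- \<theta>) * ?z = cnj ?z" "cis \<theta> * ?z = cnj (cis (- 2 * \<theta>) * ?z)"
    unfolding rot by (simp_all add: cis_cnj)
  have "cnj (E2 ?z) = cnj (cis (- \<alpha>)) * fa (cis (- 2 * \<theta>) * ?z) * fb ?z - cnj (cis \<alpha>) * fb (cis (- 2 * \<theta>) * ?z) * fa ?z"
    unfolding E2_def 1 fa_fb_cnj by simp
  also have "\<dots> = - cis \<alpha> * E1 ?z"
  proof -
    have "cis \<alpha> * cis (- 2 * \<alpha>) = cis (- \<alpha>)" by (simp add: cis_mult)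
    then have "- cis \<alpha> * E1 ?z = cis \<alpha> * fa (cis (- 2 * \<theta>) * ?z) * fb ?z - cis (- \<alpha>) * fb (cis (- 2 * \<theta>) * ?z) * fa ?z"
      unfolding E1_def by (simp add: algebra_simps)
    then show ?thesis by (simp add: cis_cnj)
  qed
  finally have "cmod (cnj (E2 ?z)) = cmod (- cis \<alpha> * E1 ?z)" by simp
  then show ?thesis by (simp add: norm_mult)
qed

text \<open>For positive zeta \<open>fa\<close> and \<open>fb\<close> are real. Multiplying
  \<open>E1\<close> by the conjugate of Y, the value of \<open>fa\<close> at the rotated point,
  makes the \<open>fb\<close> term real, so the imaginary part isolates \<open>fa\<close>. Its
  factor tends to a nonzero real number times exp(-i pi/(k+1)), which is not real because k >=
  1.\<close>

lemma E1_real_axis: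
  "\<exists>c>0. \<forall>\<^sub>F \<rho> in at_top. c * cmod (fa (of_real \<rho>)) \<le> cmod (E1 (of_real \<rho>))"
proof -
  define \<psi> where "\<psi> = pi - 2 * \<theta>"
  have \<psi>: "\<psi> \<in> good" using good_shifts(2)[of 0] cr(4) by (simp add: \<psi>_def)
  have t0: "((\<lambda>\<rho>. sc0 \<rho> \<psi>) \<longlongrightarrow> u0) at_top" and t1: "((\<lambda>\<rho>. sc1 \<rho> \<psi>) \<longlongrightarrow> u1) at_top"
    by (rule tendsto_uniform_limitI[OF sc_uniform_limit(1) \<psi>], rule tendsto_uniform_limitI[OF sc_uniform_limit(2) \<psi>])
  define X where "X \<rho> = cis (- 2 * \<alpha>) * fb (cis (- 2 * \<theta>) * of_real \<rho>)" for \<rho> :: real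
  define Y where "Y \<rho> = fa (cis (- 2 * \<theta>) * of_real \<rho>)" for \<rho> :: real
  have c: "cis (- 2 * \<theta>) = - cis \<psi>" using cis_shift(3)[of 0 "- 2 * \<theta>"] by (simp add: \<psi>_def)
  have XY: "X \<rho> * cnj (Y \<rho>) = cis (- 2 * pw * pi) * (sc1 \<rho> \<psi> * cnj (sc0 \<rho> \<psi>))"
    and Yn: "cmod (Y \<rho>) = \<rho> powr - pw * cmod (sc0 \<rho> \<psi>)" if "0 < \<rho>" for \<rho>
  proof -
    have pp: "complex_of_real (\<rho> powr pw) * of_real (\<rho> powr - pw) = 1" using that by (simp add: powr_minus field_simps)
    have Y: "Y \<rho> = of_real (\<rho> powr - pw) * cis (- pw * \<psi>) * sc0 \<rho> \<psi>"
      unfolding Y_def using fa_fb_sc(1)[OF that c] by (simp add: mult.commute)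
    have X: "X \<rho> = cis (- 2 * \<alpha>) * (of_real (\<rho> powr pw) * cis (pw * \<psi>) * sc1 \<rho> \<psi>)"
      unfolding X_def using fa_fb_sc(2)[OF that c] by (simp add: mult.commute)
    have "X \<rho> * cnj (Y \<rho>) = (complex_of_real (\<rho> powr pw) * of_real (\<rho> powr - pw)) * (cis (- 2 * \<alpha>) * (cis (pw * \<psi>) * cis (pw * \<psi>))) * (sc1 \<rho> \<psi> * cnj (sc0 \<rho> \<psi>))"
      unfolding X Y by (simp add: cis_cnj mult_ac)
    moreover have "- 2 * \<alpha> + (pw * \<psi> + pw * \<psi>) = - 2 * pw * pi" by (simp add: \<psi>_def alpha_eq algebra_simps)
    ultimately show "X \<rho> * cnj (Y \<rho>) = cis (- 2 * pw * pi) * (sc1 \<rho> \<psi> * cnj (sc0 \<rho> \<psi>))"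
      unfolding pp cis_mult by simp
    show "cmod (Y \<rho>) = \<rho> powr - pw * cmod (sc0 \<rho> \<psi>)" unfolding Y by (simp add: norm_mult)
  qed
  define I where "I = \<bar>Im (cis (- 2 * pw * pi) * (u1 * cnj u0))\<bar>"
  have I: "0 < I"
  proof -
    have p: "2 * pw * pi = pi / real (Suc k)" unfolding pw_def by (simp del: of_nat_Suc)
    have "0 < pi / real (Suc k)" "pi / real (Suc k) < pi" using k_pos by (auto simp: divide_less_eq)
    then have s: "0 < sin (2 * pw * pi)" unfolding p by (rule sin_gt_zero)
    have "Im u0 = 0" "Im u1 = 0" using u01_real by (simp_all add: complex_eq_iff)
    then have "I = \<bar>sin (2 * pw * pi) * (Re u1 * Re u0)\<bar>" unfolding I_def by simp
    moreover have "Re u0 \<noteq> 0" "Re u1 \<noteq> 0" using u01_nonzero \<open>Im u0 = 0\<close> \<open>Im u1 = 0\<close> by (auto simp: complex_eq_iff)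
    ultimately show ?thesis using s by simp
  qed
  have "((\<lambda>\<rho>. \<bar>Im (cis (- 2 * pw * pi) * (sc1 \<rho> \<psi> * cnj (sc0 \<rho> \<psi>)))\<bar>) \<longlongrightarrow> I) at_top"
    unfolding I_def by (intro tendsto_intros t0 t1)
  then have ev1: "\<forall>\<^sub>F \<rho> in at_top. I / 2 < \<bar>Im (cis (- 2 * pw * pi) * (sc1 \<rho> \<psi> * cnj (sc0 \<rho> \<psi>)))\<bar>"
    by (rule order_tendstoD) (use I in simp)
  define S where "S = cmod u0 + 1"
  have S: "0 < S" by (simp add: S_def add_nonneg_pos)
  have ev2: "\<forall>\<^sub>F \<rho> in at_top. cmod (sc0 \<rho> \<psi>) < S"
    by (rule order_tendstoD(2)[OF tendsto_norm[OF t0]]) (simp add: S_def)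
  have "\<forall>\<^sub>F \<rho> in at_top. I / (2 * S) * cmod (fa (of_real \<rho>)) \<le> cmod (E1 (of_real \<rho>))"
    using ev1 ev2 eventually_ge_at_top[of 1]
  proof eventually_elim
    case (elim \<rho>)
    have \<rho>: "0 < \<rho>" using elim by simp
    let ?a = "fa (of_real \<rho>)" and ?b = "fb (of_real \<rho>)"
    have re: "Im ?a = 0" "Im ?b = 0" using fa_fb_cnj[of "of_real \<rho>"] by (simp_all add: complex_eq_iff)
    then obtain a b where ab: "?a = of_real a" "?b = of_real b" by (metis complex_is_Real_iff Reals_cases)
    have "E1 (of_real \<rho>) = ?a * X \<rho> - ?b * Y \<rho>" unfolding E1_def X_def Y_def by (simp add: mult_ac)
    then have "E1 (of_real \<rho>) * cnj (Y \<rho>) = of_real a * (X \<rho> * cnj (Y \<rho>)) - of_real b * (Y \<rho> * cnj (Y \<rho>))"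
      unfolding ab by (simp add: left_diff_distrib mult.assoc)
    also have "of_real b * (Y \<rho> * cnj (Y \<rho>)) = of_real (b * (cmod (Y \<rho>))\<^sup>2)"
      unfolding complex_norm_square[symmetric] by simp
    finally have "E1 (of_real \<rho>) * cnj (Y \<rho>) = of_real a * (X \<rho> * cnj (Y \<rho>)) - of_real (b * (cmod (Y \<rho>))\<^sup>2)" .
    then have "Im (E1 (of_real \<rho>) * cnj (Y \<rho>)) = a * Im (X \<rho> * cnj (Y \<rho>))" by simp
    then have "\<bar>a\<bar> * \<bar>Im (X \<rho> * cnj (Y \<rho>))\<bar> \<le> cmod (E1 (of_real \<rho>) * cnj (Y \<rho>))"
      using abs_Im_le_cmod[of "E1 (of_real \<rho>) * cnj (Y \<rho>)"] by (simp add: abs_mult)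
    then have "\<bar>a\<bar> * (I / 2) \<le> cmod (E1 (of_real \<rho>)) * cmod (Y \<rho>)"
      using elim(1) mult_left_mono[of "I / 2" "\<bar>Im (X \<rho> * cnj (Y \<rho>))\<bar>" "\<bar>a\<bar>"] unfolding XY[OF \<rho>] by (simp add: norm_mult)
    also have "\<dots> \<le> cmod (E1 (of_real \<rho>)) * S"
    proof (rule mult_left_mono)
      have "\<rho> powr - pw \<le> 1" using elim by (simp add: powr_minus_divide pw_def ge_one_powr_ge_zero)
      then have "\<rho> powr - pw * cmod (sc0 \<rho> \<psi>) \<le> 1 * S" using elim by (intro mult_mono) auto
      then show "cmod (Y \<rho>) \<le> S" unfolding Yn[OF \<rho>] by simp
    qed simp
    finally show ?case using S unfolding ab by (simp add: field_simps)
  qed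
  then show ?thesis using I S by (intro exI[of _ "I / (2 * S)"]) auto
qed

end

end

section \<open>Phragmen-Lindelof estimate\<close>

lemma Ln_polar: "0 < r \<Longrightarrow> - pi < x \<Longrightarrow> x \<le> pi \<Longrightarrow> Ln (of_real r * cis x) = of_real (ln r) + \<i> * of_real x"
  by (rule Ln_unique) (simp_all add: exp_add exp_of_real cis_conv_exp)

lemma powr_at_top: "0 < a \<Longrightarrow> filterlim (\<lambda>x::real. x powr a) at_top at_top"
proof -
  assume a: "0 < a"
  have "filterlim (\<lambda>x::real. a * ln x) at_top at_top"
    by (rule filterlim_tendsto_pos_mult_at_top[OF tendsto_const a ln_at_top])
  then have "filterlim (\<lambda>x::real. exp (a * ln x)) at_top at_top"
    by (rule filterlim_compose[OF exp_at_top])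
  moreover have "\<forall>\<^sub>F x in at_top. exp (a * ln x) = x powr a"
    using eventually_gt_at_top[of 0] by eventually_elim (simp add: powr_def)
  ultimately show ?thesis by (rule filterlim_cong[OF refl refl, THEN iffD1, rotated])
qed

definition quadrant :: "real \<Rightarrow> complex set" where
  "quadrant R = {W. 0 \<le> Re W \<and> 0 \<le> Im W \<and> R \<le> cmod W}"

text \<open>Regularisation by exp(-\<open>\<epsilon>\<close> V) with V = (exp(-i pi/4) W)^(3/2). The
  exponent 3/2 beats the exponential type of g and stays below the critical exponent 2 of a
  quadrant, so Re V is still positive there. The arc |W| = R0 belongs to the boundary because bounds
  are available for large W only.\<close>

lemma phragmen_lindelof_quadrant:
  assumes R0: "0 < R0" and hol: "g holomorphic_on quadrant R0"
    and bd: "\<And>W. W \<in> quadrant R0 \<Longrightarrow> Re W = 0 \<or> Im W = 0 \<or> cmod W = R0 \<Longrightarrow> cmod (g W) \<le> B"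
    and gr: "\<And>W. W \<in> quadrant R0 \<Longrightarrow> cmod (g W) \<le> C * exp (C * cmod W)" and B: "0 < B" and C: "0 \<le> C"
    and W: "W \<in> quadrant R0"
  shows "cmod (g W) \<le> B"
proof -
  define V where "V W = exp (of_real (3/2) * Ln (cis (- pi / 4) * W))" for W
  \<comment> \<open>After the rotation the arguments lie within pi/4 of 0, and 3/2 times pi/4 is 3
    pi/8 < pi/2.\<close>
  define \<kappa> where "\<kappa> = cos (3 * pi / 8)"
  have \<kappa>: "0 < \<kappa>" unfolding \<kappa>_def by (rule cos_gt_zero_pi) auto
  have ReV: "\<kappa> * cmod W powr (3/2) \<le> Re (V W)" and rot: "0 < Re (cis (- pi / 4) * W)" if W: "W \<in> quadrant R0" for W
  proof -
    have W0: "W \<noteq> 0" using W R0 by (auto simp: quadrant_def)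
    define a where "a = Arg W"
    have "0 \<le> Im W" "0 \<le> Re W" using W by (auto simp: quadrant_def)
    then have a: "0 \<le> a" "a \<le> pi / 2" unfolding a_def using Arg_Re_nonneg[of W] Arg_less_0[of W] by linarith+
    have Wp: "W = of_real (cmod W) * cis a" unfolding a_def rcis_def[symmetric] rcis_cmod_Arg ..
    have r: "cis (- pi / 4) * W = of_real (cmod W) * cis (a - pi / 4)"
      by (subst Wp) (simp add: cis_mult[symmetric] diff_conv_add_uminus mult_ac del: add_uminus_conv_diff)
    have L: "Ln (cis (- pi / 4) * W) = of_real (ln (cmod W)) + \<i> * of_real (a - pi / 4)"
    proof -
      have "- pi < a - pi / 4" "a - pi / 4 \<le> pi" using a pi_gt_zero by linarith+
      then show ?thesis unfolding r using W0 by (intro Ln_polar) auto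
    qed
    have "V W = exp (Complex (3/2 * ln (cmod W)) (3/2 * (a - pi/4)))"
      unfolding V_def L by (rule arg_cong[of _ _ exp]) (simp add: complex_eq_iff)
    then have "Re (V W) = cmod W powr (3/2) * cos (3/2 * (a - pi/4))"
      using W0 by (simp add: exp_eq_polar powr_def)
    moreover have "\<kappa> \<le> cos (3/2 * (a - pi/4))"
    proof -
      have "3/2 * (a - pi/4) \<le> 3 * pi / 8" "- (3/2 * (a - pi/4)) \<le> 3 * pi / 8" using a by (simp_all add: field_simps)
      then have "\<bar>3/2 * (a - pi/4)\<bar> \<le> 3 * pi / 8" by (rule abs_leI)
      then have "cos (3 * pi / 8) \<le> cos \<bar>3/2 * (a - pi/4)\<bar>" by (intro cos_monotone_0_pi_le) auto
      then show ?thesis unfolding cos_abs_real \<kappa>_def .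
    qed
    ultimately show "\<kappa> * cmod W powr (3/2) \<le> Re (V W)" by (simp only: mult.commute[of \<kappa>]) (rule mult_left_mono, auto)
    have "0 < cos (a - pi / 4)" using a pi_gt_zero by (intro cos_gt_zero_pi) linarith+
    then show "0 < Re (cis (- pi / 4) * W)" unfolding r using W0 by simp
  qed
  have holV: "V holomorphic_on quadrant R0"
    unfolding V_def[abs_def] using rot by (intro holomorphic_intros) (force simp: complex_nonpos_Reals_iff)
  have main: "cmod (g W) * exp (- \<epsilon> * Re (V W)) \<le> B" if \<epsilon>: "0 < \<epsilon>" for \<epsilon>
  proof -
    have "\<forall>\<^sub>F R in at_top. C * exp (C * R - \<epsilon> * (\<kappa> * R powr (3/2))) < B"
    proof -
      have "((\<lambda>R. C * exp (C * R - \<epsilon> * (\<kappa> * R powr (3/2)))) \<longlongrightarrow> C * 0) at_top"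
      proof (intro tendsto_mult tendsto_const)
        have "filterlim (\<lambda>R. R * (\<epsilon> * \<kappa> * R powr (1/2) + - C)) at_top at_top"
        proof (rule filterlim_at_top_mult_at_top[OF filterlim_ident])
          have "filterlim (\<lambda>R::real. R powr (1/2)) at_top at_top"
            by (rule powr_at_top) simp
          then have "filterlim (\<lambda>R. (\<epsilon> * \<kappa>) * R powr (1/2)) at_top at_top"
            using \<epsilon> \<kappa> by (intro filterlim_tendsto_pos_mult_at_top[OF tendsto_const]) auto
          then show "filterlim (\<lambda>R. \<epsilon> * \<kappa> * R powr (1/2) + - C) at_top at_top"
            using filterlim_tendsto_add_at_top[OF tendsto_const[of "- C"]] by (simp add: add.commute)
        qed
        then have "filterlim (\<lambda>R. - (R * (\<epsilon> * \<kappa> * R powr (1/2) + - C))) at_bot at_top"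
          by (simp add: filterlim_uminus_at_top)
        moreover have "\<forall>\<^sub>F R in at_top. - (R * (\<epsilon> * \<kappa> * R powr (1/2) + - C)) = C * R - \<epsilon> * (\<kappa> * R powr (3/2))"
          using eventually_gt_at_top[of 0]
        proof eventually_elim
          case (elim R)
          have "R powr (3/2) = R powr (1 + 1/2)" by simp
          also have "\<dots> = R * R powr (1/2)" using elim by (simp only: powr_add powr_one)
          finally show ?case by (simp add: algebra_simps)
        qed
        ultimately have "filterlim (\<lambda>R. C * R - \<epsilon> * (\<kappa> * R powr (3/2))) at_bot at_top"
          by (rule filterlim_cong[OF refl refl, THEN iffD1, rotated])
        then show "((\<lambda>R. exp (C * R - \<epsilon> * (\<kappa> * R powr (3/2)))) \<longlongrightarrow> 0) at_top"
          by (rule filterlim_compose[OF exp_at_bot])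
      qed
      then show ?thesis using B by (intro order_tendstoD(2)) auto
    qed
    from eventually_conj[OF this eventually_gt_at_top[of "max R0 (cmod W)"]]
    obtain R where R: "C * exp (C * R - \<epsilon> * (\<kappa> * R powr (3/2))) < B" "R0 < R" "cmod W < R"
      using eventually_happens[of _ "at_top :: real filter"] by (auto simp: trivial_limit_at_top_linorder)
    let ?S = "quadrant R0 \<inter> cball 0 R"
    let ?h = "\<lambda>W. g W * exp (- of_real \<epsilon> * V W)"
    have holh: "?h holomorphic_on quadrant R0" by (intro holomorphic_intros hol holV)
    have clq: "closed (quadrant R0)"
      unfolding quadrant_def by (intro closed_Collect_conj closed_Collect_le continuous_intros)
    then have cl: "closed ?S" by (intro closed_Int closed_cball)
    have nh: "cmod (?h W) = cmod (g W) * exp (- \<epsilon> * Re (V W))" for W by (simp add: norm_mult)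
    have "cmod (?h W) \<le> B"
    proof (rule maximum_modulus_frontier[of ?h ?S])
      show "?h holomorphic_on interior ?S" by (rule holomorphic_on_subset[OF holh]) (use interior_subset in blast)
      have "?h holomorphic_on ?S" by (rule holomorphic_on_subset[OF holh]) blast
      then show "continuous_on (closure ?S) ?h"
        unfolding closure_closed[OF cl] by (rule holomorphic_on_imp_continuous_on)
      show "bounded ?S" by (intro bounded_Int) auto
      show "W \<in> ?S" using W R by simp
      fix z assume z: "z \<in> frontier ?S"
      then have zS: "z \<in> ?S" using cl by (simp add: frontier_def)
      let ?O = "{W. 0 < Re W} \<inter> {W. 0 < Im W} \<inter> {W. R0 < cmod W} \<inter> ball 0 R"
      have "open ?O"
        by (intro open_Int open_halfspace_Re_gt open_halfspace_Im_gt open_ball open_Collect_less continuous_intros)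
      moreover have "?O \<subseteq> ?S" by (auto simp: quadrant_def)
      ultimately have "?O \<subseteq> interior ?S" by (rule interior_maximal[rotated])
      then have "z \<notin> ?O" using z by (auto simp: frontier_def)
      then have cases: "(Re z = 0 \<or> Im z = 0 \<or> cmod z = R0) \<or> cmod z = R"
        using zS by (auto simp: quadrant_def)
      have zq: "z \<in> quadrant R0" using zS by simp
      have V0: "\<kappa> * cmod z powr (3/2) \<le> Re (V z)" by (rule ReV[OF zq])
      have k0: "0 \<le> \<kappa> * cmod z powr (3/2)" using \<kappa> by simp
      show "cmod (?h z) \<le> B"
      proof (cases "cmod z = R")
        case True
        have "cmod (?h z) \<le> C * exp (C * R) * exp (- \<epsilon> * (\<kappa> * R powr (3/2)))"
          unfolding nh using gr[OF zq] V0 \<epsilon> C unfolding True by (intro mult_mono) auto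
        also have "\<dots> = C * exp (C * R - \<epsilon> * (\<kappa> * R powr (3/2)))" by (simp add: exp_diff exp_minus field_simps)
        finally show ?thesis using R by linarith
      next
        case False
        then have "cmod (g z) \<le> B" using bd[OF zq] cases by blast
        moreover have "exp (- \<epsilon> * Re (V z)) \<le> 1" using V0 k0 \<epsilon> by simp
        ultimately have "cmod (g z) * exp (- \<epsilon> * Re (V z)) \<le> B * 1" using B by (intro mult_mono) auto
        then show ?thesis unfolding nh by simp
      qed
    qed
    then show ?thesis unfolding nh .
  qed
  have "((\<lambda>\<epsilon>. cmod (g W) * exp (- \<epsilon> * Re (V W))) \<longlongrightarrow> cmod (g W) * exp (- 0 * Re (V W))) (at_right 0)"
    by (intro tendsto_intros)
  moreover have "\<forall>\<^sub>F \<epsilon> in at_right 0. cmod (g W) * exp (- \<epsilon> * Re (V W)) \<le> B"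
    using eventually_at_right_less[of 0] by eventually_elim (rule main)
  ultimately have "cmod (g W) * exp (- 0 * Re (V W)) \<le> B"
    by (rule tendsto_upperbound) simp
  then show ?thesis by simp
qed

section \<open>The variable W, with zeta = W^((l-k)/(l+1))\<close>

context exponents
begin

definition ex :: real where "ex = \<theta> / pi"

text \<open>Principal power. The closed upper half plane goes to the sector from 0 to
  \<open>\<theta>\<close>, the positive imaginary axis to the ray at \<open>\<theta>\<close>/2 on
  which conjugation acts as one rotation step.\<close>

definition zt :: "complex \<Rightarrow> complex" where "zt W = exp (of_real ex * Ln W)"

lemma ex: "0 < ex" "ex = real (l - k) / real (Suc l)"
  using cr(4) unfolding ex_def by simp (simp add: \<theta>_def del: of_nat_Suc)

lemma zt_polar:
  assumes "W \<noteq> 0"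
  shows "zt W = of_real (cmod W powr ex) * cis (ex * Arg W)"
proof -
  have "Ln W = Complex (ln (cmod W)) (Arg W)" using assms by (simp add: complex_eq_iff Arg_eq_Im_Ln)
  then have "of_real ex * Ln W = Complex (ex * ln (cmod W)) (ex * Arg W)" by (simp add: complex_eq_iff)
  then show ?thesis unfolding zt_def using assms by (simp add: exp_eq_polar powr_def)
qed

lemma zt_root:
  assumes "W \<noteq> 0"
  defines "s \<equiv> cmod W powr (1 / real (Suc l))"
  shows "0 < s" "s ^ Suc l = cmod W" "s ^ (l - k) = cmod W powr ex" "1 \<le> cmod W \<Longrightarrow> 1 \<le> s"
proof -
  show s: "0 < s" using assms by simp
  have p: "s ^ n = cmod W powr (real n / real (Suc l))" for n
    using s by (simp add: powr_realpow[symmetric] s_def powr_powr del: of_nat_Suc)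
  show "s ^ Suc l = cmod W" "s ^ (l - k) = cmod W powr ex"
    unfolding p ex(2) using assms by (simp_all del: of_nat_Suc)
  show "1 \<le> cmod W \<Longrightarrow> 1 \<le> s" unfolding s_def by (rule ge_one_powr_ge_zero) auto
qed

lemma zt_holomorphic: "S \<inter> \<real>\<^sub>\<le>\<^sub>0 = {} \<Longrightarrow> zt holomorphic_on S"
  unfolding zt_def[abs_def] by (intro holomorphic_intros) auto

lemma zt_angle: "0 \<le> Im W \<Longrightarrow> W \<noteq> 0 \<Longrightarrow> ex * Arg W \<in> {0..\<theta>}"
proof -
  assume W: "0 \<le> Im W" "W \<noteq> 0"
  have "0 \<le> ex * Arg W" using W ex(1) Arg_less_0[of W] by simp
  moreover have "ex * Arg W \<le> ex * pi" using Arg_le_pi ex(1) by (intro mult_left_mono) auto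
  moreover have "ex * pi = \<theta>" by (simp add: ex_def)
  ultimately show ?thesis by simp
qed

lemma zt_eventually:
  assumes "\<forall>\<^sub>F \<rho> in at_top. P (\<rho> :: real)"
  shows "\<exists>R\<ge>1. \<forall>W. R \<le> cmod W \<longrightarrow> P (cmod W powr ex)"
proof -
  have "\<forall>\<^sub>F R in at_top. P (R powr ex)"
    using filterlim_iff[THEN iffD1, OF powr_at_top[OF ex(1)], rule_format, OF assms] .
  then obtain R where "\<And>x. R \<le> x \<Longrightarrow> P (x powr ex)" unfolding eventually_at_top_linorder by blast
  then show ?thesis by (intro exI[of _ "max 1 R"]) auto
qed

lemma E2_growth: "\<exists>C\<ge>0. \<forall>W. 1 \<le> cmod W \<longrightarrow> cmod (E2 (zt W)) \<le> C * exp (C * cmod W)"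
proof -
  obtain C where C: "0 \<le> C" "\<And>s \<phi>. 1 \<le> s \<Longrightarrow> cmod (fa (of_real (s ^ (l - k)) * cis \<phi>)) \<le> C * exp (C * s ^ Suc l)"
      "\<And>s \<phi>. 1 \<le> s \<Longrightarrow> cmod (fb (of_real (s ^ (l - k)) * cis \<phi>)) \<le> C * exp (C * s ^ Suc l)"
    using fa_fb_growth by blast
  show ?thesis
  proof (intro exI[of _ "max (2 * C * C) (2 * C)"] conjI allI impI)
    show "0 \<le> max (2 * C * C) (2 * C)" using C by simp
    fix W :: complex assume W: "1 \<le> cmod W"
    then have W0: "W \<noteq> 0" by auto
    define s where "s = cmod W powr (1 / real (Suc l))"
    note s = zt_root[OF W0, folded s_def]
    have z: "zt W = of_real (s ^ (l - k)) * cis (ex * Arg W)" unfolding zt_polar[OF W0] s(3) ..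
    define X where "X = C * exp (C * cmod W)"
    have X: "cmod (fa (cis t * zt W)) \<le> X" "cmod (fb (cis t * zt W)) \<le> X" for t
      unfolding X_def z rot using C(2,3)[OF s(4)[OF W]] unfolding s(2) by auto
    have X0: "0 \<le> X" using C by (simp add: X_def)
    have "cmod (E2 (zt W)) \<le> cmod (fa (cis \<theta> * zt W)) * cmod (fb (cis (- \<theta>) * zt W)) + cmod (fb (cis \<theta> * zt W)) * cmod (fa (cis (- \<theta>) * zt W))"
      unfolding E2_def by (rule norm_triangle_le_diff) (simp add: norm_mult)
    also have "\<dots> \<le> X * X + X * X" using X X0 by (intro add_mono mult_mono) auto
    also have "\<dots> = 2 * C * C * exp (2 * C * cmod W)" unfolding X_def by (simp add: exp_add[symmetric])
    also have "\<dots> \<le> max (2 * C * C) (2 * C) * exp (max (2 * C * C) (2 * C) * cmod W)"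
      using C by (intro mult_mono) (auto intro!: mult_right_mono)
    finally show "cmod (E2 (zt W)) \<le> max (2 * C * C) (2 * C) * exp (max (2 * C * C) (2 * C) * cmod W)" .
  qed
qed

context
  assumes half: "\<theta> \<le> pi / 2"
begin

lemma E1_E2_zt:
  "\<exists>R\<ge>1. \<forall>W. R \<le> cmod W \<longrightarrow> 0 \<le> Im W \<longrightarrow> 6 \<le> cmod (E1 (zt W)) * cmod (E2 (zt W)) \<and> cmod (E1 (zt W)) * cmod (E2 (zt W)) \<le> 10"
proof -
  from zt_eventually[OF E1_E2_bounds[OF half]]
  obtain R where R: "1 \<le> R" "\<And>W \<phi>. R \<le> cmod W \<Longrightarrow> \<phi> \<in> {0..\<theta>} \<Longrightarrow>
     6 \<le> cmod (E1 (of_real (cmod W powr ex) * cis \<phi>)) * cmod (E2 (of_real (cmod W powr ex) * cis \<phi>)) \<and>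
     cmod (E1 (of_real (cmod W powr ex) * cis \<phi>)) * cmod (E2 (of_real (cmod W powr ex) * cis \<phi>)) \<le> 10" by blast
  show ?thesis
  proof (intro exI[of _ R] conjI R(1) allI impI)
    fix W assume W: "R \<le> cmod W" "0 \<le> Im W"
    then have W0: "W \<noteq> 0" using R(1) by auto
    show "6 \<le> cmod (E1 (zt W)) * cmod (E2 (zt W))" "cmod (E1 (zt W)) * cmod (E2 (zt W)) \<le> 10"
      using R(2)[OF W(1) zt_angle[OF W(2) W0]] unfolding zt_polar[OF W0, symmetric] by auto
  qed
qed

lemma E1_neutral_axis:
  assumes "0 < N"
  shows "cmod (E2 (zt (\<i> * of_real N))) = cmod (E1 (zt (\<i> * of_real N)))"
proof -
  have "Arg (\<i> * of_real N) = pi / 2" unfolding Arg_times_of_real2[OF assms] by simp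
  then have "zt (\<i> * of_real N) = of_real (N powr ex) * cis (\<theta> / 2)"
    using assms by (subst zt_polar) (auto simp: norm_mult ex_def)
  then show ?thesis using E1_E2_neutral[OF half] by simp
qed

text \<open>Phragmen-Lindelof for exp(c1 W)/\<open>E1\<close>. The product bound gives
  1/|\<open>E1\<close>| <= |\<open>E2\<close>|, hence exponential type; on the imaginary axis
  |\<open>E1\<close>|^2 = |\<open>E1\<close> \<open>E2\<close>| >= 6; on the real axis
  |\<open>E1\<close>| is at least a multiple of |\<open>fa\<close>|, hence of exp(c1 W).\<close>

lemma E1_lower_bound:
  "\<exists>c>0. \<exists>B>0. \<exists>R\<ge>1. \<forall>W\<in>quadrant R. exp (c * Re W) \<le> B * cmod (E1 (zt W))"
proof -
  obtain R1 where R1: "1 \<le> R1" "\<And>W. R1 \<le> cmod W \<Longrightarrow> 0 \<le> Im W \<Longrightarrow> 6 \<le> cmod (E1 (zt W)) * cmod (E2 (zt W)) \<and> cmod (E1 (zt W)) * cmod (E2 (zt W)) \<le> 10"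
    using E1_E2_zt by blast
  obtain C where C: "0 \<le> C" "\<And>W. 1 \<le> cmod W \<Longrightarrow> cmod (E2 (zt W)) \<le> C * exp (C * cmod W)" using E2_growth by blast
  obtain c1 L0 where c1: "0 < c1" "1 \<le> L0" "\<And>L. L0 \<le> L \<Longrightarrow> exp (c1 * L) \<le> cmod (conn0 (of_real L) (- of_real L))"
    using conn0_lower_bound by blast
  obtain c2 where c2: "0 < c2" "\<forall>\<^sub>F \<rho> in at_top. c2 * cmod (fa (of_real \<rho>)) \<le> cmod (E1 (of_real \<rho>))"
    using E1_real_axis[OF half] by blast
  obtain R2 where R2: "1 \<le> R2" "\<And>W. R2 \<le> cmod W \<Longrightarrow> c2 * cmod (fa (of_real (cmod W powr ex))) \<le> cmod (E1 (of_real (cmod W powr ex)))"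
    using zt_eventually[OF c2(2)] by blast
  define R where "R = max R1 (max R2 L0)"
  have R: "1 \<le> R" "R1 \<le> R" "R2 \<le> R" "L0 \<le> R" using R1 by (auto simp: R_def)
  have E1nz: "E1 (zt W) \<noteq> 0" and inv: "1 / cmod (E1 (zt W)) \<le> cmod (E2 (zt W))" if W: "W \<in> quadrant R" for W
  proof -
    have e: "6 \<le> cmod (E1 (zt W)) * cmod (E2 (zt W))" using R1(2)[of W] W R by (auto simp: quadrant_def)
    then show nz: "E1 (zt W) \<noteq> 0" by auto
    have "1 \<le> cmod (E1 (zt W)) * cmod (E2 (zt W))" using e by linarith
    then show "1 / cmod (E1 (zt W)) \<le> cmod (E2 (zt W))" using nz by (simp add: divide_le_eq mult.commute)
  qed
  let ?g = "\<lambda>W. exp (of_real c1 * W) / E1 (zt W)"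
  have ng: "cmod (?g W) = exp (c1 * Re W) * (1 / cmod (E1 (zt W)))" for W by (simp add: norm_divide)
  have np: "quadrant R \<inter> \<real>\<^sub>\<le>\<^sub>0 = {}" using R by (force simp: quadrant_def complex_nonpos_Reals_iff cmod_def)
  have "(\<lambda>W. E1 (zt W)) holomorphic_on quadrant R"
    using holomorphic_on_compose[OF zt_holomorphic[OF np] brackets_holomorphic(1)] by (simp add: o_def)
  then have hol: "?g holomorphic_on quadrant R" using E1nz by (intro holomorphic_intros) auto
  have "compact (quadrant R \<inter> cball 0 R)"
    unfolding quadrant_def by (intro closed_Int_compact closed_Collect_conj closed_Collect_le continuous_intros compact_cball)
  moreover have "continuous_on (quadrant R \<inter> cball 0 R) ?g"
    by (rule holomorphic_on_imp_continuous_on[OF holomorphic_on_subset[OF hol]]) auto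
  ultimately have "bounded (?g ` (quadrant R \<inter> cball 0 R))" by (intro compact_imp_bounded compact_continuous_image)
  then obtain B0 where B0': "\<forall>x\<in>?g ` (quadrant R \<inter> cball 0 R). cmod x \<le> B0" unfolding bounded_iff by blast
  have B0: "cmod (?g W) \<le> B0" if "W \<in> quadrant R" "cmod W \<le> R" for W
    using that B0'[rule_format, of "?g W"] by auto
  define B where "B = max B0 (max 1 (1 / c2))"
  have B: "1 \<le> B" "B0 \<le> B" "1 / c2 \<le> B" by (auto simp: B_def)
  define C' where "C' = C + c1"
  have gB: "cmod (?g W) \<le> B" if W: "W \<in> quadrant R" for W
  proof (rule phragmen_lindelof_quadrant[of R ?g B C'])
    show "0 < R" "0 < B" "0 \<le> C'" using R B C c1 by (auto simp: C'_def)
    show "?g holomorphic_on quadrant R" by (rule hol)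
    show "W \<in> quadrant R" by (rule W)
  next
    fix W assume W: "W \<in> quadrant R"
    have "cmod (?g W) \<le> exp (c1 * cmod W) * (C * exp (C * cmod W))"
      unfolding ng using inv[OF W] C(2)[of W] W R complex_Re_le_cmod[of W] c1 by (intro mult_mono) (auto simp: quadrant_def)
    also have "\<dots> = C * exp (C' * cmod W)" by (simp add: C'_def exp_add[symmetric] algebra_simps)
    also have "\<dots> \<le> C' * exp (C' * cmod W)" using c1 by (intro mult_right_mono) (auto simp: C'_def)
    finally show "cmod (?g W) \<le> C' * exp (C' * cmod W)" .
  next
    fix W assume W: "W \<in> quadrant R" and b: "Re W = 0 \<or> Im W = 0 \<or> cmod W = R"
    have W1: "1 \<le> cmod W" using W R by (auto simp: quadrant_def)
    consider "cmod W = R" | "Re W = 0" | "Im W = 0" using b by blast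
    then show "cmod (?g W) \<le> B"
    proof cases
      case 1 then show ?thesis using B0[OF W] B by simp
    next
      case 2
      define N where "N = Im W"
      have N: "W = \<i> * of_real N" "0 < N" using 2 W W1 by (auto simp: complex_eq_iff N_def quadrant_def cmod_def intro: le_neq_trans)
      have "6 \<le> cmod (E1 (zt W)) * cmod (E1 (zt W))"
        using R1(2)[of W] W R E1_neutral_axis[OF N(2)] unfolding N(1)[symmetric] by (auto simp: quadrant_def)
      have "1 \<le> cmod (E1 (zt W))"
      proof (rule ccontr)
        assume "\<not> 1 \<le> cmod (E1 (zt W))"
        then have "cmod (E1 (zt W)) * cmod (E1 (zt W)) \<le> 1 * 1" by (intro mult_mono) auto
        then show False using \<open>6 \<le> cmod (E1 (zt W)) * cmod (E1 (zt W))\<close> by simp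
      qed
      then have "1 / cmod (E1 (zt W)) \<le> 1" by (simp add: divide_le_eq_1)
      then show ?thesis unfolding ng using 2 B by simp
    next
      case 3
      define L where "L = Re W"
      have L: "W = of_real L" "0 < L" "cmod W = L" using 3 W W1 by (auto simp: complex_eq_iff L_def quadrant_def cmod_def intro: le_neq_trans)
      have W0: "W \<noteq> 0" using L by auto
      have LR: "R \<le> L" using W L by (auto simp: quadrant_def)
      have zW: "zt W = of_real (L powr ex)" using zt_polar[OF W0] L Arg_of_real[of L] by simp
      define s where "s = cmod W powr (1 / real (Suc l))"
      note s = zt_root[OF W0, folded s_def]
      have "exp (c1 * L) \<le> cmod (conn0 (of_real L) (- of_real L))" using c1(3) LR R by simp
      also have "\<dots> \<le> sqrt s * cmod (conn0 (of_real L) (- of_real L))"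
        using s(4)[OF W1] by (simp add: mult_le_cancel_right1)
      also have "\<dots> = cmod (fa (zt W))"
        using conn_scale_large(1)[OF s(1), of 0] s(1) unfolding s(2,3) L(3) zW by (simp add: norm_mult)
      finally have "c2 * exp (c1 * L) \<le> c2 * cmod (fa (zt W))" using c2 by simp
      also have "\<dots> \<le> cmod (E1 (zt W))" using R2(2)[of W] LR R unfolding L(3) zW by simp
      finally have "exp (c1 * L) / cmod (E1 (zt W)) \<le> 1 / c2"
        using c2(1) E1nz[OF W] by (simp add: field_simps)
      then show ?thesis unfolding ng using B L(1) by simp
    qed
  qed
  have "exp (c1 * Re W) \<le> B * cmod (E1 (zt W))" if "W \<in> quadrant R" for W
  proof -
    have "0 < cmod (E1 (zt W))" using E1nz[OF that] by simp
    then show ?thesis using gB[OF that] unfolding ng by (simp add: pos_divide_le_eq)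
  qed
  then show ?thesis using c1 B R by (intro exI[of _ c1] conjI exI[of _ B] exI[of _ R]) auto
qed

end

end

section \<open>Zeros near the imaginary axis\<close>

lemma eventually_norm_bounds:
  fixes f :: "real \<Rightarrow> 'a \<Rightarrow> complex"
  assumes "uniform_limit X f (\<lambda>_. c) at_top" "c \<noteq> 0"
  shows "\<forall>\<^sub>F \<rho> in at_top. \<forall>x\<in>X. cmod c / 2 \<le> cmod (f \<rho> x) \<and> cmod (f \<rho> x) \<le> 2 * cmod c"
proof -
  have "0 < cmod c / 2" using assms by simp
  from uniform_limitD[OF assms(1) this] show ?thesis
  proof eventually_elim
    case (elim \<rho>)
    show ?case
    proof
      fix x assume "x \<in> X"
      then have "cmod (f \<rho> x - c) < cmod c / 2" using elim by (simp add: dist_norm)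
      then show "cmod c / 2 \<le> cmod (f \<rho> x) \<and> cmod (f \<rho> x) \<le> 2 * cmod c"
        using norm_triangle_ineq2[of c "f \<rho> x"] norm_triangle_ineq2[of "f \<rho> x" c] by (simp add: norm_minus_commute)
    qed
  qed
qed

text \<open>Plucker relation for g_(-1), g_0, g_2 and the solution with data (0, 1) at 0. The
  Wronskian of g_0 with the latter is a0, the value of \<open>fa\<close>.\<close>

lemma plucker_one_sided:
  fixes w v :: complex
  assumes "w * v = 1" "w * am * b0 - bm * a0 = c"
  shows "a0 * (w * w * (am * b2) - v * (a2 * bm)) = - (v * c * - a2 + (w * w * a0 * b2 - b0 * a2) * - am)"
  using assms by algebra

text \<open>The same relation with the reflected decaying solution as fourth member; its data are
  (\<open>as\<close>, -\<open>bs\<close>), where \<open>as\<close> and \<open>bs\<close> are the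
  values of \<open>fa\<close> and \<open>fb\<close> at -zeta.\<close>

lemma plucker_two_sided:
  fixes w v :: complex
  assumes "w * v = 1" "w * am * b0 - bm * a0 = c"
  shows "(- (a0 * bs) - b0 * as) * (w * w * (am * b2) - v * (a2 * bm)) =
     - (v * c * (w * w * (as * b2) + 1 * (a2 * bs)) + (w * w * a0 * b2 - b0 * a2) * (v * (as * bm) + 1 * (am * bs)))"
  using assms by algebra

context exponents
begin

context
  assumes half: "\<theta> \<le> pi / 2"
begin

text \<open>The function \<open>F\<close> below omits \<open>0\<close>, takes the value \<open>1\<close> exactly at the zeros of \<open>D\<close>, is bounded at
  \<open>\<i> N\<close> and grows exponentially to the right of the imaginary axis. By Schottky's theorem it cannot
  omit \<open>1\<close> on a large disc around \<open>\<i> N\<close>.\<close>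

lemma zeros_near_imaginary_axis:
  assumes hol: "N1 holomorphic_on UNIV" "N2 holomorphic_on UNIV"
    and pl: "\<And>\<zeta>. D \<zeta> * EL \<zeta> = - (cis \<alpha> * qc * N2 \<zeta> + E1 \<zeta> * N1 \<zeta>)"
    and m: "0 < m"
    and bd: "\<forall>\<^sub>F \<rho> in at_top. \<forall>\<phi>\<in>{0..\<theta>}. N2 (of_real \<rho> * cis \<phi>) \<noteq> 0 \<and>
        m * cmod (N2 (of_real \<rho> * cis \<phi>)) \<le> cmod (N1 (of_real \<rho> * cis \<phi>)) \<and> m * cmod (N1 (of_real \<rho> * cis \<phi>)) \<le> cmod (N2 (of_real \<rho> * cis \<phi>))"
  shows "\<exists>r>0. \<exists>N0. \<forall>N\<ge>N0. \<exists>W. cmod (W - \<i> * of_real N) \<le> r \<and> D (zt W) = 0"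
proof -
  obtain R1 where R1: "1 \<le> R1" "\<And>W. R1 \<le> cmod W \<Longrightarrow> 0 \<le> Im W \<Longrightarrow> 6 \<le> cmod (E1 (zt W)) * cmod (E2 (zt W)) \<and> cmod (E1 (zt W)) * cmod (E2 (zt W)) \<le> 10"
    using E1_E2_zt[OF half] by blast
  obtain c B R2 where c: "0 < c" "0 < B" "1 \<le> R2" "\<And>W. W \<in> quadrant R2 \<Longrightarrow> exp (c * Re W) \<le> B * cmod (E1 (zt W))"
    using E1_lower_bound[OF half] by blast
  obtain R3 where R3: "1 \<le> R3" "\<And>W. R3 \<le> cmod W \<Longrightarrow> 0 \<le> Im W \<Longrightarrow> cmod (EL (zt W) - qc) < 1 \<and> N2 (zt W) \<noteq> 0 \<and>
        m * cmod (N2 (zt W)) \<le> cmod (N1 (zt W)) \<and> m * cmod (N1 (zt W)) \<le> cmod (N2 (zt W))"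
  proof -
    from zt_eventually[OF eventually_conj[OF EL_limit[OF half] bd]]
    obtain R where R: "1 \<le> R" "\<And>W \<phi>. R \<le> cmod W \<Longrightarrow> \<phi> \<in> {0..\<theta>} \<Longrightarrow>
       cmod (EL (of_real (cmod W powr ex) * cis \<phi>) - qc) < 1 \<and> N2 (of_real (cmod W powr ex) * cis \<phi>) \<noteq> 0 \<and>
        m * cmod (N2 (of_real (cmod W powr ex) * cis \<phi>)) \<le> cmod (N1 (of_real (cmod W powr ex) * cis \<phi>)) \<and> m * cmod (N1 (of_real (cmod W powr ex) * cis \<phi>)) \<le> cmod (N2 (of_real (cmod W powr ex) * cis \<phi>))"
      by blast
    have "cmod (EL (zt W) - qc) < 1 \<and> N2 (zt W) \<noteq> 0 \<and>
        m * cmod (N2 (zt W)) \<le> cmod (N1 (zt W)) \<and> m * cmod (N1 (zt W)) \<le> cmod (N2 (zt W))" if W: "R \<le> cmod W" "0 \<le> Im W" for W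
    proof -
      have W0: "W \<noteq> 0" using W R(1) by auto
      show ?thesis using R(2)[OF W(1) zt_angle[OF W(2) W0]] unfolding zt_polar[OF W0, symmetric] .
    qed
    then show ?thesis using that R(1) by blast
  qed
  \<comment> \<open>At i N one has |\<open>E1\<close>| <= 4, |N1/N2| <= 1/m and |\<open>qc\<close>|
    = 2, so |F| <= 2/m; \<open>S\<close> is then Schottky's bound on the disc of half the
    radius.\<close>
  define C1 where "C1 = 2 / m"
  define S where "S = exp (pi * exp (pi * (2 + 2 * C1 + 12 * (1/2) / (1 - 1/2))))"
  \<comment> \<open>Then exp(c t) > c t >= 2 B S / m, which pushes |F| above \<open>S\<close> at i N
    + t. The disc has radius 2t, so this point lies at half the radius, where Schottky's bound
    applies.\<close>
  define t where "t = 2 * B * (S + 1) / m / c"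
  have S0: "0 < S" by (simp add: S_def)
  have t: "0 < t" unfolding t_def using c m S0 by simp
  \<comment> \<open>The summand 2t keeps the whole disc in the upper half plane and beyond all three
    radii.\<close>
  define N0 where "N0 = max R1 (max R2 R3) + 2 * t"
  show ?thesis
  proof (rule exI[of _ "2 * t"], intro conjI exI[of _ N0] allI impI)
    show "0 < 2 * t" using t by simp
    fix N assume N: "N0 \<le> N"
    let ?W0 = "\<i> * complex_of_real N"
    have N1: "1 \<le> N" using N t R1 by (simp add: N0_def)
    have disc: "0 < Im W" "R1 \<le> cmod W" "R2 \<le> cmod W" "R3 \<le> cmod W" if W: "W \<in> cball ?W0 (2 * t)" for W
    proof -
      have "cmod (?W0 - W) \<le> 2 * t" using W by (simp add: dist_norm)
      then have "\<bar>Im (?W0 - W)\<bar> \<le> 2 * t" using abs_Im_le_cmod[of "?W0 - W"] by linarith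
      then have "N - 2 * t \<le> Im W" by simp
      then have "max R1 (max R2 R3) \<le> Im W" using N unfolding N0_def by linarith
      moreover have "Im W \<le> cmod W" using abs_Im_le_cmod[of W] by linarith
      ultimately show "0 < Im W" "R1 \<le> cmod W" "R2 \<le> cmod W" "R3 \<le> cmod W" using R1(1) by auto
    qed
    show "\<exists>W. cmod (W - ?W0) \<le> 2 * t \<and> D (zt W) = 0"
    proof (rule ccontr)
      assume "\<not> ?thesis"
      then have D: "D (zt W) \<noteq> 0" if "W \<in> cball ?W0 (2 * t)" for W using that by (auto simp: dist_norm norm_minus_commute)
      define F where "F W = - E1 (zt W) * N1 (zt W) / (cis \<alpha> * qc * N2 (zt W))" for W
      have nF: "cmod (F W) = cmod (E1 (zt W)) * (cmod (N1 (zt W)) / cmod (N2 (zt W))) / 2" for W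
        unfolding F_def by (simp add: norm_divide norm_mult norm_qc)
      have ratio: "m \<le> cmod (N1 (zt W)) / cmod (N2 (zt W))" "cmod (N1 (zt W)) / cmod (N2 (zt W)) \<le> 1 / m"
        and nz: "N2 (zt W) \<noteq> 0" "N1 (zt W) \<noteq> 0" "E1 (zt W) \<noteq> 0" "EL (zt W) \<noteq> 0"
        if W: "W \<in> cball ?W0 (2 * t)" for W
      proof -
        have r: "cmod (EL (zt W) - qc) < 1" "N2 (zt W) \<noteq> 0"
        "m * cmod (N2 (zt W)) \<le> cmod (N1 (zt W))" "m * cmod (N1 (zt W)) \<le> cmod (N2 (zt W))"
          using R3(2)[of W] disc[OF W] by auto
        show "N2 (zt W) \<noteq> 0" by fact
        have p: "0 < cmod (N2 (zt W))" using r by simp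
        show "m \<le> cmod (N1 (zt W)) / cmod (N2 (zt W))" using r p by (simp add: pos_le_divide_eq)
        show "cmod (N1 (zt W)) / cmod (N2 (zt W)) \<le> 1 / m" using r p m by (simp add: field_simps)
        have "0 < m * cmod (N2 (zt W))" using p m by simp
        then have "0 < cmod (N1 (zt W))" using r by linarith
        then show "N1 (zt W) \<noteq> 0" by simp
        show "E1 (zt W) \<noteq> 0" using R1(2)[of W] disc[OF W] by auto
        show "EL (zt W) \<noteq> 0"
        proof
          assume "EL (zt W) = 0"
          then have "cmod qc < 1" using r(1) by simp
          then show False using norm_qc by simp
        qed
      qed
      have F01: "\<not> (F W = 0 \<or> F W = 1)" if W: "W \<in> cball ?W0 (2 * t)" for W
      proof -
        have "F W \<noteq> 0" unfolding F_def using nz[OF W] norm_qc by simp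
        moreover have "F W \<noteq> 1"
        proof
          assume "F W = 1"
          then have "- E1 (zt W) * N1 (zt W) = cis \<alpha> * qc * N2 (zt W)"
            unfolding F_def by (rule conjunct2[OF iffD1[OF divide_eq_1_iff]])
          then have "cis \<alpha> * qc * N2 (zt W) + E1 (zt W) * N1 (zt W) = 0"
            by (simp flip: \<open>- E1 (zt W) * N1 (zt W) = cis \<alpha> * qc * N2 (zt W)\<close>)
          then have "D (zt W) * EL (zt W) = 0" unfolding pl by simp
          then show False using D[OF W] nz[OF W] by simp
        qed
        ultimately show ?thesis by simp
      qed
      have holF: "F holomorphic_on cball ?W0 (2 * t)"
      proof -
        have "cball ?W0 (2 * t) \<inter> \<real>\<^sub>\<le>\<^sub>0 = {}" using disc(1) by (force simp: complex_nonpos_Reals_iff simp del: mem_cball)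
        then have z: "zt holomorphic_on cball ?W0 (2 * t)" by (rule zt_holomorphic)
        have comp: "(\<lambda>W. f (zt W)) holomorphic_on cball ?W0 (2 * t)" if "f holomorphic_on UNIV" for f
          using holomorphic_on_compose[OF z holomorphic_on_subset[OF that]] by (simp add: o_def)
        show ?thesis unfolding F_def[abs_def]
          by (intro holomorphic_intros comp hol brackets_holomorphic) (use nz norm_qc in auto)
      qed
      define f where "f z = F (?W0 + of_real (2 * t) * z)" for z
      have in_disc: "?W0 + of_real (2 * t) * z \<in> cball ?W0 (2 * t)" if "z \<in> cball 0 1" for z
        using that t by (simp add: dist_norm norm_mult mult_left_le)
      have holf: "f holomorphic_on cball 0 1"
        unfolding f_def[abs_def]
        by (rule holomorphic_on_compose_gen[of "\<lambda>z. ?W0 + of_real (2 * t) * z" _ F "cball ?W0 (2 * t)", unfolded o_def])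
           (use in_disc holF in \<open>auto intro!: holomorphic_intros\<close>)
      have W0: "?W0 \<in> cball ?W0 (2 * t)" using t by simp
      have "cmod (E1 (zt ?W0)) * cmod (E1 (zt ?W0)) \<le> 10"
        using R1(2)[of ?W0] disc[OF W0] E1_neutral_axis[OF half, of N] N1 by auto
      then have "(cmod (E1 (zt ?W0)))\<^sup>2 \<le> 4\<^sup>2" by (simp add: power2_eq_square)
      then have "cmod (E1 (zt ?W0)) \<le> 4" by (rule power2_le_imp_le) simp
      then have "cmod (E1 (zt ?W0)) * (cmod (N1 (zt ?W0)) / cmod (N2 (zt ?W0))) / 2 \<le> 4 * (1 / m) / 2"
        using ratio[OF W0] m by (intro divide_right_mono mult_mono) auto
      then have f0: "cmod (f 0) \<le> C1" unfolding f_def C1_def using nF[of ?W0] by simp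
      have "cmod (f (1/2)) \<le> S"
        unfolding S_def by (rule Schottky[OF holf f0]) (use F01 in_disc in \<open>auto simp: f_def\<close>)
      moreover have "S < cmod (f (1/2))"
      proof -
        define W where "W = ?W0 + of_real t"
        have fW: "f (1/2) = F W" by (simp add: f_def W_def)
        have Wd: "W \<in> cball ?W0 (2 * t)" using t by (simp add: W_def dist_norm)
        have "W \<in> quadrant R2" using disc[OF Wd] t N1 by (auto simp: quadrant_def W_def)
        then have e: "exp (c * t) \<le> B * cmod (E1 (zt W))" using c(4)[of W] by (simp add: W_def)
        have "c * t = 2 * B * (S + 1) / m" unfolding t_def using c by simp
        moreover have "2 * B * S / m \<le> 2 * B * (S + 1) / m" using c m by (intro divide_right_mono mult_left_mono) auto
        ultimately have "2 * B * S / m < 1 + c * t" by linarith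
        also have "\<dots> \<le> exp (c * t)" using exp_ge_add_one_self[of "c * t"] by simp
        also note e
        finally have "S < cmod (E1 (zt W)) * m / 2" using c m by (simp add: field_simps)
        also have "\<dots> \<le> cmod (F W)" unfolding nF using ratio(1)[OF Wd] by (intro divide_right_mono mult_left_mono) auto
        finally show ?thesis unfolding fW .
      qed
      ultimately show False by simp
    qed
  qed
qed

text \<open>The fourth solution is the one with data (0, 1), so N1 and N2 are -\<open>fa\<close> at
  good arguments. After removal of a common power both lie within a factor 2 of |\<open>u0\<close>|,
  which bounds their ratio by 4.\<close>

lemma fa_zeros: "\<exists>r>0. \<exists>N0. \<forall>N\<ge>N0. \<exists>W. cmod (W - \<i> * of_real N) \<le> r \<and> fa (zt W) = 0"
proof (rule zeros_near_imaginary_axis)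
  show "(\<lambda>\<zeta>. - fa (cis \<theta> * \<zeta>)) holomorphic_on UNIV" "(\<lambda>\<zeta>. - fa (cis (- 2 * \<theta>) * \<zeta>)) holomorphic_on UNIV"
    by (intro holomorphic_intros brackets_holomorphic)+
  show "fa \<zeta> * EL \<zeta> = - (cis \<alpha> * qc * - fa (cis (- 2 * \<theta>) * \<zeta>) + E1 \<zeta> * - fa (cis \<theta> * \<zeta>))" for \<zeta>
  proof -
    define w where "w = cis (- \<alpha>)"
    define v where "v = cis \<alpha>"
    have wv: "w * v = 1" by (simp add: w_def v_def cis_mult)
    have w2: "cis (- 2 * \<alpha>) = w * w" by (simp add: w_def cis_mult)
    show ?thesis
      using plucker_one_sided[OF wv quantum_wronskian_shifts(2)[of \<zeta>, folded w_def]]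
      unfolding EL_def E1_def w2 w_def[symmetric] v_def[symmetric] by blast
  qed
  show "0 < (1/4 :: real)" by simp
  have b: "bounded ((\<lambda>_. u0) ` {0..\<theta>})" by (rule bounded_subset[of "{u0}"]) auto
  have 1: "uniform_limit {0..\<theta>} (\<lambda>\<rho> \<phi>. sc0 \<rho> (\<phi> + (\<theta> - pi))) (\<lambda>_. u0) at_top"
    by (rule uniform_limit_pull[OF sc_uniform_limit(1) good_shifts(1)[OF half]])
  have 2: "uniform_limit {0..\<theta>} (\<lambda>\<rho> \<phi>. sc0 \<rho> (\<phi> + (- 2 * \<theta> + pi))) (\<lambda>_. u0) at_top"
    by (rule uniform_limit_pull[OF sc_uniform_limit(1) good_shifts(2)[OF half]])
  show "\<forall>\<^sub>F \<rho> in at_top. \<forall>\<phi>\<in>{0..\<theta>}. - fa (cis (- 2 * \<theta>) * (of_real \<rho> * cis \<phi>)) \<noteq> 0 \<and>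
      1/4 * cmod (- fa (cis (- 2 * \<theta>) * (of_real \<rho> * cis \<phi>))) \<le> cmod (- fa (cis \<theta> * (of_real \<rho> * cis \<phi>))) \<and>
      1/4 * cmod (- fa (cis \<theta> * (of_real \<rho> * cis \<phi>))) \<le> cmod (- fa (cis (- 2 * \<theta>) * (of_real \<rho> * cis \<phi>)))"
    using eventually_norm_bounds[OF 1 u01_nonzero(1)[OF half]] eventually_norm_bounds[OF 2 u01_nonzero(1)[OF half]] eventually_gt_at_top[of 0]
  proof eventually_elim
    case (elim \<rho>)
    show ?case
    proof
      fix \<phi> assume \<phi>: "\<phi> \<in> {0..\<theta>}"
      have a: "cmod (fa (cis \<theta> * (of_real \<rho> * cis \<phi>))) = \<rho> powr - pw * cmod (sc0 \<rho> (\<phi> + (\<theta> - pi)))"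
        "cmod (fa (cis (- 2 * \<theta>) * (of_real \<rho> * cis \<phi>))) = \<rho> powr - pw * cmod (sc0 \<rho> (\<phi> + (- 2 * \<theta> + pi)))"
        unfolding rot fa_fb_sc(1)[OF elim(3) cis_shift(2)[of \<phi> \<theta>]] fa_fb_sc(1)[OF elim(3) cis_shift(3)[of \<phi> "- 2 * \<theta>"]]
        by (simp_all add: norm_mult)
      have p: "0 < \<rho> powr - pw" using elim by simp
      have u: "0 < cmod u0" using u01_nonzero[OF half] by simp
      have s: "cmod u0 / 2 \<le> cmod (sc0 \<rho> (\<phi> + (\<theta> - pi)))" "cmod (sc0 \<rho> (\<phi> + (\<theta> - pi))) \<le> 2 * cmod u0"
        "cmod u0 / 2 \<le> cmod (sc0 \<rho> (\<phi> + (- 2 * \<theta> + pi)))" "cmod (sc0 \<rho> (\<phi> + (- 2 * \<theta> + pi))) \<le> 2 * cmod u0"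
        using elim \<phi> by auto
      have "0 < cmod (sc0 \<rho> (\<phi> + (- 2 * \<theta> + pi)))" using s u by linarith
      then have "cmod (fa (cis (- 2 * \<theta>) * (of_real \<rho> * cis \<phi>))) \<noteq> 0" unfolding a using p by simp
      moreover have "1/4 * cmod (sc0 \<rho> (\<phi> + (- 2 * \<theta> + pi))) \<le> cmod (sc0 \<rho> (\<phi> + (\<theta> - pi)))"
        "1/4 * cmod (sc0 \<rho> (\<phi> + (\<theta> - pi))) \<le> cmod (sc0 \<rho> (\<phi> + (- 2 * \<theta> + pi)))" using s by linarith+
      then have "1/4 * cmod (fa (cis (- 2 * \<theta>) * (of_real \<rho> * cis \<phi>))) \<le> cmod (fa (cis \<theta> * (of_real \<rho> * cis \<phi>)))"
        "1/4 * cmod (fa (cis \<theta> * (of_real \<rho> * cis \<phi>))) \<le> cmod (fa (cis (- 2 * \<theta>) * (of_real \<rho> * cis \<phi>)))"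
        unfolding a using p by (simp_all add: mult.left_commute[of "1/4"] del: times_divide_eq_left)
      ultimately show "- fa (cis (- 2 * \<theta>) * (of_real \<rho> * cis \<phi>)) \<noteq> 0 \<and>
      1/4 * cmod (- fa (cis (- 2 * \<theta>) * (of_real \<rho> * cis \<phi>))) \<le> cmod (- fa (cis \<theta> * (of_real \<rho> * cis \<phi>))) \<and>
      1/4 * cmod (- fa (cis \<theta> * (of_real \<rho> * cis \<phi>))) \<le> cmod (- fa (cis (- 2 * \<theta>) * (of_real \<rho> * cis \<phi>)))" by simp
    qed
  qed
qed

text \<open>The fourth solution is the reflected decaying one, and N1, N2 are brackets with limits
  c1, c2. In c1 the two phases coincide; in c2 they differ by exp(-i pi/(k+1)), which is not -1
  since k >= 1. So neither limit vanishes and the ratio stays bounded both ways.\<close>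

lemma two_sided_zeros: "\<exists>r>0. \<exists>N0. \<forall>N\<ge>N0. \<exists>W. cmod (W - \<i> * of_real N) \<le> r \<and>
   - (fa (zt W) * fb (- zt W)) - fb (zt W) * fa (- zt W) = 0"
proof -
  define N1 where "N1 \<zeta> = cis \<alpha> * (fa (cis pi * \<zeta>) * fb (cis \<theta> * \<zeta>)) + 1 * (fa (cis \<theta> * \<zeta>) * fb (cis pi * \<zeta>))" for \<zeta>
  define N2 where "N2 \<zeta> = cis (- 2 * \<alpha>) * (fa (cis pi * \<zeta>) * fb (cis (- 2 * \<theta>) * \<zeta>)) + 1 * (fa (cis (- 2 * \<theta>) * \<zeta>) * fb (cis pi * \<zeta>))" for \<zeta>
  define c1 where "c1 = u0 * u1 * (cis \<alpha> * cis (pw * ((\<theta> - pi) - 0)) + 1 * cis (- pw * ((\<theta> - pi) - 0)))"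
  define c2 where "c2 = u0 * u1 * (cis (- 2 * \<alpha>) * cis (pw * ((- 2 * \<theta> + pi) - 0)) + 1 * cis (- pw * ((- 2 * \<theta> + pi) - 0)))"
  have c1: "c1 \<noteq> 0"
  proof -
    have "cis \<alpha> * cis (pw * ((\<theta> - pi) - 0)) = cis (- pw * ((\<theta> - pi) - 0))"
      unfolding cis_mult by (simp add: alpha_eq algebra_simps)
    then show ?thesis unfolding c1_def using u01_nonzero[OF half] by simp
  qed
  have c2: "c2 \<noteq> 0"
  proof -
    have ph: "- 2 * \<alpha> + pw * (- 2 * \<theta> + pi - 0) = - pw * (- 2 * \<theta> + pi - 0) + - 2 * pw * pi"
      by (simp add: alpha_eq algebra_simps)
    have e: "cis (- 2 * \<alpha>) * cis (pw * ((- 2 * \<theta> + pi) - 0)) = cis (- pw * (- 2 * \<theta> + pi - 0)) * cis (- 2 * pw * pi)"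
      unfolding cis_mult ph ..
    have p: "2 * pw * pi = pi / real (Suc k)" unfolding pw_def by (simp del: of_nat_Suc)
    have "2 \<le> real (Suc k)" using k_pos by simp
    then have "pi / real (Suc k) \<le> pi / 2" by (intro divide_left_mono) (auto simp del: of_nat_Suc)
    moreover have "0 < pi / real (Suc k)" by simp
    ultimately have "0 \<le> cos (2 * pw * pi)" unfolding p by (intro cos_ge_zero) linarith+
    then have "Re (cis (- 2 * pw * pi) + 1) \<noteq> 0" by simp
    then have "cis (- 2 * pw * pi) + 1 \<noteq> 0" by (metis zero_complex.simps(1))
    moreover have "c2 = u0 * u1 * (cis (- pw * (- 2 * \<theta> + pi - 0)) * (cis (- 2 * pw * pi) + 1))"
      unfolding c2_def e by (simp add: algebra_simps)
    ultimately show ?thesis using u01_nonzero[OF half] by simp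
  qed
  have l1: "uniform_limit {0..\<theta>} (\<lambda>\<rho> \<phi>. N1 (of_real \<rho> * cis \<phi>)) (\<lambda>_. c1) at_top"
    unfolding N1_def rot c1_def
    by (rule bracket_limit[OF good_shifts(3)[OF half] good_shifts(1)[OF half] _ cis_shift(2)]) (simp_all add: cis_mult[symmetric])
  have l2: "uniform_limit {0..\<theta>} (\<lambda>\<rho> \<phi>. N2 (of_real \<rho> * cis \<phi>)) (\<lambda>_. c2) at_top"
    unfolding N2_def rot c2_def
    by (rule bracket_limit[OF good_shifts(3)[OF half] good_shifts(2)[OF half] _ cis_shift(3)]) (simp_all add: cis_mult[symmetric])
  define m where "m = min (cmod c1 / (4 * cmod c2)) (cmod c2 / (4 * cmod c1))"
  have m: "0 < m" using c1 c2 by (simp add: m_def)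
  show ?thesis
  proof (rule zeros_near_imaginary_axis[OF _ _ _ m])
    show "N1 holomorphic_on UNIV" "N2 holomorphic_on UNIV"
      unfolding N1_def[abs_def] N2_def[abs_def] by (intro holomorphic_intros brackets_holomorphic)+
    show "(- (fa \<zeta> * fb (- \<zeta>)) - fb \<zeta> * fa (- \<zeta>)) * EL \<zeta> = - (cis \<alpha> * qc * N2 \<zeta> + E1 \<zeta> * N1 \<zeta>)" for \<zeta>
    proof -
      define w where "w = cis (- \<alpha>)"
      define v where "v = cis \<alpha>"
      have wv: "w * v = 1" by (simp add: w_def v_def cis_mult)
      have w2: "cis (- 2 * \<alpha>) = w * w" by (simp add: w_def cis_mult)
      have n: "cis pi * \<zeta> = - \<zeta>" by simp
      show ?thesis
        using plucker_two_sided[OF wv quantum_wronskian_shifts(2)[of \<zeta>, folded w_def]]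
        unfolding EL_def E1_def N1_def N2_def w2 n w_def[symmetric] v_def[symmetric] by blast
    qed
    show "\<forall>\<^sub>F \<rho> in at_top. \<forall>\<phi>\<in>{0..\<theta>}. N2 (of_real \<rho> * cis \<phi>) \<noteq> 0 \<and>
        m * cmod (N2 (of_real \<rho> * cis \<phi>)) \<le> cmod (N1 (of_real \<rho> * cis \<phi>)) \<and> m * cmod (N1 (of_real \<rho> * cis \<phi>)) \<le> cmod (N2 (of_real \<rho> * cis \<phi>))"
      using eventually_norm_bounds[OF l1 c1] eventually_norm_bounds[OF l2 c2]
    proof eventually_elim
      case (elim \<rho>)
      show ?case
      proof
        fix \<phi> assume \<phi>: "\<phi> \<in> {0..\<theta>}"
        let ?x = "cmod (N1 (of_real \<rho> * cis \<phi>))" and ?y = "cmod (N2 (of_real \<rho> * cis \<phi>))"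
        have s: "cmod c1 / 2 \<le> ?x" "?x \<le> 2 * cmod c1" "cmod c2 / 2 \<le> ?y" "?y \<le> 2 * cmod c2"
          using elim \<phi> by auto
        have c12: "0 < cmod c1" "0 < cmod c2" using c1 c2 by auto
        have "m * ?y \<le> cmod c1 / (4 * cmod c2) * (2 * cmod c2)" using s m by (intro mult_mono) (auto simp: m_def)
        also have "\<dots> = cmod c1 / 2" using c12 by simp
        finally have 1: "m * ?y \<le> ?x" using s by linarith
        have "m * ?x \<le> cmod c2 / (4 * cmod c1) * (2 * cmod c1)" using s m by (intro mult_mono) (auto simp: m_def)
        also have "\<dots> = cmod c2 / 2" using c12 by simp
        finally have 2: "m * ?x \<le> ?y" using s by linarith
        have "0 < ?y" using s c12 by linarith
        then show "N2 (of_real \<rho> * cis \<phi>) \<noteq> 0 \<and> m * ?y \<le> ?x \<and> m * ?x \<le> ?y" using 1 2 by simp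
      qed
    qed
  qed
qed

end

end

section \<open>Bounded eigenfunctions\<close>

lemma bounded_continuous_Linfty:
  assumes "continuous_on UNIV f" "\<And>x. cmod (f x) \<le> C"
  shows "f \<in> Linfty"
proof -
  have "f \<in> borel_measurable borel" using assms(1) by (rule borel_measurable_continuous_onI)
  then have "f \<in> borel_measurable lebesgue" by (simp add: measurable_completion)
  then show ?thesis using assms(2) by (auto simp: Linfty_def intro!: exI[of _ C])
qed

context exponents
begin

lemma solves_ode_sol: "solves_ode k l \<zeta> (\<lambda>x. sol 1 (- \<zeta>) p q (of_real x))"
  unfolding solves_ode_def
proof (intro exI allI conjI)
  fix x :: real
  show "((\<lambda>x. sol 1 (- \<zeta>) p q (of_real x)) has_vector_derivative sol' 1 (- \<zeta>) p q (of_real x)) (at x)"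
    by (rule has_vector_derivative_of_real_comp[OF sol_has_field_derivative])
  show "((\<lambda>x. sol' 1 (- \<zeta>) p q (of_real x)) has_vector_derivative (Q 1 (- \<zeta>) (of_real x))\<^sup>2 * sol 1 (- \<zeta>) p q (of_real x)) (at x)"
    by (rule has_vector_derivative_of_real_comp[OF sol'_has_field_derivative])
  show "- ((Q 1 (- \<zeta>) (of_real x))\<^sup>2 * sol 1 (- \<zeta>) p q (of_real x)) +
      (complex_of_real x ^ l - complex_of_real x ^ k * \<zeta>)\<^sup>2 * sol 1 (- \<zeta>) p q (of_real x) = 0"
    by (simp add: Q_def mult.commute)
qed

lemma admitsI:
  assumes nz: "p \<noteq> 0 \<or> q \<noteq> 0" and bd: "\<And>x::real. cmod (sol 1 (- \<zeta>) p q (of_real x)) \<le> C"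
  shows "admits_bounded_solution k l \<zeta>"
proof -
  let ?f = "\<lambda>x::real. sol 1 (- \<zeta>) p q (of_real x)"
  have der: "(?f has_vector_derivative sol' 1 (- \<zeta>) p q (of_real x)) (at x)" for x
    by (rule has_vector_derivative_of_real_comp[OF sol_has_field_derivative])
  then have "continuous_on UNIV ?f"
    by (intro continuous_at_imp_continuous_on ballI has_vector_derivative_continuous)
  then have "?f \<in> Linfty" by (rule bounded_continuous_Linfty) (rule bd)
  moreover have "\<exists>x. ?f x \<noteq> 0"
  proof (rule ccontr)
    assume "\<not> ?thesis"
    then have z: "?f = (\<lambda>_. 0)" by auto
    then have "p = 0" using fun_cong[OF z, of 0] by simp
    have "((\<lambda>_::real. 0::complex) has_vector_derivative q) (at 0)" using der[of 0] unfolding z by simp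
    moreover have "((\<lambda>_::real. 0::complex) has_vector_derivative 0) (at 0)" by (rule has_vector_derivative_const)
    ultimately have "q = 0" by (rule vector_derivative_unique_at)
    then show False using nz \<open>p = 0\<close> by simp
  qed
  ultimately show ?thesis unfolding admits_bounded_solution_def using solves_ode_sol by blast
qed

lemma rec_sol_bounded_right: "\<exists>C. \<forall>x\<ge>0. cmod (sol 1 (- \<zeta>) (fa \<zeta>) (fb \<zeta>) (of_real x)) \<le> C"
proof -
  obtain \<kappa> \<mu> R where "admissible \<kappa> \<mu> R 1 (- \<zeta>)" "0 < \<kappa>" "\<kappa> \<le> 1" "0 < \<mu>" "0 < R" using admissible_one by blast
  from rec_sol_bounded[OF this] show ?thesis by (simp add: rec_sol_def fa_def fb_def)
qed

lemma fa_fb_not_both_zero: "fa \<zeta> \<noteq> 0 \<or> fb \<zeta> \<noteq> 0"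
  using quantum_wronskian_shifts(1)[of \<zeta>] norm_qc by auto

text \<open>With l + 1 and k + 1 even, reflection preserves both coefficients. A decaying solution
  that vanishes at 0 is then odd, and boundedness on the right gives boundedness on the
  left.\<close>

lemma admits_of_fa_zero:
  assumes ev: "even (Suc l)" "even (Suc k)" and z: "fa \<zeta> = 0"
  shows "admits_bounded_solution k l \<zeta>"
proof -
  let ?f = "\<lambda>x::real. sol 1 (- \<zeta>) 0 (fb \<zeta>) (of_real x)"
  obtain C where C: "\<And>x. 0 \<le> x \<Longrightarrow> cmod (?f x) \<le> C" using rec_sol_bounded_right[of \<zeta>] unfolding z by blast
  have odd: "?f (- x) = - ?f x" for x
  proof -
    have "sol (1 * (- 1) ^ Suc l) (- \<zeta> * (- 1) ^ Suc k) 0 (- 1 * fb \<zeta>) (of_real x) = sol 1 (- \<zeta>) 0 (fb \<zeta>) (- 1 * of_real x)"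
      by (rule sol_scale)
    then have "?f (- x) = sol 1 (- \<zeta>) 0 (- fb \<zeta>) (of_real x)" using ev by (simp del: power_Suc)
    also have "\<dots> = - ?f x"
      using sol_linear[of 1 "- \<zeta>" 0 "- fb \<zeta>" "of_real x"] sol_linear[of 1 "- \<zeta>" 0 "fb \<zeta>" "of_real x"] by simp
    finally show ?thesis .
  qed
  show ?thesis
  proof (rule admitsI)
    show "0 \<noteq> (0::complex) \<or> fb \<zeta> \<noteq> 0" using fa_fb_not_both_zero[of \<zeta>] z by simp
    show "cmod (sol 1 (- \<zeta>) 0 (fb \<zeta>) (of_real x)) \<le> C" for x
    proof (cases "0 \<le> x")
      case False
      then have "cmod (?f (- x)) \<le> C" by (intro C) simp
      then show ?thesis unfolding odd by simp
    qed (rule C)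
  qed
qed

text \<open>With k + 1 odd, reflection turns zeta into -zeta. The vanishing Wronskian makes the data
  at 0 of the right and left decaying solutions proportional, so one solution is bounded on both
  sides.\<close>

lemma admits_of_two_sided_zero:
  assumes ev: "even (Suc l)" "odd (Suc k)" and z: "- (fa \<zeta> * fb (- \<zeta>)) - fb \<zeta> * fa (- \<zeta>) = 0"
  shows "admits_bounded_solution k l \<zeta>"
proof -
  obtain C1 where C1: "\<And>x. 0 \<le> x \<Longrightarrow> cmod (sol 1 (- \<zeta>) (fa \<zeta>) (fb \<zeta>) (of_real x)) \<le> C1"
    using rec_sol_bounded_right[of \<zeta>] by blast
  obtain C2 where C2: "\<And>x. 0 \<le> x \<Longrightarrow> cmod (sol 1 \<zeta> (fa (- \<zeta>)) (fb (- \<zeta>)) (of_real x)) \<le> C2"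
    using rec_sol_bounded_right[of "- \<zeta>"] by auto
  let ?p = "fa (- \<zeta>)" and ?q = "- fb (- \<zeta>)"
  have reflect: "sol 1 (- \<zeta>) ?p ?q (of_real x) = sol 1 \<zeta> (fa (- \<zeta>)) (fb (- \<zeta>)) (of_real (- x))" for x
  proof -
    have "sol (1 * (- 1) ^ Suc l) (\<zeta> * (- 1) ^ Suc k) (fa (- \<zeta>)) (- 1 * fb (- \<zeta>)) (of_real x) = sol 1 \<zeta> (fa (- \<zeta>)) (fb (- \<zeta>)) (- 1 * of_real x)"
      by (rule sol_scale)
    then show ?thesis using ev by (simp del: power_Suc)
  qed
  have pq: "?p \<noteq> 0 \<or> ?q \<noteq> 0" using fa_fb_not_both_zero[of "- \<zeta>"] by simp
  have cross: "fa \<zeta> * ?q = fb \<zeta> * ?p" using z by simp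
  obtain c where c: "fa \<zeta> = c * ?p" "fb \<zeta> = c * ?q"
  proof (cases "?p = 0")
    case True
    then have "fa \<zeta> = 0" using cross pq by auto
    then show ?thesis using that[of "fb \<zeta> / ?q"] True pq by auto
  next
    case False
    then show ?thesis using that[of "fa \<zeta> / ?p"] cross by (auto simp: field_simps)
  qed
  have proportional: "sol 1 (- \<zeta>) (fa \<zeta>) (fb \<zeta>) z = c * sol 1 (- \<zeta>) ?p ?q z" for z
    unfolding c sol_linear[of 1 "- \<zeta>" "c * ?p" "c * ?q" z] sol_linear[of 1 "- \<zeta>" ?p ?q z]
    by (simp only: distrib_left mult.assoc)
  show ?thesis
  proof (rule admitsI[OF fa_fb_not_both_zero])
    fix x :: real
    show "cmod (sol 1 (- \<zeta>) (fa \<zeta>) (fb \<zeta>) (of_real x)) \<le> max C1 (cmod c * C2)"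
    proof (cases "0 \<le> x")
      case True then show ?thesis using C1[of x] by simp
    next
      case False
      then have "cmod (sol 1 (- \<zeta>) ?p ?q (of_real x)) \<le> C2" unfolding reflect by (intro C2) simp
      then have "cmod c * cmod (sol 1 (- \<zeta>) ?p ?q (of_real x)) \<le> cmod c * C2" by (intro mult_left_mono) auto
      then show ?thesis unfolding proportional norm_mult by simp
    qed
  qed
qed

text \<open>The divisibility gives k + 1 = (m - 1)(l - k) and \<open>\<theta>\<close> = pi/m, where
  m >= 2 because l - k < l + 1. If l - k is even, so are l + 1 and k + 1; if l - k is odd and m
  even, then l + 1 is even and k + 1 odd. These are the two symmetric situations treated
  before.\<close>

lemma eigenvalues_near_imaginary_axis:
  assumes m: "Suc l = m * (l - k)" and par: "even (l - k) \<or> even m"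
  shows "\<exists>r>0. \<exists>N0. \<forall>N\<ge>N0. \<exists>W. cmod (W - \<i> * of_real N) \<le> r \<and> admits_bounded_solution k l (zt W)"
proof -
  have d: "0 < l - k" "l - k < Suc l" using k_pos k_less_l by auto
  have m2: "2 \<le> m"
  proof (rule ccontr)
    assume "\<not> 2 \<le> m"
    then have "m \<le> 1" by simp
    then have "m * (l - k) \<le> 1 * (l - k)" by (rule mult_le_mono1)
    then show False using m d by simp
  qed
  have "2 * (l - k) \<le> Suc l" unfolding m using m2 by (intro mult_le_mono1)
  then have "2 * real (l - k) \<le> real (Suc l)" by (metis of_nat_le_iff of_nat_mult of_nat_numeral)
  then have half: "\<theta> \<le> pi / 2" unfolding \<theta>_def by (simp add: field_simps del: of_nat_Suc)
  have ck: "Suc k = (m - 1) * (l - k)"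
    using m k_less_l m2 by (simp add: diff_mult_distrib)
  show ?thesis
  proof (cases "even (l - k)")
    case True
    then have "even (Suc l)" "even (Suc k)" using m ck by (metis dvd_mult)+
    then show ?thesis using fa_zeros[OF half] admits_of_fa_zero by metis
  next
    case False
    then have "even m" using par by simp
    then have "even (Suc l)" using m by (metis dvd_mult2)
    have "odd (m - 1)" using \<open>even m\<close> m2 by simp
    then have "odd (Suc k)" using ck False by (metis even_mult_iff)
    then show ?thesis using two_sided_zeros[OF half] admits_of_two_sided_zero \<open>even (Suc l)\<close> by metis
  qed
qed

lemma zt_imaginary:
  assumes "0 < N"
  shows "zt (\<i> * of_real N) = exp (\<i> * of_real (pi * (real l - real k) / (2 * (real l + 1)))) * of_real (N powr ((real l - real k) / (real l + 1)))"
proof -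
  have e: "ex = (real l - real k) / (real l + 1)" using ex(2) k_less_l by (simp add: of_nat_diff add.commute)
  have A: "Arg (\<i> * of_real N) = pi / 2" unfolding Arg_times_of_real2[OF assms] by simp
  have "zt (\<i> * of_real N) = of_real (N powr ex) * cis (ex * (pi / 2))"
    using assms A by (subst zt_polar) (auto simp: norm_mult)
  moreover have "ex * (pi / 2) = pi * (real l - real k) / (2 * (real l + 1))" unfolding e by (simp add: mult.commute)
  ultimately show ?thesis unfolding e cis_conv_exp by (simp add: mult.commute)
qed

text \<open>A bounded displacement of W is a relative change of order 1/N, and a power with exponent
  at most 1 keeps that order. The constant 4 is a factor 2 from the logarithm times a factor 2 from
  the exponential.\<close>

lemma zt_perturbation:
  assumes N: "0 < N" and W: "cmod (W - \<i> * of_real N) \<le> r" and r: "4 * r \<le> N"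
  shows "\<exists>\<delta>. zt W = zt (\<i> * of_real N) * (1 + \<delta>) \<and> cmod \<delta> \<le> 4 * (r / N)"
proof -
  define z where "z = (W - \<i> * of_real N) / (\<i> * of_real N)"
  have Weq: "W = (\<i> * of_real N) * (1 + z)" unfolding z_def using N by (simp add: field_simps)
  have "cmod z = cmod (W - \<i> * of_real N) / N" unfolding z_def using N by (simp add: norm_divide norm_mult)
  then have z: "cmod z \<le> r / N" using W N by (simp add: divide_right_mono)
  have rN: "r / N \<le> 1/4" using r N by (simp add: field_simps)
  have z4: "cmod z \<le> 1/4" using z rN by linarith
  have L: "cmod (Ln (1 + z)) \<le> 2 * cmod z" by (rule norm_Ln_le) (use z4 in simp)
  have re: "0 < Re (1 + z)" using abs_Re_le_cmod[of z] z4 by simp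
  then have im: "\<bar>Im (Ln (1 + z))\<bar> < pi / 2" by (rule Re_Ln_pos_lt_imp)
  have nz: "1 + z \<noteq> 0" using re by (metis less_irrefl zero_complex.simps(1))
  have LnN: "Im (Ln (\<i> * of_real N)) = pi / 2"
    using Arg_times_of_real2[OF N, of \<i>] N by (simp add: Arg_eq_Im_Ln[symmetric])
  have "Ln W = Ln (\<i> * of_real N) + Ln (1 + z)"
    unfolding Weq by (rule Ln_times_simple) (use N nz im LnN in auto)
  then have "zt W = zt (\<i> * of_real N) * exp (of_real ex * Ln (1 + z))"
    unfolding zt_def by (simp add: distrib_left exp_add)
  moreover define u where "u = of_real ex * Ln (1 + z)"
  have ex1: "ex \<le> 1" using cr(4,5) by (simp add: ex_def)
  have "cmod u \<le> 1 * (2 * cmod z)" unfolding u_def norm_mult using ex(1) ex1 L by (intro mult_mono) auto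
  then have u: "cmod u \<le> 2 * (r / N)" using z by simp
  have "cmod (exp u - 1) \<le> 2 * cmod u"
    using norm_exp_bounds(2)[of u] u rN norm_ge_zero[of u] by linarith
  ultimately show ?thesis using u by (intro exI[of _ "exp u - 1"]) (auto simp: u_def)
qed

end

theorem proposition3:
  fixes k l :: nat
  assumes "1 \<le> k" and "k < l"
    and "\<not> cond_i k l"
    and "\<not> cond_ii k l"
  shows "(\<exists>\<zeta>. admits_bounded_solution k l \<zeta>) \<and>
    (\<exists>(\<zeta> :: nat \<Rightarrow> complex) (r :: nat \<Rightarrow> complex) M\<^sub>0.
       r \<in> O(\<lambda>M. 1 / of_nat M) \<and>
       (\<forall>M\<ge>M\<^sub>0. admits_bounded_solution k l (\<zeta> M) \<and>
                 \<zeta> M = leading_term k l M * (1 + r M)))"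
proof -
  interpret exponents k l by unfold_locales fact+
  have kl: "real l - real k = real (l - k)" "real l + 1 = real (Suc l)" using assms(2) by (simp_all add: of_nat_diff)
  obtain mi :: int where mi: "mi > 0" "(real l + 1) / (real l - real k) = of_int mi"
    using assms(3) unfolding cond_i_def by blast
  define m where "m = nat mi"
  have mim: "mi = int m" using mi by (simp add: m_def)
  have "real (Suc l) = real m * real (l - k)"
    using mi(2) assms(2) unfolding kl mim by (simp add: field_simps)
  then have m: "Suc l = m * (l - k)" by (metis of_nat_eq_iff of_nat_mult)
  have par: "even (l - k) \<or> even m"
  proof (rule ccontr)
    assume "\<not> ?thesis"
    then have "odd (int (l - k))" "odd mi" unfolding mim even_of_nat by simp_all
    moreover have "int (l - k) = int l - int k" using assms(2) by (simp only: of_nat_diff less_imp_le)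
    ultimately show False using assms(4) mi(2) unfolding cond_ii_def by metis
  qed
  obtain r0 N0 where r0: "0 < r0" and N0: "\<And>N. N0 \<le> N \<Longrightarrow> \<exists>W. cmod (W - \<i> * of_real N) \<le> r0 \<and> admits_bounded_solution k l (zt W)"
    using eigenvalues_near_imaginary_axis[OF m par] by blast
  \<comment> \<open>With N = M c the modulus of \<open>zt\<close> at i N is that of
    \<open>leading_term\<close>. Eigenvalues lie near i N for every large real N, so the centres may
    be placed at any spacing.\<close>
  define c where "c = pi * (real l + 1) * (real k + 1) / (real l - real k)"
  have c: "0 < c" unfolding c_def using assms(2) by (intro divide_pos_pos mult_pos_pos) auto
  \<comment> \<open>The three thresholds ensure 4 r0 <= N for the perturbation bound, N0 <= N for
    the existence of an eigenvalue, and M >= 1 for N > 0.\<close>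
  obtain M0 :: nat where M0: "max (4 * r0 / c) (max (N0 / c) 1) \<le> real M0" using real_arch_simple by blast
  have ev: "\<exists>\<zeta> \<delta>. admits_bounded_solution k l \<zeta> \<and> \<zeta> = leading_term k l M * (1 + \<delta>) \<and> cmod \<delta> \<le> 4 * r0 / c * (1 / real M)" if M: "M0 \<le> M" for M
  proof -
    define N where "N = real M * c"
    have "real M0 \<le> real M" using M by simp
    then have "4 * r0 / c \<le> real M" "N0 / c \<le> real M" "1 \<le> real M" using M0 by linarith+
    then have N: "4 * r0 \<le> N" "N0 \<le> N" "0 < N" and M1: "1 \<le> real M" unfolding N_def using c by (auto simp: pos_divide_le_eq)
    obtain W where W: "cmod (W - \<i> * of_real N) \<le> r0" "admits_bounded_solution k l (zt W)" using N0[OF N(2)] by blast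
    obtain \<delta> where \<delta>: "zt W = zt (\<i> * of_real N) * (1 + \<delta>)" "cmod \<delta> \<le> 4 * (r0 / N)"
      using zt_perturbation[OF N(3) W(1) N(1)] by blast
    have "zt (\<i> * of_real N) = leading_term k l M"
      using zt_imaginary[OF N(3)] by (simp only: leading_term_def N_def c_def)
    moreover have "4 * (r0 / N) = 4 * r0 / c * (1 / real M)" unfolding N_def by (simp add: mult.commute)
    ultimately show ?thesis using W(2) \<delta> by (intro exI[of _ "zt W"] exI[of _ \<delta>]) auto
  qed
  then obtain \<zeta> \<delta> where zd: "\<And>M. M0 \<le> M \<Longrightarrow> admits_bounded_solution k l (\<zeta> M) \<and> \<zeta> M = leading_term k l M * (1 + \<delta> M) \<and> cmod (\<delta> M) \<le> 4 * r0 / c * (1 / real M)"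
    by metis
  have "\<delta> \<in> O(\<lambda>M. 1 / of_nat M)"
  proof (rule bigoI)
    show "\<forall>\<^sub>F M in sequentially. norm (\<delta> M) \<le> 4 * r0 / c * norm (1 / of_nat M :: complex)"
      using eventually_ge_at_top[of M0] by eventually_elim (use zd in \<open>simp add: norm_divide\<close>)
  qed
  then show ?thesis using zd by blast
qed

end
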